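(* Let $n\ge1$. The assignment $C_I\mapsto Q_I$, for $I$ a connected subset of $\{1,\dots,n\}$, defines a morphism of algebras $$\varphi:\mathfrak{aw}(n)\to\mathrm{U}_q(\mathfrak{sl}_2)^{\otimes n},$$ so that $\mathfrak{aw}(n)$ surjects onto the subalgebra of $\mathrm{U}_q(\mathfrak{sl}_2)^{\otimes n}$ generated by the intermediate Casimir elements $Q_I$, $I$ a connected subset of $\{1,\dots,n\}$.
   Context: Base field $\mathbb{C}(q)$, $q$ an indeterminate. $[A,B]=AB-BA$, $[A,B]_q=\frac{1}{q-q^{-1}}(qAB-q^{-1}BA)$. For $I,J\subseteq\{1,\dots,n\}$, $I<J$ means every element of $I$ is strictly smaller than every element of $J$. A connected subset is a non-empty set of consecutive integers. Two disjoint connected subsets are adjacent if their union is connected. A sequence $(I_1,\dots,I_k)$ of connected subsets is monotonic if $I_1<\dots<I_k$ or $I_1>\dots>I_k$; it is a monotonic sequence of adjacent subsets if moreover $I_j,I_{j+1}$ are adjacent for all $j$. Elements: $C_I$ for $I\subseteq\{1,\dots,n\}$ connected; $C_\varnothing:=1$. Adjacent sets in an index are merged: if $I_1,I_2$ are disjoint, connected and adjacent then $C_{I_1I_2}=C_{I_2I_1}:=C_{I_1\cup I_2}$ (similarly for more sets; e.g. $C_{I_1I_3I_4}$ with $I_3,I_4$ adjacent means $C_{I_1(I_3\cup I_4)}$). If $I_1,I_2$ are disjoint connected subsets and the hole $H$ between them (the set of integers strictly between $I_1$ and $I_2$) is non-empty, then $$C_{I_1I_2}:=-[C_{I_1H},C_{HI_2}]_q+C_{I_1}C_{I_2}+C_HC_{I_1HI_2}$$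 (the order of the pair $(I_1,I_2)$ matters). The algebra $\mathfrak{aw}(n)$ is the unital associative algebra generated by the $C_I$, $I$ a connected subset of $\{1,\dots,n\}$, with relations: (i) $[C_I,C_J]=0$ for connected $I,J$ with $I\cap J=\varnothing$ or $I\subset J$; (ii) $C_{I_1I_2}=-[C_{I_2I_3},C_{I_1I_3}]_q+C_{I_1}C_{I_2}+C_{I_3}C_{I_1I_2I_3}$ for every monotonic sequence $(I_1,I_2,I_3)$ of adjacent connected subsets; (iii) $C_{I_1I_4}=-[C_{I_1I_3},C_{I_3I_4}]_q+C_{I_1}C_{I_4}+C_{I_3}C_{I_1I_3I_4}$ for every monotonic sequence $(I_1,I_2,I_3,I_4)$ of adjacent connected subsets. $\mathrm{U}_q(\mathfrak{sl}_2)$: generated by $E,F,q^{\pm H}$ with $q^HE=q\,Eq^H$, $q^HF=q^{-1}Fq^H$, $[E,F]=\frac{q^{2H}-q^{-2H}}{q-q^{-1}}$; coproduct $\Delta(E)=E\otimes q^{-H}+q^H\otimes E$, $\Delta(F)=F\otimes q^{-H}+q^H\otimes F$, $\Delta(q^{\pm H})=q^{\pm H}\otimes q^{\pm H}$; normalised Casimir element $Q=\frac{1}{q+q^{-1}}\left((q-q^{-1})^2FE+q\,q^{2H}+q^{-1}q^{-2H}\right)$. For $I=\{i,\dots,j\}\subseteq\{1,\dots,n\}$, the intermediate Casimir element is $Q_I=1^{\otimes(i-1)}\otimes\Delta^{(j-i)}(Q)\otimes1^{\otimes(n-j)}\in \mathrm{U}_q(\mathfrak{sl}_2)^{\otimes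 n}$, where $\Delta^{(m)}$ is the $m$-fold iterated coproduct into $m+1$ tensor factors. *)

theory Defs
  imports Complex_Main "HOL-Library.Poly_Mapping"
    "HOL-Computational_Algebra.Polynomial" "HOL-Computational_Algebra.Fraction_Field"
    "HOL-Algebra.Module" "HOL-Algebra.QuotRing" "HOL-Algebra.Subrings"
begin

section \<open>Associative algebras over a field\<close>

text \<open>A unital associative, not necessarily commutative, algebra over the field \<open>'k\<close> is a
  \<^typ>\<open>('k, 'a) module\<close> record, which extends the ring record by a scalar multiplication. (The
  locale \<open>algebra\<close> of HOL-Algebra is not used, because it requires commutativity.)\<close>

definition alg_hom :: "('k, 'a) module \<Rightarrow> ('k, 'b) module \<Rightarrow> ('a \<Rightarrow> 'b) \<Rightarrow> bool" where
  "alg_hom A B h \<longleftrightarrow> h \<in> ring_hom A B \<and>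
     (\<forall>c. \<forall>x \<in> carrier A. h (c \<odot>\<^bsub>A\<^esub> x) = c \<odot>\<^bsub>B\<^esub> h x)"

definition is_subalgebra :: "('k, 'a) module \<Rightarrow> 'a set \<Rightarrow> bool" where
  "is_subalgebra A B \<longleftrightarrow> subring B A \<and> (\<forall>c. \<forall>x \<in> B. c \<odot>\<^bsub>A\<^esub> x \<in> B)"

definition subalgebra_generated :: "('k, 'a) module \<Rightarrow> 'a set \<Rightarrow> 'a set" where
  "subalgebra_generated A S = \<Inter>{B. is_subalgebra A B \<and> S \<subseteq> B}"

text \<open>The algebra of a monoid \<open>G\<close>: the vector space with basis \<open>carrier G\<close>, with the product of
  \<open>G\<close> extended bilinearly.\<close>

definition monoid_algebra :: "('a, 'm) monoid_scheme \<Rightarrow> ('k::field, 'a \<Rightarrow>\<^sub>0 'k) module" where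
  "monoid_algebra G =
     \<lparr>carrier = {f. Poly_Mapping.keys f \<subseteq> carrier G},
      mult = (\<lambda>f g. \<Sum>x\<in>Poly_Mapping.keys f. \<Sum>y\<in>Poly_Mapping.keys g.
        Poly_Mapping.single (x \<otimes>\<^bsub>G\<^esub> y) (Poly_Mapping.lookup f x * Poly_Mapping.lookup g y)),
      one = Poly_Mapping.single \<one>\<^bsub>G\<^esub> 1,
      zero = 0,
      add = (+),
      smult = (\<lambda>c. Poly_Mapping.map ((*) c))\<rparr>"

text \<open>\<^const>\<open>FactRing\<close> forgets the scalar multiplication, so it is added back. A two-sided ideal of a
  unital algebra is automatically a subspace.\<close>

definition quot_algebra :: "('k, 'a) module \<Rightarrow> 'a set \<Rightarrow> ('k, 'a set) module" where
  "quot_algebra A I =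
     \<lparr>carrier = carrier (A Quot I), mult = mult (A Quot I), one = one (A Quot I),
      zero = zero (A Quot I), add = add (A Quot I),
      smult = (\<lambda>c X. \<Union>x\<in>X. I +>\<^bsub>A\<^esub> (c \<odot>\<^bsub>A\<^esub> x))\<rparr>"

text \<open>The linear map induced by the map \<open>h\<close> on basis elements, from a quotient of the vector space
  with that basis to \<open>B\<close>, provided that the linear extension of \<open>h\<close> is constant on each coset.\<close>

definition lin_lift :: "('k::field, 'b) module \<Rightarrow> ('a \<Rightarrow> 'b) \<Rightarrow> ('a \<Rightarrow>\<^sub>0 'k) set \<Rightarrow> 'b" where
  "lin_lift B h X = the_elem
     ((\<lambda>p. finsum B (\<lambda>x. Poly_Mapping.lookup p x \<odot>\<^bsub>B\<^esub> h x) (Poly_Mapping.keys p)) ` X)"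

subsection \<open>Presentations by generators and relations\<close>

definition free_monoid :: "'x set \<Rightarrow> 'x list monoid" where
  "free_monoid X = \<lparr>carrier = lists X, mult = (@), one = []\<rparr>"

definition free_algebra :: "'x set \<Rightarrow> ('k::field, 'x list \<Rightarrow>\<^sub>0 'k) module" where
  "free_algebra X = monoid_algebra (free_monoid X)"

definition gen :: "'x \<Rightarrow> 'x list \<Rightarrow>\<^sub>0 'k::field" where
  "gen x = Poly_Mapping.single [x] 1"

definition presented_algebra ::
    "'x set \<Rightarrow> ('x list \<Rightarrow>\<^sub>0 'k) set \<Rightarrow> ('k::field, ('x list \<Rightarrow>\<^sub>0 'k) set) module" where
  "presented_algebra X R = quot_algebra (free_algebra X) (genideal (free_algebra X) R)"

definition presented_class ::
    "'x set \<Rightarrow> ('x list \<Rightarrow>\<^sub>0 'k) set \<Rightarrow> ('x list \<Rightarrow>\<^sub>0 'k::field) \<Rightarrow> ('x list \<Rightarrow>\<^sub>0 'k) set" where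
  "presented_class X R p = genideal (free_algebra X) R +>\<^bsub>free_algebra X\<^esub> p"

text \<open>The algebra morphism from a presented algebra to \<open>B\<close> sending each generator \<open>x\<close> to \<open>g x\<close>.\<close>

definition presented_lift ::
    "('k::field, 'b) module \<Rightarrow> ('x \<Rightarrow> 'b) \<Rightarrow> ('x list \<Rightarrow>\<^sub>0 'k) set \<Rightarrow> 'b" where
  "presented_lift B g = lin_lift B (\<lambda>w. foldr (\<lambda>x b. g x \<otimes>\<^bsub>B\<^esub> b) w \<one>\<^bsub>B\<^esub>)"

subsection \<open>Tensor powers of an algebra\<close>

text \<open>The \<open>n\<close>-th tensor power of \<open>A\<close> is the vector space freely spanned by the \<open>n\<close>-tuples of
  elements of \<open>A\<close> modulo multilinearity, with componentwise product; that is, the algebra of the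
  monoid of \<open>n\<close>-tuples modulo the ideal generated by the multilinearity relations (whose span is
  already an ideal).\<close>

definition tuple_monoid :: "('a, 'm) monoid_scheme \<Rightarrow> nat \<Rightarrow> 'a list monoid" where
  "tuple_monoid A n = \<lparr>carrier = {xs. length xs = n \<and> set xs \<subseteq> carrier A},
     mult = map2 (mult A), one = replicate n \<one>\<^bsub>A\<^esub>\<rparr>"

definition multilinearity_relations :: "('k::field, 'a) module \<Rightarrow> nat \<Rightarrow> ('a list \<Rightarrow>\<^sub>0 'k) set" where
  "multilinearity_relations A n =
     {Poly_Mapping.single (xs[i := a \<oplus>\<^bsub>A\<^esub> b]) 1
        - Poly_Mapping.single (xs[i := a]) 1 - Poly_Mapping.single (xs[i := b]) 1 | xs i a b.
        xs \<in> carrier (tuple_monoid A n) \<and> i < n \<and> a \<in> carrier A \<and> b \<in> carrier A} \<union>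
     {Poly_Mapping.single (xs[i := c \<odot>\<^bsub>A\<^esub> a]) 1 - Poly_Mapping.single (xs[i := a]) c | xs i a c.
        xs \<in> carrier (tuple_monoid A n) \<and> i < n \<and> a \<in> carrier A}"

definition tensor_ideal :: "('k::field, 'a) module \<Rightarrow> nat \<Rightarrow> ('a list \<Rightarrow>\<^sub>0 'k) set" where
  "tensor_ideal A n = genideal (monoid_algebra (tuple_monoid A n)) (multilinearity_relations A n)"

definition tensor_power ::
    "('k::field, 'a) module \<Rightarrow> nat \<Rightarrow> ('k, ('a list \<Rightarrow>\<^sub>0 'k) set) module" where
  "tensor_power A n = quot_algebra (monoid_algebra (tuple_monoid A n)) (tensor_ideal A n)"

definition pure_tensor :: "('k::field, 'a) module \<Rightarrow> 'a list \<Rightarrow> ('a list \<Rightarrow>\<^sub>0 'k) set" where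
  "pure_tensor A xs = tensor_ideal A (length xs)
     +>\<^bsub>monoid_algebra (tuple_monoid A (length xs))\<^esub> Poly_Mapping.single xs 1"

text \<open>\<open>tensor_concat A a b X Y\<close> is \<open>X \<otimes> Y\<close> for \<open>X\<close> in the \<open>a\<close>-th and \<open>Y\<close> in the \<open>b\<close>-th tensor
  power of \<open>A\<close>.\<close>

definition tensor_concat :: "('k::field, 'a) module \<Rightarrow> nat \<Rightarrow> nat \<Rightarrow>
    ('a list \<Rightarrow>\<^sub>0 'k) set \<Rightarrow> ('a list \<Rightarrow>\<^sub>0 'k) set \<Rightarrow> ('a list \<Rightarrow>\<^sub>0 'k) set" where
  "tensor_concat A a b X Y =
     lin_lift (tensor_power A (a + b))
       (\<lambda>xs. lin_lift (tensor_power A (a + b)) (\<lambda>ys. pure_tensor A (xs @ ys)) Y) X"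


section \<open>The quantum group\<close>

type_synonym Cq = "complex poly fract"

definition qv :: Cq where
  "qv = Fract [:0, 1:] 1"

definition qcomm :: "(Cq, 'a) module \<Rightarrow> 'a \<Rightarrow> 'a \<Rightarrow> 'a" where
  "qcomm A x y = inverse (qv - inverse qv) \<odot>\<^bsub>A\<^esub>
     (qv \<odot>\<^bsub>A\<^esub> (x \<otimes>\<^bsub>A\<^esub> y) \<ominus>\<^bsub>A\<^esub> inverse qv \<odot>\<^bsub>A\<^esub> (y \<otimes>\<^bsub>A\<^esub> x))"

text \<open>The generators \<open>gK\<close> and \<open>gKinv\<close> are $q^H$ and $q^{-H}$.\<close>

datatype uq_gen = gE | gF | gK | gKinv

definition Uq_free :: "(Cq, uq_gen list \<Rightarrow>\<^sub>0 Cq) module" where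
  "Uq_free = free_algebra UNIV"

definition Uq_relations :: "(uq_gen list \<Rightarrow>\<^sub>0 Cq) set" where
  "Uq_relations = (let A = Uq_free; E = gen gE; F = gen gF; K = gen gK; L = gen gKinv in
     {K \<otimes>\<^bsub>A\<^esub> L \<ominus>\<^bsub>A\<^esub> \<one>\<^bsub>A\<^esub>,
      L \<otimes>\<^bsub>A\<^esub> K \<ominus>\<^bsub>A\<^esub> \<one>\<^bsub>A\<^esub>,
      K \<otimes>\<^bsub>A\<^esub> E \<ominus>\<^bsub>A\<^esub> qv \<odot>\<^bsub>A\<^esub> (E \<otimes>\<^bsub>A\<^esub> K),
      K \<otimes>\<^bsub>A\<^esub> F \<ominus>\<^bsub>A\<^esub> inverse qv \<odot>\<^bsub>A\<^esub> (F \<otimes>\<^bsub>A\<^esub> K),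
      (E \<otimes>\<^bsub>A\<^esub> F \<ominus>\<^bsub>A\<^esub> F \<otimes>\<^bsub>A\<^esub> E)
        \<ominus>\<^bsub>A\<^esub> inverse (qv - inverse qv) \<odot>\<^bsub>A\<^esub> (K \<otimes>\<^bsub>A\<^esub> K \<ominus>\<^bsub>A\<^esub> L \<otimes>\<^bsub>A\<^esub> L)})"

type_synonym Uq_elem = "(uq_gen list \<Rightarrow>\<^sub>0 Cq) set"

definition Uq :: "(Cq, Uq_elem) module" where
  "Uq = presented_algebra UNIV Uq_relations"

definition uq :: "uq_gen \<Rightarrow> Uq_elem" where
  "uq x = presented_class UNIV Uq_relations (gen x)"

type_synonym Uq_tensor = "(Uq_elem list \<Rightarrow>\<^sub>0 Cq) set"

definition Uq_pow :: "nat \<Rightarrow> (Cq, Uq_tensor) module" where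
  "Uq_pow n = tensor_power Uq n"

fun coproduct_gen :: "uq_gen \<Rightarrow> Uq_tensor" where
  "coproduct_gen gE =
     pure_tensor Uq [uq gE, uq gKinv] \<oplus>\<^bsub>Uq_pow 2\<^esub> pure_tensor Uq [uq gK, uq gE]"
| "coproduct_gen gF =
     pure_tensor Uq [uq gF, uq gKinv] \<oplus>\<^bsub>Uq_pow 2\<^esub> pure_tensor Uq [uq gK, uq gF]"
| "coproduct_gen gK = pure_tensor Uq [uq gK, uq gK]"
| "coproduct_gen gKinv = pure_tensor Uq [uq gKinv, uq gKinv]"

definition coproduct :: "Uq_elem \<Rightarrow> Uq_tensor" where
  "coproduct = presented_lift (Uq_pow 2) coproduct_gen"

text \<open>The coproduct applied to the first of \<open>Suc m\<close> tensor factors. By coassociativity the iterated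
  coproduct does not depend on the factor chosen at each step.\<close>

definition coproduct_first :: "nat \<Rightarrow> Uq_tensor \<Rightarrow> Uq_tensor" where
  "coproduct_first m =
     lin_lift (Uq_pow (2 + m))
       (\<lambda>xs. tensor_concat Uq 2 m (coproduct (hd xs)) (pure_tensor Uq (tl xs)))"

primrec iterated_coproduct :: "nat \<Rightarrow> Uq_elem \<Rightarrow> Uq_tensor" where
  "iterated_coproduct 0 x = pure_tensor Uq [x]"
| "iterated_coproduct (Suc m) x = coproduct_first m (iterated_coproduct m x)"

definition casimir :: Uq_elem where
  "casimir = inverse (qv + inverse qv) \<odot>\<^bsub>Uq\<^esub>
     ((qv - inverse qv)\<^sup>2 \<odot>\<^bsub>Uq\<^esub> (uq gF \<otimes>\<^bsub>Uq\<^esub> uq gE)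
      \<oplus>\<^bsub>Uq\<^esub> qv \<odot>\<^bsub>Uq\<^esub> (uq gK \<otimes>\<^bsub>Uq\<^esub> uq gK)
      \<oplus>\<^bsub>Uq\<^esub> inverse qv \<odot>\<^bsub>Uq\<^esub> (uq gKinv \<otimes>\<^bsub>Uq\<^esub> uq gKinv))"


section \<open>Connected subsets and intermediate Casimir elements\<close>

definition connected_subsets :: "nat \<Rightarrow> nat set set" where
  "connected_subsets n = {{i..j} | i j. 1 \<le> i \<and> i \<le> j \<and> j \<le> n}"

definition intermediate_casimir :: "nat \<Rightarrow> nat set \<Rightarrow> Uq_tensor" where
  "intermediate_casimir n I = (let i = Min I; j = Max I in
     tensor_concat Uq (i - 1) (Suc (j - i) + (n - j)) \<one>\<^bsub>Uq_pow (i - 1)\<^esub>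
       (tensor_concat Uq (Suc (j - i)) (n - j)
          (iterated_coproduct (j - i) casimir) \<one>\<^bsub>Uq_pow (n - j)\<^esub>))"

definition set_less :: "nat set \<Rightarrow> nat set \<Rightarrow> bool" where
  "set_less I J \<longleftrightarrow> (\<forall>i\<in>I. \<forall>j\<in>J. i < j)"

definition adjacent :: "nat \<Rightarrow> nat set \<Rightarrow> nat set \<Rightarrow> bool" where
  "adjacent n I J \<longleftrightarrow> I \<in> connected_subsets n \<and> J \<in> connected_subsets n \<and>
     I \<inter> J = {} \<and> I \<union> J \<in> connected_subsets n"

definition monotonic_adjacent :: "nat \<Rightarrow> nat set list \<Rightarrow> bool" where
  "monotonic_adjacent n Is \<longleftrightarrow> set Is \<subseteq> connected_subsets n \<and>
     (sorted_wrt set_less Is \<or> sorted_wrt (\<lambda>I J. set_less J I) Is) \<and>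
     successively (adjacent n) Is"

definition hole :: "nat set \<Rightarrow> nat set \<Rightarrow> nat set" where
  "hole I J = {k. (\<forall>i\<in>I. \<forall>j\<in>J. i < k \<and> k < j) \<or> (\<forall>i\<in>I. \<forall>j\<in>J. j < k \<and> k < i)}"


section \<open>The algebra $\mathfrak{aw}(n)$\<close>

definition aw_free :: "nat \<Rightarrow> (Cq, nat set list \<Rightarrow>\<^sub>0 Cq) module" where
  "aw_free n = free_algebra (connected_subsets n)"

text \<open>\<open>aw_C2 n I J\<close> is $C_{IJ}$ for disjoint connected \<open>I\<close> and \<open>J\<close>. With \<open>H\<close> the hole, \<open>I\<close>, \<open>H\<close> are
  adjacent and so are \<open>H\<close>, \<open>J\<close>, hence the index pairs \<open>IH\<close>, \<open>HJ\<close> and \<open>IHJ\<close> are merged.\<close>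

definition aw_C2 :: "nat \<Rightarrow> nat set \<Rightarrow> nat set \<Rightarrow> nat set list \<Rightarrow>\<^sub>0 Cq" where
  "aw_C2 n I J = (let A = aw_free n; H = hole I J in
     if adjacent n I J then gen (I \<union> J)
     else \<ominus>\<^bsub>A\<^esub> qcomm A (gen (I \<union> H)) (gen (H \<union> J))
       \<oplus>\<^bsub>A\<^esub> gen I \<otimes>\<^bsub>A\<^esub> gen J \<oplus>\<^bsub>A\<^esub> gen H \<otimes>\<^bsub>A\<^esub> gen (I \<union> H \<union> J))"

definition aw_relations :: "nat \<Rightarrow> (nat set list \<Rightarrow>\<^sub>0 Cq) set" where
  "aw_relations n = (let A = aw_free n in
     {gen I \<otimes>\<^bsub>A\<^esub> gen J \<ominus>\<^bsub>A\<^esub> gen J \<otimes>\<^bsub>A\<^esub> gen I | I J.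
        I \<in> connected_subsets n \<and> J \<in> connected_subsets n \<and> (I \<inter> J = {} \<or> I \<subseteq> J)} \<union>
     {aw_C2 n I1 I2 \<ominus>\<^bsub>A\<^esub>
        (\<ominus>\<^bsub>A\<^esub> qcomm A (aw_C2 n I2 I3) (aw_C2 n I1 I3)
          \<oplus>\<^bsub>A\<^esub> gen I1 \<otimes>\<^bsub>A\<^esub> gen I2 \<oplus>\<^bsub>A\<^esub> gen I3 \<otimes>\<^bsub>A\<^esub> gen (I1 \<union> I2 \<union> I3)) | I1 I2 I3.
        monotonic_adjacent n [I1, I2, I3]} \<union>
     {aw_C2 n I1 I4 \<ominus>\<^bsub>A\<^esub>
        (\<ominus>\<^bsub>A\<^esub> qcomm A (aw_C2 n I1 I3) (aw_C2 n I3 I4)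
          \<oplus>\<^bsub>A\<^esub> gen I1 \<otimes>\<^bsub>A\<^esub> gen I4 \<oplus>\<^bsub>A\<^esub> gen I3 \<otimes>\<^bsub>A\<^esub> aw_C2 n I1 (I3 \<union> I4)) | I1 I2 I3 I4.
        monotonic_adjacent n [I1, I2, I3, I4]})"

definition aw :: "nat \<Rightarrow> (Cq, (nat set list \<Rightarrow>\<^sub>0 Cq) set) module" where
  "aw n = presented_algebra (connected_subsets n) (aw_relations n)"

definition aw_C :: "nat \<Rightarrow> nat set \<Rightarrow> (nat set list \<Rightarrow>\<^sub>0 Cq) set" where
  "aw_C n I = presented_class (connected_subsets n) (aw_relations n) (gen I)"

end

theory Submission
  imports Defs
begin

text \<open>
  The intermediate Casimir element of an interval is the Casimir element of the representation obtained by
  multiplying, via the coproduct, the commuting copies of the quantum group at the positions of the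
  interval. So everything reduces to identities between Casimir elements of three or four commuting
  representations. The Casimir element of a product is linear in a few elements of its leftmost factor,
  which therefore drops out: the relations of type (ii) split into identities for two commuting
  representations. In these, moving a factor past another one amounts to an explicit change of the right
  coideal generators, and the relations of type (iii) follow from the same formulas by linearity.
  Decreasing sequences are reduced to increasing ones by the automorphism that exchanges \<open>E\<close> with \<open>F\<close> and
  \<open>q^H\<close> with \<open>q^{-H}\<close>.
\<close>

section \<open>Associative algebras\<close>

text \<open>Let m be the Casimir element times q + q^-1, and let x be one of l, u, v. For commuting
  Y and Z, with M the scaled Casimir element of YZ, the bracket of x_Y with M is q - q^-1 times m_Y
  x_YZ + m_Z e(x) - (q + q^-1) x~, where e is the counit: 1 on l, 0 on u and v. The elements x~ are
  read off from this formula, and pairing them with X gives C_IK, so that its defining formula is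
  recovered. The content of (ii) is that the bracket of M with x~ has the same form with m_Y and m_Z
  exchanged, and returns x_Y. For (iii), x~ is linear in the elements of Z with coefficients from Y,
  which commute with the Casimir element of ZW. Two obstacles shape the rest. Noncommutative
  identities of this size are checked by rewriting to a normal form, so everything is rescaled until
  no denominator is left and computed in a ring of type classes. And a tensor power is a quotient of
  formal sums of tuples, so that every map on it, even the tensor product of two elements, must be
  shown to be constant on cosets before it can be evaluated.\<close>

lemma ring_cong:
  assumes "ring R" "carrier S = carrier R" "mult S = mult R" "one S = one R" "zero S = zero R" "add S = add R"
  shows "ring S"
proof -
  interpret R: ring R by fact
  show ?thesis
  proof (rule ringI)
    show "abelian_group S"
    proof (rule abelian_groupI)
      fix x assume x: "x \<in> carrier S"
      show "\<exists>y\<in>carrier S. y \<oplus>\<^bsub>S\<^esub> x = \<zero>\<^bsub>S\<^esub>"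
        using x R.l_neg R.a_inv_closed unfolding assms by blast
    qed (simp_all add: assms(2-) R.add.m_ac)
    show "Group.monoid S"
      by (rule monoidI) (use assms(2-) in \<open>auto simp: R.m_assoc\<close>)
  qed (use assms(2-) in \<open>auto simp: R.l_distr R.r_distr\<close>)
qed

locale assoc_algebra = ring A for A :: "('k::field, 'a) module" (structure) +
  assumes smult_closed [simp, intro]: "x \<in> carrier A \<Longrightarrow> c \<odot> x \<in> carrier A"
    and smult_add_left: "x \<in> carrier A \<Longrightarrow> (c + d) \<odot> x = c \<odot> x \<oplus> d \<odot> x"
    and smult_add_right: "x \<in> carrier A \<Longrightarrow> y \<in> carrier A \<Longrightarrow> c \<odot> (x \<oplus> y) = c \<odot> x \<oplus> c \<odot> y"
    and smult_smult: "x \<in> carrier A \<Longrightarrow> c \<odot> (d \<odot> x) = (c * d) \<odot> x"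
    and smult_one [simp]: "x \<in> carrier A \<Longrightarrow> 1 \<odot> x = x"
    and smult_mult_left: "x \<in> carrier A \<Longrightarrow> y \<in> carrier A \<Longrightarrow> (c \<odot> x) \<otimes> y = c \<odot> (x \<otimes> y)"
    and smult_mult_right: "x \<in> carrier A \<Longrightarrow> y \<in> carrier A \<Longrightarrow> x \<otimes> (c \<odot> y) = c \<odot> (x \<otimes> y)"
begin

lemma smult_zero_left [simp]: "x \<in> carrier A \<Longrightarrow> 0 \<odot> x = \<zero>"
  using smult_add_left[of x 0 0] by simp

lemma smult_zero_right [simp]: "c \<odot> \<zero> = \<zero>"
  using smult_add_right[of \<zero> \<zero> c] by simp

lemma smult_uminus_left: "x \<in> carrier A \<Longrightarrow> (- c) \<odot> x = \<ominus> (c \<odot> x)"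
  using smult_add_left[of x "-c" c] by (intro minus_equality[symmetric]) auto

end

lemma alg_homD:
  assumes "alg_hom A B h"
  shows "x \<in> carrier A \<Longrightarrow> h x \<in> carrier B"
    "x \<in> carrier A \<Longrightarrow> y \<in> carrier A \<Longrightarrow> h (x \<otimes>\<^bsub>A\<^esub> y) = h x \<otimes>\<^bsub>B\<^esub> h y"
    "x \<in> carrier A \<Longrightarrow> y \<in> carrier A \<Longrightarrow> h (x \<oplus>\<^bsub>A\<^esub> y) = h x \<oplus>\<^bsub>B\<^esub> h y"
    "h \<one>\<^bsub>A\<^esub> = \<one>\<^bsub>B\<^esub>"
    "x \<in> carrier A \<Longrightarrow> h (c \<odot>\<^bsub>A\<^esub> x) = c \<odot>\<^bsub>B\<^esub> h x"
  using assms unfolding alg_hom_def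
  by (auto simp: ring_hom_closed ring_hom_mult ring_hom_add ring_hom_one)

lemma alg_homI:
  assumes "\<And>x. x \<in> carrier A \<Longrightarrow> h x \<in> carrier B"
    "\<And>x y. x \<in> carrier A \<Longrightarrow> y \<in> carrier A \<Longrightarrow> h (x \<otimes>\<^bsub>A\<^esub> y) = h x \<otimes>\<^bsub>B\<^esub> h y"
    "\<And>x y. x \<in> carrier A \<Longrightarrow> y \<in> carrier A \<Longrightarrow> h (x \<oplus>\<^bsub>A\<^esub> y) = h x \<oplus>\<^bsub>B\<^esub> h y"
    "h \<one>\<^bsub>A\<^esub> = \<one>\<^bsub>B\<^esub>"
    "\<And>c x. x \<in> carrier A \<Longrightarrow> h (c \<odot>\<^bsub>A\<^esub> x) = c \<odot>\<^bsub>B\<^esub> h x"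
  shows "alg_hom A B h"
  unfolding alg_hom_def using assms by (auto intro: ring_hom_memI)

lemma alg_hom_zero:
  assumes "assoc_algebra A" "assoc_algebra B" "alg_hom A B h" shows "h \<zero>\<^bsub>A\<^esub> = \<zero>\<^bsub>B\<^esub>"
  using assms ring_hom_zero by (auto simp: alg_hom_def assoc_algebra_def)

lemma alg_hom_uminus:
  assumes "assoc_algebra A" "assoc_algebra B" "alg_hom A B h" "x \<in> carrier A"
  shows "h (\<ominus>\<^bsub>A\<^esub> x) = \<ominus>\<^bsub>B\<^esub> h x"
proof -
  interpret A: assoc_algebra A by fact
  interpret B: assoc_algebra B by fact
  show ?thesis using assms alg_homD(5)[OF assms(3,4), of "-1"] alg_homD(1)[OF assms(3,4)]
    by (simp add: A.smult_uminus_left B.smult_uminus_left)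
qed

lemma alg_hom_minus:
  assumes "assoc_algebra A" "assoc_algebra B" "alg_hom A B h" "x \<in> carrier A" "y \<in> carrier A"
  shows "h (x \<ominus>\<^bsub>A\<^esub> y) = h x \<ominus>\<^bsub>B\<^esub> h y"
proof -
  interpret A: assoc_algebra A by fact
  show ?thesis using assms
    by (simp add: a_minus_def alg_homD(3)[OF assms(3)] alg_hom_uminus[OF assms(1-3)])
qed

lemma alg_hom_comp: "alg_hom A B f \<Longrightarrow> alg_hom B C g \<Longrightarrow> alg_hom A C (\<lambda>x. g (f x))"
  by (rule alg_homI) (simp_all add: alg_homD)

subsection \<open>The algebra of a monoid\<close>

lemma poly_mapping_induct [consumes 1, case_names zero add]:
  fixes f :: "'a \<Rightarrow>\<^sub>0 'b::comm_monoid_add"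
  assumes "Poly_Mapping.keys f \<subseteq> X" and zero: "P 0"
    and add: "\<And>x c f. x \<in> X \<Longrightarrow> Poly_Mapping.keys f \<subseteq> X \<Longrightarrow> P f \<Longrightarrow> P (Poly_Mapping.single x c + f)"
  shows "P f"
proof -
  have sum: "f = (\<Sum>k\<in>Poly_Mapping.keys f. Poly_Mapping.single k (Poly_Mapping.lookup f k))"
    by (rule poly_mapping_eqI) (simp add: lookup_sum lookup_single when_def in_keys_iff)
  have "Poly_Mapping.keys (\<Sum>k\<in>S. Poly_Mapping.single k (Poly_Mapping.lookup f k)) \<subseteq> X \<and>
      P (\<Sum>k\<in>S. Poly_Mapping.single k (Poly_Mapping.lookup f k))" if "finite S" "S \<subseteq> X" for S
    using that
  proof (induction S rule: finite_induct)
    case (insert x S)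
    let ?s = "\<Sum>k\<in>S. Poly_Mapping.single k (Poly_Mapping.lookup f k)"
    have "Poly_Mapping.keys (Poly_Mapping.single x (Poly_Mapping.lookup f x) + ?s) \<subseteq> X"
      using insert keys_add[of "Poly_Mapping.single x (Poly_Mapping.lookup f x)" ?s] by (auto split: if_splits)
    then show ?case using insert add by simp
  qed (simp add: zero)
  from this[OF finite_keys assms(1)] show ?thesis using sum by simp
qed

lemma lookup_map_mult: "Poly_Mapping.lookup (Poly_Mapping.map ((*) c) p) k = c * Poly_Mapping.lookup p k"
  for c :: "'k::field"
  by (simp add: map.rep_eq when_def)

lemma map_mult_add: "Poly_Mapping.map ((*) c) (p + p') = Poly_Mapping.map ((*) c) p + Poly_Mapping.map ((*) c) p'"
  for c :: "'k::field"
  by (rule poly_mapping_eqI) (simp add: lookup_map_mult lookup_add distrib_left)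

lemma map_mult_single: "Poly_Mapping.map ((*) c) (Poly_Mapping.single x a) = Poly_Mapping.single x (c * a)"
  for c :: "'k::field"
  by (rule poly_mapping_eqI) (simp add: lookup_map_mult lookup_single when_def)

lemma map_mult_zero: "Poly_Mapping.map ((*) c) 0 = 0" for c :: "'k::field"
  by (rule poly_mapping_eqI) (simp add: lookup_map_mult)

lemmas map_mult_simps = map_mult_add map_mult_single map_mult_zero

lemma keys_map_mult: "Poly_Mapping.keys (Poly_Mapping.map ((*) c) p) \<subseteq> Poly_Mapping.keys p"
  for c :: "'k::field"
  by (auto simp: in_keys_iff lookup_map_mult)

lemma monoid_algebra_simps:
  "carrier (monoid_algebra G) = {f. Poly_Mapping.keys f \<subseteq> carrier G}"
  "one (monoid_algebra G) = Poly_Mapping.single \<one>\<^bsub>G\<^esub> 1"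
  "zero (monoid_algebra G) = 0"
  "add (monoid_algebra G) = (+)"
  "smult (monoid_algebra G) = (\<lambda>c. Poly_Mapping.map ((*) c))"
  by (simp_all add: monoid_algebra_def)

text \<open>The sums in the product run over supports, which change under addition. Over common
  finite supersets, both sides of a distributive law become sums over the same index sets.\<close>

lemma monoid_algebra_mult_superset:
  assumes "finite S" "finite T" "Poly_Mapping.keys f \<subseteq> S" "Poly_Mapping.keys g \<subseteq> T"
  shows "f \<otimes>\<^bsub>monoid_algebra G\<^esub> g = (\<Sum>x\<in>S. \<Sum>y\<in>T.
     Poly_Mapping.single (x \<otimes>\<^bsub>G\<^esub> y) (Poly_Mapping.lookup f x * Poly_Mapping.lookup g y))"
proof -
  have "f \<otimes>\<^bsub>monoid_algebra G\<^esub> g = (\<Sum>x\<in>Poly_Mapping.keys f. \<Sum>y\<in>T.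
     Poly_Mapping.single (x \<otimes>\<^bsub>G\<^esub> y) (Poly_Mapping.lookup f x * Poly_Mapping.lookup g y))"
    unfolding monoid_algebra_def using assms
    by (simp, intro sum.cong refl sum.mono_neutral_left) (auto simp: in_keys_iff)
  also have "\<dots> = (\<Sum>x\<in>S. \<Sum>y\<in>T.
     Poly_Mapping.single (x \<otimes>\<^bsub>G\<^esub> y) (Poly_Mapping.lookup f x * Poly_Mapping.lookup g y))"
    using assms by (intro sum.mono_neutral_left) (auto simp: in_keys_iff)
  finally show ?thesis .
qed

lemma monoid_algebra_distribs:
  "(f + f') \<otimes>\<^bsub>monoid_algebra G\<^esub> g = f \<otimes>\<^bsub>monoid_algebra G\<^esub> g + f' \<otimes>\<^bsub>monoid_algebra G\<^esub> g"
  "f \<otimes>\<^bsub>monoid_algebra G\<^esub> (g + g') = f \<otimes>\<^bsub>monoid_algebra G\<^esub> g + f \<otimes>\<^bsub>monoid_algebra G\<^esub> g'"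
proof -
  let ?S = "Poly_Mapping.keys f \<union> Poly_Mapping.keys f'" and ?T = "Poly_Mapping.keys g \<union> Poly_Mapping.keys g'"
  note k = keys_add[of f f'] keys_add[of g g']
  show "(f + f') \<otimes>\<^bsub>monoid_algebra G\<^esub> g = f \<otimes>\<^bsub>monoid_algebra G\<^esub> g + f' \<otimes>\<^bsub>monoid_algebra G\<^esub> g"
    using k by (simp add: monoid_algebra_mult_superset[of ?S ?T] lookup_add distrib_right single_add sum.distrib)
  show "f \<otimes>\<^bsub>monoid_algebra G\<^esub> (g + g') = f \<otimes>\<^bsub>monoid_algebra G\<^esub> g + f \<otimes>\<^bsub>monoid_algebra G\<^esub> g'"
    using k by (simp add: monoid_algebra_mult_superset[of ?S ?T] lookup_add distrib_left single_add sum.distrib)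
qed

lemma monoid_algebra_mult_zero:
  "0 \<otimes>\<^bsub>monoid_algebra G\<^esub> g = 0" "f \<otimes>\<^bsub>monoid_algebra G\<^esub> 0 = 0"
  by (simp_all add: monoid_algebra_def)

lemma monoid_algebra_mult_single:
  "Poly_Mapping.single x a \<otimes>\<^bsub>monoid_algebra G\<^esub> Poly_Mapping.single y b = Poly_Mapping.single (x \<otimes>\<^bsub>G\<^esub> y) (a * b)"
  by (subst monoid_algebra_mult_superset[of "{x}" "{y}"]) auto

lemmas monoid_algebra_mult_simps =
  monoid_algebra_distribs monoid_algebra_mult_zero monoid_algebra_mult_single

lemma monoid_algebra_mult_closed:
  assumes "Group.monoid G" "Poly_Mapping.keys f \<subseteq> carrier G" "Poly_Mapping.keys g \<subseteq> carrier G"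
  shows "Poly_Mapping.keys (f \<otimes>\<^bsub>monoid_algebra G\<^esub> g) \<subseteq> carrier G"
proof -
  interpret G: Group.monoid G by fact
  show ?thesis using assms(2)
  proof (induction f rule: poly_mapping_induct)
    case zero show ?case by (simp add: monoid_algebra_mult_simps)
  next
    case (add x c f)
    have "Poly_Mapping.keys (Poly_Mapping.single x c \<otimes>\<^bsub>monoid_algebra G\<^esub> g) \<subseteq> carrier G"
      using assms(3)
    proof (induction g rule: poly_mapping_induct)
      case (add y d g)
      have "x \<otimes>\<^bsub>G\<^esub> y \<in> carrier G" using add \<open>x \<in> carrier G\<close> by simp
      then show ?case using add.IH
        by (simp add: monoid_algebra_mult_simps) (rule order_trans[OF keys_add], simp)
    qed (simp add: monoid_algebra_mult_simps)
    then show ?case using add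
      by (simp add: monoid_algebra_mult_simps) (rule order_trans[OF keys_add], simp)
  qed
qed

lemma monoid_algebra_assoc_algebra:
  assumes "Group.monoid G"
  shows "assoc_algebra (monoid_algebra G :: ('k::field, 'a \<Rightarrow>\<^sub>0 'k) module)" (is "assoc_algebra ?M")
proof -
  interpret G: Group.monoid G by fact
  note s = monoid_algebra_simps
  have grp: "abelian_group ?M"
  proof (rule abelian_groupI)
    fix x y assume "x \<in> carrier ?M" "y \<in> carrier ?M"
    then show "x \<oplus>\<^bsub>?M\<^esub> y \<in> carrier ?M" using keys_add[of x y] by (auto simp: s)
  next
    fix x assume "x \<in> carrier ?M"
    then have "- x \<in> carrier ?M" "- x \<oplus>\<^bsub>?M\<^esub> x = \<zero>\<^bsub>?M\<^esub>" by (simp_all add: s in_keys_iff subset_iff)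
    then show "\<exists>y\<in>carrier ?M. y \<oplus>\<^bsub>?M\<^esub> x = \<zero>\<^bsub>?M\<^esub>" by blast
  qed (simp_all add: s add_ac)
  \<comment> \<open>Both sides are additive in each argument, so the three supports are split one
    after the other until only basis elements remain.\<close>
  have assoc: "(f \<otimes>\<^bsub>?M\<^esub> g) \<otimes>\<^bsub>?M\<^esub> h = f \<otimes>\<^bsub>?M\<^esub> (g \<otimes>\<^bsub>?M\<^esub> h)"
    if "f \<in> carrier ?M" "g \<in> carrier ?M" "h \<in> carrier ?M" for f g h
  proof -
    from that have k: "Poly_Mapping.keys f \<subseteq> carrier G" "Poly_Mapping.keys g \<subseteq> carrier G"
      "Poly_Mapping.keys h \<subseteq> carrier G" by (auto simp: s)
    show ?thesis using k(1)
    proof (induction f rule: poly_mapping_induct)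
      case (add x a f)
      note x = \<open>x \<in> carrier G\<close>
      have "(Poly_Mapping.single x a \<otimes>\<^bsub>?M\<^esub> g) \<otimes>\<^bsub>?M\<^esub> h = Poly_Mapping.single x a \<otimes>\<^bsub>?M\<^esub> (g \<otimes>\<^bsub>?M\<^esub> h)"
        using k(2)
      proof (induction g rule: poly_mapping_induct)
        case (add y b g)
        note y = \<open>y \<in> carrier G\<close>
        have "(Poly_Mapping.single x a \<otimes>\<^bsub>?M\<^esub> Poly_Mapping.single y b) \<otimes>\<^bsub>?M\<^esub> h
            = Poly_Mapping.single x a \<otimes>\<^bsub>?M\<^esub> (Poly_Mapping.single y b \<otimes>\<^bsub>?M\<^esub> h)"
          using k(3)
          by (induction h rule: poly_mapping_induct)
            (simp_all add: monoid_algebra_mult_simps G.m_assoc x y mult.assoc)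
        then show ?case using add.IH by (simp add: monoid_algebra_distribs)
      qed (simp add: monoid_algebra_mult_simps)
      then show ?case using add.IH by (simp add: monoid_algebra_distribs)
    qed (simp add: monoid_algebra_mult_simps)
  qed
  have one: "\<one>\<^bsub>?M\<^esub> \<otimes>\<^bsub>?M\<^esub> f = f" "f \<otimes>\<^bsub>?M\<^esub> \<one>\<^bsub>?M\<^esub> = f" if "f \<in> carrier ?M" for f
  proof -
    from that have k: "Poly_Mapping.keys f \<subseteq> carrier G" by (simp add: s)
    show "\<one>\<^bsub>?M\<^esub> \<otimes>\<^bsub>?M\<^esub> f = f" "f \<otimes>\<^bsub>?M\<^esub> \<one>\<^bsub>?M\<^esub> = f"
      using k by (induction f rule: poly_mapping_induct) (simp_all add: monoid_algebra_mult_simps s)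
  qed
  have mon: "Group.monoid ?M"
    by (rule monoidI)
      (auto simp: assoc one, auto simp: s G.one_closed split: if_splits
         dest: subsetD[OF monoid_algebra_mult_closed[OF assms]])
  have ring: "ring ?M"
    by (rule ringI[OF grp mon]) (simp_all add: s monoid_algebra_distribs)
  have sl: "Poly_Mapping.map ((*) c) f \<otimes>\<^bsub>?M\<^esub> g = Poly_Mapping.map ((*) c) (f \<otimes>\<^bsub>?M\<^esub> g)"
    "f \<otimes>\<^bsub>?M\<^esub> Poly_Mapping.map ((*) c) g = Poly_Mapping.map ((*) c) (f \<otimes>\<^bsub>?M\<^esub> g)" for c f g
  proof -
    have U: "Poly_Mapping.keys p \<subseteq> UNIV" for p :: "'a \<Rightarrow>\<^sub>0 'k" by simp
    have 1: "Poly_Mapping.map ((*) c) (Poly_Mapping.single x a) \<otimes>\<^bsub>?M\<^esub> g = Poly_Mapping.map ((*) c) (Poly_Mapping.single x a \<otimes>\<^bsub>?M\<^esub> g)" for x a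
      using U[of g] by (induction g rule: poly_mapping_induct)
        (simp_all add: monoid_algebra_mult_simps map_mult_simps mult.assoc)
    show "Poly_Mapping.map ((*) c) f \<otimes>\<^bsub>?M\<^esub> g = Poly_Mapping.map ((*) c) (f \<otimes>\<^bsub>?M\<^esub> g)"
      using U[of f] by (induction f rule: poly_mapping_induct)
        (simp_all add: monoid_algebra_distribs monoid_algebra_mult_zero map_mult_zero map_mult_add map_mult_single flip: 1)
    have 2: "f \<otimes>\<^bsub>?M\<^esub> Poly_Mapping.map ((*) c) (Poly_Mapping.single x a) = Poly_Mapping.map ((*) c) (f \<otimes>\<^bsub>?M\<^esub> Poly_Mapping.single x a)" for x a
      using U[of f] by (induction f rule: poly_mapping_induct)
        (simp_all add: monoid_algebra_mult_simps map_mult_simps, metis mult.left_commute)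
    show "f \<otimes>\<^bsub>?M\<^esub> Poly_Mapping.map ((*) c) g = Poly_Mapping.map ((*) c) (f \<otimes>\<^bsub>?M\<^esub> g)"
      using U[of g] by (induction g rule: poly_mapping_induct)
        (simp_all add: monoid_algebra_distribs monoid_algebra_mult_zero map_mult_zero map_mult_add map_mult_single flip: 2)
  qed
  show ?thesis
  proof (intro assoc_algebra.intro assoc_algebra_axioms.intro ring)
    fix x y c d
    show "x \<in> carrier ?M \<Longrightarrow> c \<odot>\<^bsub>?M\<^esub> x \<in> carrier ?M"
      using keys_map_mult[of c x] by (auto simp: s)
    show "(c + d) \<odot>\<^bsub>?M\<^esub> x = c \<odot>\<^bsub>?M\<^esub> x \<oplus>\<^bsub>?M\<^esub> d \<odot>\<^bsub>?M\<^esub> x"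
      by (rule poly_mapping_eqI) (simp add: s lookup_map_mult lookup_add distrib_right)
    show "c \<odot>\<^bsub>?M\<^esub> (d \<odot>\<^bsub>?M\<^esub> x) = (c * d) \<odot>\<^bsub>?M\<^esub> x"
      by (rule poly_mapping_eqI) (simp add: s lookup_map_mult mult.assoc)
    show "1 \<odot>\<^bsub>?M\<^esub> x = x"
      by (rule poly_mapping_eqI) (simp add: s lookup_map_mult)
  qed (simp_all add: s map_mult_add sl)
qed

subsection \<open>Quotients\<close>

lemma quot_algebra_simps:
  "carrier (quot_algebra A I) = a_rcosets\<^bsub>A\<^esub> I" "zero (quot_algebra A I) = I"
  "one (quot_algebra A I) = I +>\<^bsub>A\<^esub> \<one>\<^bsub>A\<^esub>"
  by (simp_all add: quot_algebra_def FactRing_def)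

lemma quot_algebra_carrier:
  "carrier (quot_algebra A I) = (\<lambda>x. I +>\<^bsub>A\<^esub> x) ` carrier A"
  by (auto simp: quot_algebra_simps A_RCOSETS_def' a_r_coset_def')

context assoc_algebra begin

context
  fixes I assumes I: "ideal I A"
begin

interpretation I: ideal I A by (rule I)

text \<open>In a unital algebra \<open>c \<odot> x\<close> is the product of
  \<open>c \<odot> \<one>\<close> and \<open>x\<close>, so absorption of products gives closure
  under scalars.\<close>

lemma ideal_smult: "x \<in> I \<Longrightarrow> c \<odot> x \<in> I"
  using I.I_l_closed[of x "c \<odot> \<one>"] I.a_Hcarr by (simp add: smult_mult_left)

text \<open>The scalar multiplication of \<open>quot_algebra\<close> is a union over all
  representatives. It collapses to one coset because representatives differ by elements of the
  ideal, which is closed under scalars.\<close>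

lemma coset_smult: "x \<in> carrier A \<Longrightarrow> c \<odot>\<^bsub>quot_algebra A I\<^esub> (I +> x) = I +> (c \<odot> x)"
proof -
  assume x: "x \<in> carrier A"
  have "I +> (c \<odot> y) = I +> (c \<odot> x)" if "y \<in> I +> x" for y
  proof -
    from that obtain i where i: "i \<in> I" "y = i \<oplus> x" by (auto simp: a_r_coset_def')
    then have "c \<odot> y = c \<odot> i \<oplus> c \<odot> x" using x I.a_Hcarr by (simp add: smult_add_right)
    then have "c \<odot> y \<in> I +> (c \<odot> x)" using ideal_smult[OF i(1)] by (auto simp: a_r_coset_def')
    from I.a_repr_independence'[OF this] show ?thesis using x by simp
  qed
  moreover have "x \<in> I +> x" using x by (rule I.a_rcos_self)
  ultimately have "(\<Union>y\<in>I +> x. I +> (c \<odot> y)) = I +> (c \<odot> x)"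
    by blast
  then show ?thesis by (simp add: quot_algebra_def)
qed

lemma coset_ops:
  assumes "x \<in> carrier A" "y \<in> carrier A"
  shows "(I +> x) \<otimes>\<^bsub>quot_algebra A I\<^esub> (I +> y) = I +> (x \<otimes> y)"
    "(I +> x) \<oplus>\<^bsub>quot_algebra A I\<^esub> (I +> y) = I +> (x \<oplus> y)"
  using assms by (simp_all add: quot_algebra_def FactRing_def I.rcoset_mult_add I.a_rcos_sum)

lemma quot_algebra: "assoc_algebra (quot_algebra A I)"
proof (intro assoc_algebra.intro assoc_algebra_axioms.intro)
  show "ring (quot_algebra A I)"
    by (rule ring_cong[OF I.quotient_is_ring]) (simp_all add: quot_algebra_def)
qed (auto simp: quot_algebra_carrier coset_smult coset_ops smult_add_left smult_add_right
  smult_smult smult_mult_left smult_mult_right)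

lemma coset_hom: "alg_hom A (quot_algebra A I) (\<lambda>x. I +> x)"
  by (rule alg_homI) (simp_all add: quot_algebra_carrier quot_algebra_simps(3) coset_ops coset_smult)

end
end

section \<open>Linear extension from a basis, and maps out of quotients of monoid algebras\<close>

definition lin_ext :: "('k::field, 'b) module \<Rightarrow> ('a \<Rightarrow> 'b) \<Rightarrow> ('a \<Rightarrow>\<^sub>0 'k) \<Rightarrow> 'b" where
  "lin_ext B h p = finsum B (\<lambda>x. Poly_Mapping.lookup p x \<odot>\<^bsub>B\<^esub> h x) (Poly_Mapping.keys p)"

context assoc_algebra begin

lemma lin_ext_superset:
  assumes "finite S" "Poly_Mapping.keys p \<subseteq> S" "\<And>x. x \<in> S \<Longrightarrow> h x \<in> carrier A"
  shows "lin_ext A h p = (\<Oplus>x\<in>S. Poly_Mapping.lookup p x \<odot> h x)"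
  unfolding lin_ext_def
  by (rule add.finprod_mono_neutral_cong_left) (use assms in \<open>auto simp: in_keys_iff\<close>)

lemma lin_ext_closed:
  assumes "\<And>x. x \<in> Poly_Mapping.keys p \<Longrightarrow> h x \<in> carrier A" shows "lin_ext A h p \<in> carrier A"
  unfolding lin_ext_def using assms by (intro finsum_closed) auto

lemma lin_ext_zero [simp]: "lin_ext A h 0 = \<zero>"
  by (simp add: lin_ext_def)

lemma lin_ext_single: "h x \<in> carrier A \<Longrightarrow> lin_ext A h (Poly_Mapping.single x c) = c \<odot> h x"
  by (subst lin_ext_superset[of "{x}"]) (auto simp: finsum_insert)

lemma lin_ext_add:
  assumes "\<And>x. x \<in> Poly_Mapping.keys p \<union> Poly_Mapping.keys p' \<Longrightarrow> h x \<in> carrier A"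
  shows "lin_ext A h (p + p') = lin_ext A h p \<oplus> lin_ext A h p'"
proof -
  let ?S = "Poly_Mapping.keys p \<union> Poly_Mapping.keys p'"
  have "lin_ext A h (p + p') = (\<Oplus>x\<in>?S. Poly_Mapping.lookup p x \<odot> h x \<oplus> Poly_Mapping.lookup p' x \<odot> h x)"
  proof -
    have "lin_ext A h (p + p') = (\<Oplus>x\<in>?S. Poly_Mapping.lookup (p + p') x \<odot> h x)"
      using assms keys_add[of p p'] by (intro lin_ext_superset) auto
    also have "\<dots> = (\<Oplus>x\<in>?S. Poly_Mapping.lookup p x \<odot> h x \<oplus> Poly_Mapping.lookup p' x \<odot> h x)"
      using assms by (intro finsum_cong' refl) (auto simp: lookup_add smult_add_left)
    finally show ?thesis .
  qed
  also have "\<dots> = (\<Oplus>x\<in>?S. Poly_Mapping.lookup p x \<odot> h x) \<oplus> (\<Oplus>x\<in>?S. Poly_Mapping.lookup p' x \<odot> h x)"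
    by (rule finsum_addf) (use assms in auto)
  also have "\<dots> = lin_ext A h p \<oplus> lin_ext A h p'"
    using assms lin_ext_superset[of ?S p h] lin_ext_superset[of ?S p' h] by simp
  finally show ?thesis .
qed

lemma lin_ext_cong:
  assumes "\<And>x. x \<in> Poly_Mapping.keys p \<Longrightarrow> h x = h' x" "\<And>x. x \<in> Poly_Mapping.keys p \<Longrightarrow> h' x \<in> carrier A"
  shows "lin_ext A h p = lin_ext A h' p"
  unfolding lin_ext_def by (rule finsum_cong') (use assms in auto)

context
  fixes h :: "'c \<Rightarrow> 'a" and X :: "'c set"
  assumes h: "\<And>x. x \<in> X \<Longrightarrow> h x \<in> carrier A"
begin

lemma lin_ext_closed_on: "Poly_Mapping.keys p \<subseteq> X \<Longrightarrow> lin_ext A h p \<in> carrier A"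
  using h by (intro lin_ext_closed) auto

lemma lin_ext_add_on: "Poly_Mapping.keys p \<subseteq> X \<Longrightarrow> Poly_Mapping.keys p' \<subseteq> X \<Longrightarrow>
    lin_ext A h (p + p') = lin_ext A h p \<oplus> lin_ext A h p'"
  using h by (intro lin_ext_add) auto

lemma lin_ext_smult: "Poly_Mapping.keys p \<subseteq> X \<Longrightarrow>
    lin_ext A h (Poly_Mapping.map ((*) c) p) = c \<odot> lin_ext A h p"
proof (induction p rule: poly_mapping_induct)
  case (add x a f)
  have "Poly_Mapping.keys (Poly_Mapping.map ((*) c) f) \<subseteq> X"
    using add keys_map_mult[of c f] by blast
  then show ?case using add h
    by (simp add: map_mult_simps lin_ext_add_on lin_ext_single lin_ext_closed_on smult_add_right smult_smult)
qed (simp add: map_mult_zero)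

lemma lin_ext_mult_left:
  assumes "a \<in> carrier A" "Poly_Mapping.keys p \<subseteq> X"
  shows "lin_ext A (\<lambda>x. a \<otimes> h x) p = a \<otimes> lin_ext A h p"
proof -
  have fin: "finite (Poly_Mapping.keys p)" by simp
  have "a \<otimes> lin_ext A h p = (\<Oplus>x\<in>Poly_Mapping.keys p. a \<otimes> (Poly_Mapping.lookup p x \<odot> h x))"
    unfolding lin_ext_def by (rule finsum_rdistr) (use assms h in auto)
  also have "\<dots> = lin_ext A (\<lambda>x. a \<otimes> h x) p"
    unfolding lin_ext_def by (rule finsum_cong') (use assms h in \<open>auto simp: smult_mult_right\<close>)
  finally show ?thesis by simp
qed

lemma lin_ext_mult_right:
  assumes "a \<in> carrier A" "Poly_Mapping.keys p \<subseteq> X"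
  shows "lin_ext A (\<lambda>x. h x \<otimes> a) p = lin_ext A h p \<otimes> a"
proof -
  have "lin_ext A h p \<otimes> a = (\<Oplus>x\<in>Poly_Mapping.keys p. (Poly_Mapping.lookup p x \<odot> h x) \<otimes> a)"
    unfolding lin_ext_def by (rule finsum_ldistr) (use assms h in auto)
  also have "\<dots> = lin_ext A (\<lambda>x. h x \<otimes> a) p"
    unfolding lin_ext_def by (rule finsum_cong') (use assms h in \<open>auto simp: smult_mult_left\<close>)
  finally show ?thesis by simp
qed

end

text \<open>Both sides of the product law are additive in each factor, so it reduces to basis
  elements, where it is the multiplicativity of \<open>h\<close>.\<close>

lemma lin_ext_hom:
  fixes G :: "('c, 'm) monoid_scheme"
  assumes G: "Group.monoid G" and h: "\<And>x. x \<in> carrier G \<Longrightarrow> h x \<in> carrier A" and one: "h \<one>\<^bsub>G\<^esub> = \<one>"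
    and mult: "\<And>x y. x \<in> carrier G \<Longrightarrow> y \<in> carrier G \<Longrightarrow> h (x \<otimes>\<^bsub>G\<^esub> y) = h x \<otimes> h y"
  shows "alg_hom (monoid_algebra G) A (lin_ext A h)"
proof (rule alg_homI)
  interpret G: Group.monoid G by fact
  note s = monoid_algebra_simps
  note add_on = lin_ext_add_on[where X = "carrier G", OF h] and closed = lin_ext_closed_on[where X = "carrier G", OF h]
  fix p r :: "'c \<Rightarrow>\<^sub>0 'k" and c
  assume p: "p \<in> carrier (monoid_algebra G)"
  show "lin_ext A h p \<in> carrier A" using p closed by (simp add: s)
  show "lin_ext A h (c \<odot>\<^bsub>monoid_algebra G\<^esub> p) = c \<odot> lin_ext A h p"
    using p lin_ext_smult[where X = "carrier G", OF h] by (simp add: s)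
  assume r: "r \<in> carrier (monoid_algebra G)"
  show "lin_ext A h (p \<oplus>\<^bsub>monoid_algebra G\<^esub> r) = lin_ext A h p \<oplus> lin_ext A h r"
    using p r add_on by (simp add: s)
  have single: "lin_ext A h (Poly_Mapping.single x a \<otimes>\<^bsub>monoid_algebra G\<^esub> r)
      = lin_ext A h (Poly_Mapping.single x a) \<otimes> lin_ext A h r" if x: "x \<in> carrier G" for x a
  proof -
    have "Poly_Mapping.keys r \<subseteq> carrier G" using r by (simp add: s)
    then show ?thesis
    proof (induction r rule: poly_mapping_induct)
      case zero then show ?case using x h by (simp add: monoid_algebra_mult_zero lin_ext_single)
    next
      case (add y b r)
      have "Poly_Mapping.keys (Poly_Mapping.single x a \<otimes>\<^bsub>monoid_algebra G\<^esub> r) \<subseteq> carrier G"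
        using x add by (intro monoid_algebra_mult_closed G) auto
      then show ?case using add x h closed
        by (simp add: monoid_algebra_mult_simps add_on lin_ext_single mult r_distr
            smult_mult_left smult_mult_right smult_smult mult.commute[of b a])
    qed
  qed
  have "Poly_Mapping.keys p \<subseteq> carrier G" using p by (simp add: s)
  then show "lin_ext A h (p \<otimes>\<^bsub>monoid_algebra G\<^esub> r) = lin_ext A h p \<otimes> lin_ext A h r"
  proof (induction p rule: poly_mapping_induct)
    case zero then show ?case using r closed by (simp add: monoid_algebra_mult_zero s)
  next
    case (add y b p)
    have r': "Poly_Mapping.keys r \<subseteq> carrier G" using r by (simp add: s)
    have "Poly_Mapping.keys (p \<otimes>\<^bsub>monoid_algebra G\<^esub> r) \<subseteq> carrier G"
      "Poly_Mapping.keys (Poly_Mapping.single y b \<otimes>\<^bsub>monoid_algebra G\<^esub> r) \<subseteq> carrier G"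
      using add(1,2) r' by (intro monoid_algebra_mult_closed[OF G]; simp)+
    then show ?case using add h closed r'
      by (simp add: monoid_algebra_distribs add_on single l_distr lin_ext_single)
  qed
next
  show "lin_ext A h \<one>\<^bsub>monoid_algebra G\<^esub> = \<one>"
    by (simp add: monoid_algebra_simps lin_ext_single one)
qed

end

text \<open>Representatives of a coset differ by an element of \<open>I\<close>, where the linear
  extension vanishes; hence the image taken in \<open>lin_lift\<close> is a singleton. The argument
  is purely linear, so it also covers maps such as \<open>tensor_concat\<close> that are not
  multiplicative.\<close>

lemma lin_lift_coset:
  fixes B :: "('k::field, 'b) module"
  assumes "Group.monoid G" "assoc_algebra B" and I: "ideal I (monoid_algebra G)"
    and h: "\<And>x. x \<in> carrier G \<Longrightarrow> h x \<in> carrier B"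
    and kill: "\<And>p. p \<in> I \<Longrightarrow> lin_ext B h p = \<zero>\<^bsub>B\<^esub>"
    and p: "p \<in> carrier (monoid_algebra G)"
  shows "lin_lift B h (I +>\<^bsub>monoid_algebra G\<^esub> p) = lin_ext B h p"
proof -
  interpret B: assoc_algebra B by fact
  interpret M: assoc_algebra "monoid_algebra G :: ('k, _) module" by (rule monoid_algebra_assoc_algebra) fact
  interpret I: ideal I "monoid_algebra G :: ('k, _) module" by fact
  have "lin_ext B h p' = lin_ext B h p" if p': "p' \<in> I +>\<^bsub>monoid_algebra G\<^esub> p" for p'
  proof -
    obtain i where i: "i \<in> I" "p' = i + p" using p' by (auto simp: a_r_coset_def' monoid_algebra_simps)
    have "lin_ext B h (i + p) = lin_ext B h i \<oplus>\<^bsub>B\<^esub> lin_ext B h p"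
      by (rule B.lin_ext_add_on[where X = "carrier G"]) (use p I.a_Hcarr[OF i(1)] h in \<open>simp_all add: monoid_algebra_simps\<close>)
    moreover have "lin_ext B h p \<in> carrier B"
      using p h by (intro B.lin_ext_closed) (auto simp: monoid_algebra_simps)
    ultimately show ?thesis using i kill by simp
  qed
  then have "lin_ext B h ` (I +>\<^bsub>monoid_algebra G\<^esub> p) = {lin_ext B h p}"
    using I.a_rcos_self[OF p] by blast
  then show ?thesis unfolding lin_lift_def lin_ext_def by simp
qed

text \<open>The kernel is an ideal; once it contains the relations, it contains the ideal that they
  generate.\<close>

lemma alg_hom_kills_genideal:
  assumes "assoc_algebra A" "assoc_algebra B" "alg_hom A B f" "R \<subseteq> carrier A"
    and "\<And>r. r \<in> R \<Longrightarrow> f r = \<zero>\<^bsub>B\<^esub>" and "p \<in> genideal A R"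
  shows "f p = \<zero>\<^bsub>B\<^esub>"
proof -
  interpret A: assoc_algebra A by fact
  interpret B: assoc_algebra B by fact
  interpret f: ring_hom_ring A B f
    using assms(3) by (simp add: alg_hom_def ring_hom_ringI2[OF A.ring_axioms B.ring_axioms])
  have "R \<subseteq> a_kernel A B f" unfolding a_kernel_def' using assms(4,5) by blast
  then have "p \<in> a_kernel A B f"
    using A.genideal_minimal[OF f.kernel_is_ideal] assms(6) by blast
  then show ?thesis unfolding a_kernel_def' by blast
qed

lemma alg_hom_quot:
  assumes "assoc_algebra A" "ideal I A" "alg_hom A B f"
    and "\<And>x. x \<in> carrier A \<Longrightarrow> F (I +>\<^bsub>A\<^esub> x) = f x"
  shows "alg_hom (quot_algebra A I) B F"
proof -
  interpret A: assoc_algebra A by fact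
  show ?thesis
    by (rule alg_homI)
      (auto simp: quot_algebra_carrier A.coset_ops[OF assms(2)] A.coset_smult[OF assms(2)] assms(4)
        quot_algebra_simps(3) alg_homD[OF assms(3)])
qed

text \<open>The common universal property of presented algebras and tensor powers, both of which are
  quotients of a monoid algebra by the ideal of some relations.\<close>

lemma lin_lift_hom:
  fixes B :: "('k::field, 'b) module" and G :: "('a, 'm) monoid_scheme"
  assumes G: "Group.monoid G" and B: "assoc_algebra B" and R: "R \<subseteq> carrier (monoid_algebra G)"
    and h: "\<And>x. x \<in> carrier G \<Longrightarrow> h x \<in> carrier B" "h \<one>\<^bsub>G\<^esub> = \<one>\<^bsub>B\<^esub>"
      "\<And>x y. x \<in> carrier G \<Longrightarrow> y \<in> carrier G \<Longrightarrow> h (x \<otimes>\<^bsub>G\<^esub> y) = h x \<otimes>\<^bsub>B\<^esub> h y"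
    and kill: "\<And>r. r \<in> R \<Longrightarrow> lin_ext B h r = \<zero>\<^bsub>B\<^esub>"
  defines "I \<equiv> genideal (monoid_algebra G) R"
  shows "alg_hom (quot_algebra (monoid_algebra G) I) B (lin_lift B h)"
    "p \<in> carrier (monoid_algebra G) \<Longrightarrow> lin_lift B h (I +>\<^bsub>monoid_algebra G\<^esub> p) = lin_ext B h p"
    "p \<in> I \<Longrightarrow> lin_ext B h p = \<zero>\<^bsub>B\<^esub>"
proof -
  interpret B: assoc_algebra B by fact
  interpret M: assoc_algebra "monoid_algebra G :: ('k, _) module" by (rule monoid_algebra_assoc_algebra) fact
  have I: "ideal I (monoid_algebra G)" unfolding I_def by (rule M.genideal_ideal[OF R])
  have hom: "alg_hom (monoid_algebra G) B (lin_ext B h)" by (rule B.lin_ext_hom[OF G h])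
  show kills: "lin_ext B h p = \<zero>\<^bsub>B\<^esub>" if "p \<in> I" for p
    using alg_hom_kills_genideal[OF M.assoc_algebra_axioms B hom R kill] that unfolding I_def by blast
  show eq: "lin_lift B h (I +>\<^bsub>monoid_algebra G\<^esub> p) = lin_ext B h p" if "p \<in> carrier (monoid_algebra G)" for p
    by (rule lin_lift_coset[OF G B I h(1) kills that])
  show "alg_hom (quot_algebra (monoid_algebra G) I) B (lin_lift B h)"
    by (rule alg_hom_quot[OF M.assoc_algebra_axioms I hom eq])
qed

subsection \<open>Presented algebras\<close>

lemma free_monoid: "Group.monoid (free_monoid X)"
  by (rule monoidI) (auto simp: free_monoid_def)

lemma free_algebra: "assoc_algebra (free_algebra X)"
  unfolding free_algebra_def by (rule monoid_algebra_assoc_algebra[OF free_monoid])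

lemma gen_carrier: "x \<in> X \<Longrightarrow> gen x \<in> carrier (free_algebra X)"
  by (simp add: free_algebra_def gen_def monoid_algebra_simps free_monoid_def)

definition eval_free :: "('k::field, 'b) module \<Rightarrow> ('x \<Rightarrow> 'b) \<Rightarrow> ('x list \<Rightarrow>\<^sub>0 'k) \<Rightarrow> 'b" where
  "eval_free B g = lin_ext B (\<lambda>w. foldr (\<lambda>x b. g x \<otimes>\<^bsub>B\<^esub> b) w \<one>\<^bsub>B\<^esub>)"

context
  fixes B :: "('k::field, 'b) module" and g :: "'x \<Rightarrow> 'b" and X
  assumes B: "assoc_algebra B" and g: "\<And>x. x \<in> X \<Longrightarrow> g x \<in> carrier B"
begin

interpretation B: assoc_algebra B by (rule B)

lemma foldr_mult:
  shows "w \<in> lists X \<Longrightarrow> foldr (\<lambda>x b. g x \<otimes>\<^bsub>B\<^esub> b) w \<one>\<^bsub>B\<^esub> \<in> carrier B"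
    and "w \<in> lists X \<Longrightarrow> w' \<in> lists X \<Longrightarrow> foldr (\<lambda>x b. g x \<otimes>\<^bsub>B\<^esub> b) (w @ w') \<one>\<^bsub>B\<^esub>
     = foldr (\<lambda>x b. g x \<otimes>\<^bsub>B\<^esub> b) w \<one>\<^bsub>B\<^esub> \<otimes>\<^bsub>B\<^esub> foldr (\<lambda>x b. g x \<otimes>\<^bsub>B\<^esub> b) w' \<one>\<^bsub>B\<^esub>"
proof -
  show cl: "w \<in> lists X \<Longrightarrow> foldr (\<lambda>x b. g x \<otimes>\<^bsub>B\<^esub> b) w \<one>\<^bsub>B\<^esub> \<in> carrier B" for w
    by (induction w) (simp_all add: g)
  assume "w \<in> lists X" "w' \<in> lists X"
  then show "foldr (\<lambda>x b. g x \<otimes>\<^bsub>B\<^esub> b) (w @ w') \<one>\<^bsub>B\<^esub>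
     = foldr (\<lambda>x b. g x \<otimes>\<^bsub>B\<^esub> b) w \<one>\<^bsub>B\<^esub> \<otimes>\<^bsub>B\<^esub> foldr (\<lambda>x b. g x \<otimes>\<^bsub>B\<^esub> b) w' \<one>\<^bsub>B\<^esub>"
  proof (induction w)
    case (Cons x w)
    have "g x \<in> carrier B" "foldr (\<lambda>x b. g x \<otimes>\<^bsub>B\<^esub> b) w \<one>\<^bsub>B\<^esub> \<in> carrier B" "foldr (\<lambda>x b. g x \<otimes>\<^bsub>B\<^esub> b) w' \<one>\<^bsub>B\<^esub> \<in> carrier B"
      using Cons.prems Cons.hyps g cl by auto
    then show ?case using Cons by (simp add: B.m_assoc)
  qed (simp add: cl)
qed

lemma eval_free_hom: "alg_hom (free_algebra X) B (eval_free B g)"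
  unfolding free_algebra_def eval_free_def
  by (rule B.lin_ext_hom[OF free_monoid]) (simp_all add: free_monoid_def foldr_mult del: foldr_append)

lemma eval_free_gen: "x \<in> X \<Longrightarrow> eval_free B g (gen x) = g x"
  by (simp add: eval_free_def gen_def B.lin_ext_single g)

lemma presented_lift:
  assumes "R \<subseteq> carrier (free_algebra X)" "\<And>r. r \<in> R \<Longrightarrow> eval_free B g r = \<zero>\<^bsub>B\<^esub>"
  shows "alg_hom (presented_algebra X R) B (presented_lift B g)"
    "p \<in> carrier (free_algebra X) \<Longrightarrow> presented_lift B g (presented_class X R p) = eval_free B g p"
proof -
  note L = lin_lift_hom[OF free_monoid B, of R X "\<lambda>w. foldr (\<lambda>x b. g x \<otimes>\<^bsub>B\<^esub> b) w \<one>\<^bsub>B\<^esub>", folded free_algebra_def eval_free_def, OF assms(1) _ _ _ assms(2)]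
  show "alg_hom (presented_algebra X R) B (presented_lift B g)"
    unfolding presented_algebra_def presented_lift_def
    by (rule L(1)) (simp_all add: free_monoid_def foldr_mult del: foldr_append)
  show "p \<in> carrier (free_algebra X) \<Longrightarrow> presented_lift B g (presented_class X R p) = eval_free B g p"
    unfolding presented_class_def presented_lift_def
    by (rule L(2)) (simp_all add: free_monoid_def foldr_mult del: foldr_append)
qed

end

context
  fixes X :: "'x set" and R :: "('x list \<Rightarrow>\<^sub>0 'k::field) set"
  assumes R: "R \<subseteq> carrier (free_algebra X)"
begin

interpretation F: assoc_algebra "free_algebra X :: ('k, _) module" by (rule free_algebra)

lemma presented_ideal: "ideal (genideal (free_algebra X) R) (free_algebra X)"
  by (rule F.genideal_ideal[OF R])

lemma presented_algebra: "assoc_algebra (presented_algebra X R)"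
  unfolding presented_algebra_def by (rule F.quot_algebra[OF presented_ideal])

lemma presented_class_hom: "alg_hom (free_algebra X) (presented_algebra X R) (presented_class X R)"
  using F.coset_hom[OF presented_ideal] unfolding presented_algebra_def presented_class_def by simp

lemma presented_carrier:
  "carrier (presented_algebra X R) = presented_class X R ` carrier (free_algebra X)"
  unfolding presented_algebra_def presented_class_def quot_algebra_carrier by simp

lemma presented_class_relation:
  assumes "r \<in> R" shows "presented_class X R r = \<zero>\<^bsub>presented_algebra X R\<^esub>"
proof -
  have "r \<in> genideal (free_algebra X) R" using F.genideal_self[OF R] assms by blast
  then show ?thesis
    unfolding presented_class_def presented_algebra_def quot_algebra_simps
    using abelian_subgroup.a_rcos_const[OF abelian_subgroupI3] presented_ideal F.is_abelian_group
    by (metis ideal.axioms(1))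
qed

text \<open>Words are products of generators, and every element is a linear combination of words.
  Both the uniqueness of the morphism and the description of its image rest on this.\<close>

lemma presented_generated:
  assumes sub: "is_subalgebra (presented_algebra X R) S"
    and gens: "\<And>x. x \<in> X \<Longrightarrow> presented_class X R (gen x) \<in> S"
  shows "carrier (presented_algebra X R) \<subseteq> S"
proof -
  let ?P = "presented_algebra X R"
  interpret P: assoc_algebra ?P by (rule presented_algebra)
  note c = alg_homD[OF presented_class_hom]
  have S: "subring S ?P" "\<And>c x. x \<in> S \<Longrightarrow> c \<odot>\<^bsub>?P\<^esub> x \<in> S"
    using sub by (auto simp: is_subalgebra_def)
  have car: "Poly_Mapping.single w a \<in> carrier (free_algebra X)" if "w \<in> lists X" for w and a :: 'k
    using that by (simp add: free_algebra_def monoid_algebra_simps free_monoid_def)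
  have word: "presented_class X R (Poly_Mapping.single w 1) \<in> S" if "w \<in> lists X" for w
    using that
  proof (induction w)
    case Nil
    have "Poly_Mapping.single [] (1 :: 'k) = \<one>\<^bsub>free_algebra X\<^esub>"
      by (simp add: free_algebra_def monoid_algebra_simps free_monoid_def)
    then show ?case using c(4) subringE(3)[OF S(1)] by simp
  next
    case (Cons x w)
    have "Poly_Mapping.single (x # w) 1 = gen x \<otimes>\<^bsub>free_algebra X\<^esub> Poly_Mapping.single w (1 :: 'k)"
      by (simp add: gen_def free_algebra_def monoid_algebra_mult_single) (simp add: free_monoid_def)
    moreover have "gen x \<in> carrier (free_algebra X :: ('k, _) module)" "w \<in> lists X"
      using Cons by (simp_all add: gen_carrier)
    ultimately show ?case
      using Cons.IH gens[OF \<open>x \<in> X\<close>] c(2)[OF _ car[of w 1]] subringE(6)[OF S(1)] by simp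
  qed
  have "presented_class X R p \<in> S" if "Poly_Mapping.keys p \<subseteq> lists X" for p
    using that
  proof (induction p rule: poly_mapping_induct)
    case zero
    have "(0 :: 'x list \<Rightarrow>\<^sub>0 'k) = \<zero>\<^bsub>free_algebra X\<^esub>" by (simp add: free_algebra_def monoid_algebra_simps)
    then show ?case
      using alg_hom_zero[OF free_algebra presented_algebra presented_class_hom] subringE(2)[OF S(1)] by simp
  next
    case (add w a p)
    have "Poly_Mapping.single w a = a \<odot>\<^bsub>free_algebra X\<^esub> Poly_Mapping.single w 1"
      by (simp add: free_algebra_def monoid_algebra_simps map_mult_single)
    then have "presented_class X R (Poly_Mapping.single w a) \<in> S"
      using c(5)[OF car] word S(2) add by simp
    moreover have "p \<in> carrier (free_algebra X)"
      using add by (simp add: free_algebra_def monoid_algebra_simps free_monoid_def)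
    moreover have "Poly_Mapping.single w a + p = Poly_Mapping.single w a \<oplus>\<^bsub>free_algebra X\<^esub> p"
      by (simp add: free_algebra_def monoid_algebra_simps)
    ultimately show ?case using add c(3) car subringE(7)[OF S(1)] by simp
  qed
  then show ?thesis
    by (auto simp: presented_carrier) (simp add: free_algebra_def monoid_algebra_simps free_monoid_def)
qed

end

section \<open>Subalgebras attached to morphisms\<close>

lemma alg_hom_image_subalgebra:
  assumes "assoc_algebra A" "assoc_algebra B" "alg_hom A B f"
  shows "is_subalgebra B (f ` carrier A)"
proof -
  interpret A: assoc_algebra A by fact
  interpret B: assoc_algebra B by fact
  interpret f: ring_hom_ring A B f
    using assms(3) by (simp add: alg_hom_def ring_hom_ringI2[OF A.ring_axioms B.ring_axioms])
  have "c \<odot>\<^bsub>B\<^esub> f x \<in> f ` carrier A" if "x \<in> carrier A" for c x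
    using alg_homD(5)[OF assms(3) that, of c] that by (metis A.smult_closed imageI)
  then show ?thesis
    unfolding is_subalgebra_def using f.img_is_subring[OF A.carrier_is_subring] by auto
qed

lemma alg_hom_preimage_subalgebra:
  assumes "assoc_algebra A" "assoc_algebra B" "alg_hom A B f" "is_subalgebra B S"
  shows "is_subalgebra A {x \<in> carrier A. f x \<in> S}"
proof -
  interpret A: assoc_algebra A by fact
  interpret B: assoc_algebra B by fact
  have S: "subring S B" "\<And>c x. x \<in> S \<Longrightarrow> c \<odot>\<^bsub>B\<^esub> x \<in> S"
    using assms(4) by (auto simp: is_subalgebra_def)
  have "subring {x \<in> carrier A. f x \<in> S} A"
    by (rule A.subringI)
      (use subringE[OF S(1)] in \<open>auto simp: alg_homD[OF assms(3)] alg_hom_uminus[OF assms(1-3)]\<close>)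
  then show ?thesis using S(2) by (auto simp: is_subalgebra_def alg_homD[OF assms(3)])
qed

lemma alg_hom_equaliser_subalgebra:
  assumes "assoc_algebra A" "assoc_algebra B" "alg_hom A B f" "alg_hom A B g"
  shows "is_subalgebra A {x \<in> carrier A. f x = g x}"
proof -
  interpret A: assoc_algebra A by fact
  have "subring {x \<in> carrier A. f x = g x} A"
    by (rule A.subringI)
      (auto simp: alg_homD[OF assms(3)] alg_homD[OF assms(4)]
         alg_hom_uminus[OF assms(1-3)] alg_hom_uminus[OF assms(1,2,4)])
  then show ?thesis by (auto simp: is_subalgebra_def alg_homD[OF assms(3)] alg_homD[OF assms(4)])
qed

section \<open>Tensor powers\<close>

abbreviation tuples :: "('k::field, 'a) module \<Rightarrow> nat \<Rightarrow> 'a list set" where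
  "tuples A n \<equiv> carrier (tuple_monoid A n)"

context assoc_algebra begin

lemma tuples_iff: "xs \<in> tuples A n \<longleftrightarrow> length xs = n \<and> (\<forall>i<n. xs ! i \<in> carrier A)"
  by (auto simp: tuple_monoid_def set_conv_nth)

lemma tuple_mult_closed: "xs \<in> tuples A n \<Longrightarrow> ys \<in> tuples A n \<Longrightarrow> map2 (mult A) xs ys \<in> tuples A n"
  by (simp add: tuples_iff)

lemma tuple_one_closed: "replicate n \<one> \<in> tuples A n"
  by (simp add: tuples_iff)

lemma tuple_update_closed: "xs \<in> tuples A n \<Longrightarrow> x \<in> carrier A \<Longrightarrow> xs[i := x] \<in> tuples A n"
  by (cases "i < n") (simp_all add: tuples_iff nth_list_update)

lemma tuple_append_closed: "xs \<in> tuples A m \<Longrightarrow> ys \<in> tuples A n \<Longrightarrow> xs @ ys \<in> tuples A (m + n)"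
  by (auto simp: tuples_iff nth_append)

lemma tuple_monoid: "Group.monoid (tuple_monoid A n)"
proof (rule monoidI)
  fix xs ys zs assume "xs \<in> tuples A n" "ys \<in> tuples A n" "zs \<in> tuples A n"
  then show "xs \<otimes>\<^bsub>tuple_monoid A n\<^esub> ys \<otimes>\<^bsub>tuple_monoid A n\<^esub> zs =
      xs \<otimes>\<^bsub>tuple_monoid A n\<^esub> (ys \<otimes>\<^bsub>tuple_monoid A n\<^esub> zs)"
    by (auto simp: tuples_iff, simp add: tuple_monoid_def) (rule nth_equalityI, simp_all add: m_assoc)
next
  fix xs assume "xs \<in> tuples A n"
  then show "\<one>\<^bsub>tuple_monoid A n\<^esub> \<otimes>\<^bsub>tuple_monoid A n\<^esub> xs = xs" "xs \<otimes>\<^bsub>tuple_monoid A n\<^esub> \<one>\<^bsub>tuple_monoid A n\<^esub> = xs"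
    by (simp_all add: tuples_iff, simp_all add: tuple_monoid_def) (rule nth_equalityI, simp_all)+
next
  show "\<one>\<^bsub>tuple_monoid A n\<^esub> \<in> tuples A n"
    using tuple_one_closed[of n] by (simp add: tuple_monoid_def)
next
  fix xs ys assume "xs \<in> tuples A n" "ys \<in> tuples A n"
  from tuple_mult_closed[OF this] show "xs \<otimes>\<^bsub>tuple_monoid A n\<^esub> ys \<in> tuples A n"
    by (simp add: tuple_monoid_def)
qed

lemma single_tuple_carrier:
  "xs \<in> tuples A n \<Longrightarrow> Poly_Mapping.single xs c \<in> carrier (monoid_algebra (tuple_monoid A n))"
  for c :: 'k
  by (simp add: monoid_algebra_simps)

lemma multilinearity_relations_carrier:
  "multilinearity_relations A n \<subseteq> carrier (monoid_algebra (tuple_monoid A n))"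
proof -
  have 2: "Poly_Mapping.keys (Poly_Mapping.single x a - Poly_Mapping.single y b) \<subseteq> S"
    if "x \<in> S" "y \<in> S" for x y :: "'a list" and a b :: 'k and S
    using that by (auto simp: in_keys_iff lookup_minus lookup_single when_def split: if_splits)
  have 3: "Poly_Mapping.keys (Poly_Mapping.single x a - Poly_Mapping.single y b - Poly_Mapping.single z c) \<subseteq> S"
    if "x \<in> S" "y \<in> S" "z \<in> S" for x y z :: "'a list" and a b c :: 'k and S
    using that by (auto simp: in_keys_iff lookup_minus lookup_single when_def split: if_splits)
  show ?thesis
    unfolding multilinearity_relations_def monoid_algebra_simps
  proof (intro Un_least subsetI; elim CollectE exE conjE; rule CollectI; hypsubst)
    fix xs i a b
    assume "xs \<in> tuples A n" "a \<in> carrier A" "b \<in> carrier A"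
    then show "Poly_Mapping.keys (Poly_Mapping.single (xs[i := a \<oplus> b]) (1::'k) - Poly_Mapping.single (xs[i := a]) 1
        - Poly_Mapping.single (xs[i := b]) 1) \<subseteq> tuples A n"
      by (intro 3 tuple_update_closed) simp_all
  next
    fix xs i a c
    assume "xs \<in> tuples A n" "a \<in> carrier A"
    then show "Poly_Mapping.keys (Poly_Mapping.single (xs[i := c \<odot> a]) 1 - Poly_Mapping.single (xs[i := a]) c)
        \<subseteq> tuples A n"
      by (intro 2 tuple_update_closed) simp_all
  qed
qed

lemma tuple_algebra: "assoc_algebra (monoid_algebra (tuple_monoid A n) :: ('k, _) module)"
  by (rule monoid_algebra_assoc_algebra[OF tuple_monoid])

lemma tensor_ideal: "ideal (tensor_ideal A n) (monoid_algebra (tuple_monoid A n))"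
proof -
  interpret M: assoc_algebra "monoid_algebra (tuple_monoid A n) :: ('k, _) module" by (rule tuple_algebra)
  show ?thesis unfolding tensor_ideal_def
    by (rule M.genideal_ideal[OF multilinearity_relations_carrier])
qed

lemma tensor_power: "assoc_algebra (tensor_power A n)"
  unfolding tensor_power_def by (rule assoc_algebra.quot_algebra[OF tuple_algebra tensor_ideal])

definition tclass where
  "tclass n p = tensor_ideal A n +>\<^bsub>monoid_algebra (tuple_monoid A n)\<^esub> p"

lemma tclass_hom: "alg_hom (monoid_algebra (tuple_monoid A n)) (tensor_power A n) (tclass n)"
  unfolding tensor_power_def tclass_def by (rule assoc_algebra.coset_hom[OF tuple_algebra tensor_ideal])

lemma tensor_carrier:
  "carrier (tensor_power A n) = tclass n ` carrier (monoid_algebra (tuple_monoid A n))"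
  unfolding tensor_power_def tclass_def quot_algebra_carrier by simp

lemma pure_tclass: "xs \<in> tuples A n \<Longrightarrow> pure_tensor A xs = tclass n (Poly_Mapping.single xs 1)"
  by (simp add: tuples_iff pure_tensor_def tclass_def)

lemma pure_closed: "xs \<in> tuples A n \<Longrightarrow> pure_tensor A xs \<in> carrier (tensor_power A n)"
  by (simp add: pure_tclass alg_homD(1)[OF tclass_hom] single_tuple_carrier)

lemma pure_mult:
  assumes "xs \<in> tuples A n" "ys \<in> tuples A n"
  shows "pure_tensor A xs \<otimes>\<^bsub>tensor_power A n\<^esub> pure_tensor A ys = pure_tensor A (map2 (mult A) xs ys)"
proof -
  have "xs \<otimes>\<^bsub>tuple_monoid A n\<^esub> ys = map2 (mult A) xs ys" by (simp add: tuple_monoid_def)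
  then show ?thesis
    using alg_homD(2)[OF tclass_hom single_tuple_carrier[OF assms(1), of 1] single_tuple_carrier[OF assms(2), of 1]]
      pure_tclass[OF assms(1)] pure_tclass[OF assms(2)] pure_tclass[OF tuple_mult_closed[OF assms]]
    by (simp add: monoid_algebra_mult_single)
qed

lemma pure_one: "pure_tensor A (replicate n \<one>) = \<one>\<^bsub>tensor_power A n\<^esub>"
proof -
  have "\<one>\<^bsub>monoid_algebra (tuple_monoid A n)\<^esub> = Poly_Mapping.single (replicate n \<one>) (1 :: 'k)"
    by (simp add: monoid_algebra_simps tuple_monoid_def)
  then show ?thesis
    using alg_homD(4)[OF tclass_hom, of n] pure_tclass[OF tuple_one_closed, of n] by simp
qed

lemma tclass_zero: assumes "p \<in> multilinearity_relations A n" shows "tclass n p = \<zero>\<^bsub>tensor_power A n\<^esub>"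
proof -
  interpret M: assoc_algebra "monoid_algebra (tuple_monoid A n) :: ('k, _) module" by (rule tuple_algebra)
  interpret I: ideal "tensor_ideal A n" "monoid_algebra (tuple_monoid A n) :: ('k, _) module" by (rule tensor_ideal)
  have "p \<in> tensor_ideal A n"
    unfolding tensor_ideal_def using M.genideal_self[OF multilinearity_relations_carrier] assms by blast
  then show ?thesis
    unfolding tclass_def tensor_power_def quot_algebra_simps by (rule I.a_rcos_const)
qed

lemma pure_smult:
  assumes xs: "xs \<in> tuples A n" "i < n" and a: "a \<in> carrier A"
  shows "pure_tensor A (xs[i := c \<odot> a]) = c \<odot>\<^bsub>tensor_power A n\<^esub> pure_tensor A (xs[i := a])"
proof -
  interpret T: assoc_algebra "tensor_power A n" by (rule tensor_power)
  interpret M: assoc_algebra "monoid_algebra (tuple_monoid A n) :: ('k, _) module" by (rule tuple_algebra)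
  note t = tuple_update_closed[OF xs(1)]
  note hom = alg_homD[OF tclass_hom[of n]]
  let ?x = "Poly_Mapping.single (xs[i := c \<odot> a]) (1 :: 'k)" and ?y = "Poly_Mapping.single (xs[i := a]) c"
  have mem: "?x \<in> carrier (monoid_algebra (tuple_monoid A n))" "?y \<in> carrier (monoid_algebra (tuple_monoid A n))"
    "Poly_Mapping.single (xs[i := a]) (1::'k) \<in> carrier (monoid_algebra (tuple_monoid A n))"
    using a by (simp_all add: single_tuple_carrier t)
  have "?x - ?y \<in> multilinearity_relations A n"
    unfolding multilinearity_relations_def using assms by blast
  then have d: "tclass n (?x - ?y) = \<zero>\<^bsub>tensor_power A n\<^esub>" "?x - ?y \<in> carrier (monoid_algebra (tuple_monoid A n))"
    using tclass_zero multilinearity_relations_carrier by blast+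
  have "?x = (?x - ?y) \<oplus>\<^bsub>monoid_algebra (tuple_monoid A n)\<^esub> ?y" by (simp add: monoid_algebra_simps)
  then have "tclass n ?x = tclass n (?x - ?y) \<oplus>\<^bsub>tensor_power A n\<^esub> tclass n ?y"
    using hom(3)[OF d(2) mem(2)] by simp
  then have "tclass n ?x = tclass n ?y" using d(1) hom(1)[OF mem(2)] by simp
  moreover have "?y = c \<odot>\<^bsub>monoid_algebra (tuple_monoid A n)\<^esub> Poly_Mapping.single (xs[i := a]) 1"
    by (simp add: monoid_algebra_simps map_mult_single)
  ultimately show ?thesis
    using hom(5)[OF mem(3), of c] a by (simp add: pure_tclass[of _ n] t)
qed

lemma pure_add:
  assumes xs: "xs \<in> tuples A n" "i < n" and ab: "a \<in> carrier A" "b \<in> carrier A"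
  shows "pure_tensor A (xs[i := a \<oplus> b]) = pure_tensor A (xs[i := a]) \<oplus>\<^bsub>tensor_power A n\<^esub> pure_tensor A (xs[i := b])"
proof -
  interpret T: assoc_algebra "tensor_power A n" by (rule tensor_power)
  note t = tuple_update_closed[OF xs(1)]
  note hom = alg_homD[OF tclass_hom[of n]]
  let ?x = "Poly_Mapping.single (xs[i := a \<oplus> b]) (1 :: 'k)" and ?y = "Poly_Mapping.single (xs[i := a]) (1 :: 'k)"
    and ?z = "Poly_Mapping.single (xs[i := b]) (1 :: 'k)"
  let ?M = "monoid_algebra (tuple_monoid A n)"
  have mem: "?x \<in> carrier ?M" "?y \<in> carrier ?M" "?z \<in> carrier ?M"
    using ab by (simp_all add: single_tuple_carrier t)
  have "?x - ?y - ?z \<in> multilinearity_relations A n"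
    unfolding multilinearity_relations_def using assms by blast
  then have d: "tclass n (?x - ?y - ?z) = \<zero>\<^bsub>tensor_power A n\<^esub>" "?x - ?y - ?z \<in> carrier ?M"
    using tclass_zero multilinearity_relations_carrier by blast+
  have yz: "?y \<oplus>\<^bsub>?M\<^esub> ?z \<in> carrier ?M"
    using mem tuple_algebra by (meson assoc_algebra.axioms(1) ring.ring_simprules(1))
  have "?x = (?x - ?y - ?z) \<oplus>\<^bsub>?M\<^esub> (?y \<oplus>\<^bsub>?M\<^esub> ?z)" by (simp add: monoid_algebra_simps)
  then have "tclass n ?x = tclass n (?x - ?y - ?z) \<oplus>\<^bsub>tensor_power A n\<^esub> tclass n (?y \<oplus>\<^bsub>?M\<^esub> ?z)"
    using hom(3)[OF d(2) yz] by simp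
  then have "tclass n ?x = tclass n ?y \<oplus>\<^bsub>tensor_power A n\<^esub> tclass n ?z"
    using d(1) hom(1)[OF yz] hom(3)[OF mem(2,3)] by simp
  then show ?thesis using ab by (simp add: pure_tclass[of _ n] t)
qed

lemma tensor_induct [consumes 1, case_names zero pure add smult]:
  assumes X: "X \<in> carrier (tensor_power A n)"
    and zero: "P \<zero>\<^bsub>tensor_power A n\<^esub>"
    and pure: "\<And>xs. xs \<in> tuples A n \<Longrightarrow> P (pure_tensor A xs)"
    and add: "\<And>Y Z. Y \<in> carrier (tensor_power A n) \<Longrightarrow> Z \<in> carrier (tensor_power A n) \<Longrightarrow> P Y \<Longrightarrow> P Z
      \<Longrightarrow> P (Y \<oplus>\<^bsub>tensor_power A n\<^esub> Z)"
    and smult: "\<And>c Y. Y \<in> carrier (tensor_power A n) \<Longrightarrow> P Y \<Longrightarrow> P (c \<odot>\<^bsub>tensor_power A n\<^esub> Y)"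
  shows "P X"
proof -
  note hom = alg_homD[OF tclass_hom[of n]]
  have "P (tclass n p)" if "Poly_Mapping.keys p \<subseteq> tuples A n" for p
    using that
  proof (induction p rule: poly_mapping_induct)
    case zero
    then show ?case
      using alg_hom_zero[OF tuple_algebra tensor_power tclass_hom] assms(2) by (simp add: monoid_algebra_simps)
  next
    case (add xs c p)
    have s: "Poly_Mapping.single xs (1::'k) \<in> carrier (monoid_algebra (tuple_monoid A n))"
      and s': "Poly_Mapping.single xs c \<in> carrier (monoid_algebra (tuple_monoid A n))"
      using add(1) by (simp_all add: single_tuple_carrier)
    have p: "p \<in> carrier (monoid_algebra (tuple_monoid A n))" using add(2) by (simp add: monoid_algebra_simps)
    have "P (tclass n (Poly_Mapping.single xs 1))" using assms(3)[OF add(1)] add(1) by (simp add: pure_tclass)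
    then have "P (c \<odot>\<^bsub>tensor_power A n\<^esub> tclass n (Poly_Mapping.single xs 1))"
      using assms(5) hom(1)[OF s] by simp
    then have "P (tclass n (Poly_Mapping.single xs c))"
      using hom(5)[OF s, of c] by (simp add: monoid_algebra_simps map_mult_single)
    then show ?case
      using assms(4)[OF hom(1)[OF s'] hom(1)[OF p]] add(3) hom(3)[OF s' p] by (simp add: monoid_algebra_simps)
  qed
  then show ?thesis using X by (auto simp: tensor_carrier monoid_algebra_simps)
qed

text \<open>Multiplicativity is required besides multilinearity because the tensor power is a
  quotient by a two-sided ideal: for a multiplicative \<open>h\<close> it is enough to annihilate
  the generating relations. The last two conclusions are for maps that are only linear, like the
  tensor product with a fixed element.\<close>

lemma tensor_lift:
  fixes B :: "('k, 'b) module"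
  assumes B: "assoc_algebra B" and h: "\<And>xs. xs \<in> tuples A n \<Longrightarrow> h xs \<in> carrier B" "h (replicate n \<one>) = \<one>\<^bsub>B\<^esub>"
      "\<And>xs ys. xs \<in> tuples A n \<Longrightarrow> ys \<in> tuples A n \<Longrightarrow> h (map2 (mult A) xs ys) = h xs \<otimes>\<^bsub>B\<^esub> h ys"
    and add: "\<And>xs i a b. xs \<in> tuples A n \<Longrightarrow> i < n \<Longrightarrow> a \<in> carrier A \<Longrightarrow> b \<in> carrier A
      \<Longrightarrow> h (xs[i := a \<oplus> b]) = h (xs[i := a]) \<oplus>\<^bsub>B\<^esub> h (xs[i := b])"
    and smult: "\<And>xs i a c. xs \<in> tuples A n \<Longrightarrow> i < n \<Longrightarrow> a \<in> carrier A
      \<Longrightarrow> h (xs[i := c \<odot> a]) = c \<odot>\<^bsub>B\<^esub> h (xs[i := a])"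
  shows "alg_hom (tensor_power A n) B (lin_lift B h)"
    "xs \<in> tuples A n \<Longrightarrow> lin_lift B h (pure_tensor A xs) = h xs"
    "p \<in> carrier (monoid_algebra (tuple_monoid A n)) \<Longrightarrow> lin_lift B h (tclass n p) = lin_ext B h p"
    "p \<in> tensor_ideal A n \<Longrightarrow> lin_ext B h p = \<zero>\<^bsub>B\<^esub>"
proof -
  interpret B: assoc_algebra B by (rule B)
  let ?M = "monoid_algebra (tuple_monoid A n) :: ('k, _) module"
  have o: "h \<one>\<^bsub>tuple_monoid A n\<^esub> = \<one>\<^bsub>B\<^esub>" by (simp add: tuple_monoid_def h(2))
  have m: "h (xs \<otimes>\<^bsub>tuple_monoid A n\<^esub> ys) = h xs \<otimes>\<^bsub>B\<^esub> h ys" if "xs \<in> tuples A n" "ys \<in> tuples A n" for xs ys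
    using h(3)[OF that] by (simp add: tuple_monoid_def)
  have hom: "alg_hom ?M B (lin_ext B h)"
    by (rule B.lin_ext_hom[OF tuple_monoid h(1) o m])
  note l = B.lin_ext_single[of h, OF h(1)] alg_hom_minus[OF tuple_algebra B hom]
  have minus: "x \<ominus>\<^bsub>?M\<^esub> y = x - y" if "x \<in> carrier ?M" "y \<in> carrier ?M" for x y
  proof -
    interpret M: assoc_algebra ?M by (rule tuple_algebra)
    have "- y \<oplus>\<^bsub>?M\<^esub> y = \<zero>\<^bsub>?M\<^esub>" "- y \<in> carrier ?M" using that by (simp_all add: monoid_algebra_simps)
    then have "\<ominus>\<^bsub>?M\<^esub> y = - y" using M.minus_equality that by blast
    then show ?thesis by (simp add: a_minus_def monoid_algebra_simps)
  qed
  have kill: "lin_ext B h r = \<zero>\<^bsub>B\<^esub>" if "r \<in> multilinearity_relations A n" for r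
    using that unfolding multilinearity_relations_def
  proof (elim UnE CollectE exE conjE)
    fix xs i a b
    assume r: "r = Poly_Mapping.single (xs[i := a \<oplus> b]) 1 - Poly_Mapping.single (xs[i := a]) 1
        - Poly_Mapping.single (xs[i := b]) 1"
      and xs: "xs \<in> tuples A n" "i < n" "a \<in> carrier A" "b \<in> carrier A"
    have t: "xs[i := a \<oplus> b] \<in> tuples A n" "xs[i := a] \<in> tuples A n" "xs[i := b] \<in> tuples A n"
      using xs by (simp_all add: tuple_update_closed)
    note s = single_tuple_carrier[OF t(1), of 1] single_tuple_carrier[OF t(2), of 1] single_tuple_carrier[OF t(3), of 1]
    interpret M: assoc_algebra ?M by (rule tuple_algebra)
    have "r = Poly_Mapping.single (xs[i := a \<oplus> b]) 1 \<ominus>\<^bsub>?M\<^esub> Poly_Mapping.single (xs[i := a]) 1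
        \<ominus>\<^bsub>?M\<^esub> Poly_Mapping.single (xs[i := b]) 1"
      using s M.minus_closed[OF s(1,2)] unfolding r by (simp add: minus)
    then have "lin_ext B h r = h (xs[i := a \<oplus> b]) \<ominus>\<^bsub>B\<^esub> h (xs[i := a]) \<ominus>\<^bsub>B\<^esub> h (xs[i := b])"
      using s t h(1) M.minus_closed[OF s(1,2)] by (simp add: l)
    also have "\<dots> = \<zero>\<^bsub>B\<^esub>"
    proof -
      have "h (xs[i := a]) \<in> carrier B" "h (xs[i := b]) \<in> carrier B" using h(1) t by blast+
      moreover have "x \<oplus>\<^bsub>B\<^esub> y \<oplus>\<^bsub>B\<^esub> \<ominus>\<^bsub>B\<^esub> x \<oplus>\<^bsub>B\<^esub> \<ominus>\<^bsub>B\<^esub> y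
          = (x \<oplus>\<^bsub>B\<^esub> y) \<oplus>\<^bsub>B\<^esub> \<ominus>\<^bsub>B\<^esub> (x \<oplus>\<^bsub>B\<^esub> y)"
        if "x \<in> carrier B" "y \<in> carrier B" for x y
        using that by (simp add: B.minus_add B.a_assoc)
      ultimately show ?thesis
        unfolding add[OF xs] a_minus_def by (simp add: B.r_neg)
    qed
    finally show ?thesis .
  next
    fix xs i a c
    assume r: "r = Poly_Mapping.single (xs[i := c \<odot> a]) 1 - Poly_Mapping.single (xs[i := a]) c"
      and xs: "xs \<in> tuples A n" "i < n" "a \<in> carrier A"
    have t: "xs[i := c \<odot> a] \<in> tuples A n" "xs[i := a] \<in> tuples A n"
      using xs by (simp_all add: tuple_update_closed)
    note s = single_tuple_carrier[OF t(1), of 1] single_tuple_carrier[OF t(2), of c]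
    have "r = Poly_Mapping.single (xs[i := c \<odot> a]) 1 \<ominus>\<^bsub>?M\<^esub> Poly_Mapping.single (xs[i := a]) c"
      using s unfolding r by (simp add: minus)
    then have "lin_ext B h r = h (xs[i := c \<odot> a]) \<ominus>\<^bsub>B\<^esub> c \<odot>\<^bsub>B\<^esub> h (xs[i := a])"
      using s t h(1) by (simp add: l)
    then show ?thesis using smult[OF xs] h(1)[OF t(2)] by (simp add: a_minus_def B.r_neg)
  qed
  note L = lin_lift_hom[OF tuple_monoid B multilinearity_relations_carrier h(1) _ _ kill, folded tensor_ideal_def]
  show "alg_hom (tensor_power A n) B (lin_lift B h)"
    unfolding tensor_power_def by (rule L(1)[OF _ o m])
  show 3: "lin_lift B h (tclass n p) = lin_ext B h p" if "p \<in> carrier ?M" for p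
    unfolding tclass_def by (rule L(2)[OF _ o m _ that])
  show "lin_ext B h p = \<zero>\<^bsub>B\<^esub>" if "p \<in> tensor_ideal A n" for p
    by (rule L(3)[OF _ o m _ that])
  show "lin_lift B h (pure_tensor A xs) = h xs" if xs: "xs \<in> tuples A n"
    using 3[OF single_tuple_carrier[OF xs, of 1]] by (simp add: pure_tclass[OF xs] l(1)[OF xs] h(1)[OF xs])
qed

end

section \<open>Embeddings into tensor powers\<close>

context assoc_algebra begin

abbreviation T where "T \<equiv> tensor_power A"

lemma map2_ones: "map2 (mult A) (replicate n \<one>) (replicate n \<one>) = replicate n \<one>"
  by (simp add: zip_replicate)

lemma nth_ones_update: "j < n \<Longrightarrow> (replicate n \<one>)[i := x] ! j = (if i = j then x else \<one>)"
  by (cases "i < n") (auto simp: nth_list_update)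

text \<open>Tensor positions count from 0, whereas the elements of connected subsets count from
  1.\<close>

definition pos where "pos n i x = pure_tensor A ((replicate n \<one>)[i := x])"

lemma pos_hom:
  assumes "i < n" shows "alg_hom A (T n) (pos n i)"
proof (rule alg_homI)
  note o = tuple_one_closed[of n]
  fix x assume x: "x \<in> carrier A"
  show "pos n i x \<in> carrier (T n)" unfolding pos_def by (intro pure_closed tuple_update_closed o x)
  show "pos n i (c \<odot> x) = c \<odot>\<^bsub>T n\<^esub> pos n i x" for c
    unfolding pos_def by (rule pure_smult[OF o assms x])
  fix y assume y: "y \<in> carrier A"
  show "pos n i (x \<oplus> y) = pos n i x \<oplus>\<^bsub>T n\<^esub> pos n i y"
    unfolding pos_def by (rule pure_add[OF o assms x y])
  have "map2 (mult A) ((replicate n \<one>)[i := x]) ((replicate n \<one>)[i := y]) = (replicate n \<one>)[i := x \<otimes> y]"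
    by (rule nth_equalityI) (simp_all add: nth_ones_update x y)
  then show "pos n i (x \<otimes> y) = pos n i x \<otimes>\<^bsub>T n\<^esub> pos n i y"
    unfolding pos_def by (simp add: pure_mult[OF tuple_update_closed[OF o x] tuple_update_closed[OF o y]])
next
  have "(replicate n \<one>)[i := \<one>] = replicate n \<one>" by (rule nth_equalityI) (simp_all add: nth_ones_update)
  then show "pos n i \<one> = \<one>\<^bsub>T n\<^esub>" unfolding pos_def by (simp add: pure_one)
qed

lemma pos_commute:
  assumes "i \<noteq> j" "x \<in> carrier A" "y \<in> carrier A"
  shows "pos n i x \<otimes>\<^bsub>T n\<^esub> pos n j y = pos n j y \<otimes>\<^bsub>T n\<^esub> pos n i x"
proof -
  note o = tuple_one_closed[of n]
  have "map2 (mult A) ((replicate n \<one>)[i := x]) ((replicate n \<one>)[j := y]) =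
      map2 (mult A) ((replicate n \<one>)[j := y]) ((replicate n \<one>)[i := x])"
    by (rule nth_equalityI) (use assms in \<open>simp_all add: nth_ones_update\<close>)
  then show ?thesis unfolding pos_def
    by (simp add: pure_mult[OF tuple_update_closed[OF o] tuple_update_closed[OF o]] assms)
qed

text \<open>Tensoring with units on the right or on the left. Unlike \<open>tensor_concat\<close>
  itself, these maps are algebra morphisms, and \<open>tensor_concat\<close> is the product of their
  values.\<close>

definition left where "left a b = lin_lift (T (a + b)) (\<lambda>xs. pure_tensor A (xs @ replicate b \<one>))"
definition right where "right a b = lin_lift (T (a + b)) (\<lambda>ys. pure_tensor A (replicate a \<one> @ ys))"

lemma left:
  shows left_hom: "alg_hom (T a) (T (a + b)) (left a b)"
    and left_pure: "xs \<in> tuples A a \<Longrightarrow> left a b (pure_tensor A xs) = pure_tensor A (xs @ replicate b \<one>)"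
    and left_tclass: "p \<in> carrier (monoid_algebra (tuple_monoid A a)) \<Longrightarrow>
      left a b (tclass a p) = lin_ext (T (a + b)) (\<lambda>xs. pure_tensor A (xs @ replicate b \<one>)) p"
    and left_kills: "p \<in> tensor_ideal A a \<Longrightarrow>
      lin_ext (T (a + b)) (\<lambda>xs. pure_tensor A (xs @ replicate b \<one>)) p = \<zero>\<^bsub>T (a + b)\<^esub>"
proof -
  let ?h = "\<lambda>xs. pure_tensor A (xs @ replicate b \<one>)"
  have c: "xs @ replicate b \<one> \<in> tuples A (a + b)" if "xs \<in> tuples A a" for xs
    using that by (simp add: tuple_append_closed tuple_one_closed)
  have 1: "?h xs \<in> carrier (T (a + b))" if "xs \<in> tuples A a" for xs using c[OF that] by (rule pure_closed)
  have 2: "?h (replicate a \<one>) = \<one>\<^bsub>T (a + b)\<^esub>" by (simp add: pure_one flip: replicate_add)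
  have 3: "?h (map2 (mult A) xs ys) = ?h xs \<otimes>\<^bsub>T (a + b)\<^esub> ?h ys" if "xs \<in> tuples A a" "ys \<in> tuples A a" for xs ys
    using that pure_mult[OF c[OF that(1)] c[OF that(2)]] by (simp add: tuples_iff map2_ones)
  have 4: "?h (xs[i := x \<oplus> y]) = ?h (xs[i := x]) \<oplus>\<^bsub>T (a + b)\<^esub> ?h (xs[i := y])"
    if "xs \<in> tuples A a" "i < a" "x \<in> carrier A" "y \<in> carrier A" for xs i x y
    using that pure_add[OF c[OF that(1)], of i x y] by (simp add: tuples_iff list_update_append1)
  have 5: "?h (xs[i := k \<odot> x]) = k \<odot>\<^bsub>T (a + b)\<^esub> ?h (xs[i := x])"
    if "xs \<in> tuples A a" "i < a" "x \<in> carrier A" for xs i x k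
    using that pure_smult[OF c[OF that(1)], of i x k] by (simp add: tuples_iff list_update_append1)
  note L = tensor_lift[OF tensor_power, of a ?h "a + b", OF 1 2 3 4 5, folded left_def]
  show "alg_hom (T a) (T (a + b)) (left a b)" by (rule L(1))
  show "xs \<in> tuples A a \<Longrightarrow> left a b (pure_tensor A xs) = ?h xs" by (rule L(2))
  show "p \<in> carrier (monoid_algebra (tuple_monoid A a)) \<Longrightarrow> left a b (tclass a p) = lin_ext (T (a + b)) ?h p"
    by (rule L(3))
  show "p \<in> tensor_ideal A a \<Longrightarrow> lin_ext (T (a + b)) ?h p = \<zero>\<^bsub>T (a + b)\<^esub>"
    by (rule L(4))
qed

lemma right:
  shows right_hom: "alg_hom (T b) (T (a + b)) (right a b)"
    and right_pure: "ys \<in> tuples A b \<Longrightarrow> right a b (pure_tensor A ys) = pure_tensor A (replicate a \<one> @ ys)"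
    and right_tclass: "p \<in> carrier (monoid_algebra (tuple_monoid A b)) \<Longrightarrow>
      right a b (tclass b p) = lin_ext (T (a + b)) (\<lambda>ys. pure_tensor A (replicate a \<one> @ ys)) p"
    and right_kills: "p \<in> tensor_ideal A b \<Longrightarrow>
      lin_ext (T (a + b)) (\<lambda>ys. pure_tensor A (replicate a \<one> @ ys)) p = \<zero>\<^bsub>T (a + b)\<^esub>"
proof -
  let ?h = "\<lambda>ys. pure_tensor A (replicate a \<one> @ ys)"
  have c: "replicate a \<one> @ ys \<in> tuples A (a + b)" if "ys \<in> tuples A b" for ys
    using that by (simp add: tuple_append_closed tuple_one_closed)
  have 1: "?h ys \<in> carrier (T (a + b))" if "ys \<in> tuples A b" for ys using c[OF that] by (rule pure_closed)
  have 2: "?h (replicate b \<one>) = \<one>\<^bsub>T (a + b)\<^esub>" by (simp add: pure_one flip: replicate_add)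
  have 3: "?h (map2 (mult A) xs ys) = ?h xs \<otimes>\<^bsub>T (a + b)\<^esub> ?h ys" if "xs \<in> tuples A b" "ys \<in> tuples A b" for xs ys
    using that pure_mult[OF c[OF that(1)] c[OF that(2)]] by (simp add: tuples_iff map2_ones)
  have 4: "?h (ys[i := x \<oplus> y]) = ?h (ys[i := x]) \<oplus>\<^bsub>T (a + b)\<^esub> ?h (ys[i := y])"
    if "ys \<in> tuples A b" "i < b" "x \<in> carrier A" "y \<in> carrier A" for ys i x y
    using that pure_add[OF c[OF that(1)], of "a + i" x y] by (simp add: tuples_iff list_update_append)
  have 5: "?h (ys[i := k \<odot> x]) = k \<odot>\<^bsub>T (a + b)\<^esub> ?h (ys[i := x])"
    if "ys \<in> tuples A b" "i < b" "x \<in> carrier A" for ys i x k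
    using that pure_smult[OF c[OF that(1)], of "a + i" x k] by (simp add: tuples_iff list_update_append)
  note L = tensor_lift[OF tensor_power, of b ?h "a + b", OF 1 2 3 4 5, folded right_def]
  show "alg_hom (T b) (T (a + b)) (right a b)" by (rule L(1))
  show "ys \<in> tuples A b \<Longrightarrow> right a b (pure_tensor A ys) = ?h ys" by (rule L(2))
  show "p \<in> carrier (monoid_algebra (tuple_monoid A b)) \<Longrightarrow> right a b (tclass b p) = lin_ext (T (a + b)) ?h p"
    by (rule L(3))
  show "p \<in> tensor_ideal A b \<Longrightarrow> lin_ext (T (a + b)) ?h p = \<zero>\<^bsub>T (a + b)\<^esub>"
    by (rule L(4))
qed

lemma left_pos: "i < a \<Longrightarrow> x \<in> carrier A \<Longrightarrow> left a b (pos a i x) = pos (a + b) i x"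
  by (simp add: pos_def left_pure tuple_update_closed tuple_one_closed replicate_add list_update_append1)

lemma right_pos: "i < b \<Longrightarrow> x \<in> carrier A \<Longrightarrow> right a b (pos b i x) = pos (a + b) (a + i) x"
  by (simp add: pos_def right_pure tuple_update_closed tuple_one_closed replicate_add list_update_append)

lemma left_right_pure:
  assumes "xs \<in> tuples A a" "ys \<in> tuples A b"
  shows "left a b (pure_tensor A xs) \<otimes>\<^bsub>T (a + b)\<^esub> right a b (pure_tensor A ys) = pure_tensor A (xs @ ys)"
    "right a b (pure_tensor A ys) \<otimes>\<^bsub>T (a + b)\<^esub> left a b (pure_tensor A xs) = pure_tensor A (xs @ ys)"
proof -
  have "map2 (mult A) xs (replicate a \<one>) = xs" "map2 (mult A) (replicate a \<one>) xs = xs"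
      "map2 (mult A) ys (replicate b \<one>) = ys" "map2 (mult A) (replicate b \<one>) ys = ys"
    using assms by (auto simp: tuples_iff intro: nth_equalityI)
  then have "map2 (mult A) (xs @ replicate b \<one>) (replicate a \<one> @ ys) = xs @ ys"
      "map2 (mult A) (replicate a \<one> @ ys) (xs @ replicate b \<one>) = xs @ ys"
    using assms by (simp_all add: tuples_iff)
  moreover have "xs @ replicate b \<one> \<in> tuples A (a + b)" "replicate a \<one> @ ys \<in> tuples A (a + b)"
    using assms by (simp_all add: tuple_append_closed tuple_one_closed)
  ultimately show
    "left a b (pure_tensor A xs) \<otimes>\<^bsub>T (a + b)\<^esub> right a b (pure_tensor A ys) = pure_tensor A (xs @ ys)"
    "right a b (pure_tensor A ys) \<otimes>\<^bsub>T (a + b)\<^esub> left a b (pure_tensor A xs) = pure_tensor A (xs @ ys)"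
    using assms by (simp_all add: left_pure right_pure pure_mult)
qed

lemma left_right_commute:
  assumes "X \<in> carrier (T a)" "Y \<in> carrier (T b)"
  shows "left a b X \<otimes>\<^bsub>T (a + b)\<^esub> right a b Y = right a b Y \<otimes>\<^bsub>T (a + b)\<^esub> left a b X"
proof -
  interpret TT: assoc_algebra "T (a + b)" by (rule tensor_power)
  interpret Ta: assoc_algebra "T a" by (rule tensor_power)
  interpret Tb: assoc_algebra "T b" by (rule tensor_power)
  note l = alg_homD[OF left_hom[of a b]] alg_hom_zero[OF tensor_power tensor_power left_hom[of a b]]
  note r = alg_homD[OF right_hom[of b a]] alg_hom_zero[OF tensor_power tensor_power right_hom[of b a]]
  have pure: "left a b (pure_tensor A xs) \<otimes>\<^bsub>T (a + b)\<^esub> right a b Y = right a b Y \<otimes>\<^bsub>T (a + b)\<^esub> left a b (pure_tensor A xs)"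
    if xs: "xs \<in> tuples A a" for xs
  proof -
    have x: "left a b (pure_tensor A xs) \<in> carrier (T (a + b))" using xs by (simp add: l(1) pure_closed)
    show ?thesis using assms(2)
      by (induction Y rule: tensor_induct)
        (simp_all add: r x left_right_pure[OF xs] TT.r_distr TT.l_distr TT.smult_mult_left TT.smult_mult_right)
  qed
  have y: "right a b Y \<in> carrier (T (a + b))" using assms(2) by (simp add: r(1))
  show ?thesis using assms(1)
    by (induction X rule: tensor_induct)
      (simp_all add: l y pure TT.r_distr TT.l_distr TT.smult_mult_left TT.smult_mult_right)
qed

text \<open>With one argument fixed, \<open>tensor_concat\<close> is linear but not multiplicative,
  so \<open>tensor_lift\<close> does not apply. Writing the tensor of \<open>xs @ ys\<close> as a
  product of two embedded tensors expresses both linear extensions through those of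
  \<open>left\<close> and \<open>right\<close>, which vanish on the tensor ideals.\<close>

lemma tensor_concat:
  assumes X: "X \<in> carrier (T a)" and Y: "Y \<in> carrier (T b)"
  shows "tensor_concat A a b X Y = left a b X \<otimes>\<^bsub>T (a + b)\<^esub> right a b Y"
proof -
  interpret TT: assoc_algebra "T (a + b)" by (rule tensor_power)
  obtain p where p: "p \<in> carrier (monoid_algebra (tuple_monoid A a))" "X = tclass a p"
    using X by (auto simp: tensor_carrier)
  obtain r where r: "r \<in> carrier (monoid_algebra (tuple_monoid A b))" "Y = tclass b r"
    using Y by (auto simp: tensor_carrier)
  have keys: "Poly_Mapping.keys p \<subseteq> tuples A a" "Poly_Mapping.keys r \<subseteq> tuples A b"
    using p r by (simp_all add: monoid_algebra_simps)
  have L: "left a b (pure_tensor A xs) \<in> carrier (T (a + b))" if "xs \<in> tuples A a" for xs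
    using that by (simp add: alg_homD(1)[OF left_hom] pure_closed)
  have R: "right a b (pure_tensor A ys) \<in> carrier (T (a + b))" if "ys \<in> tuples A b" for ys
    using that by (simp add: alg_homD(1)[OF right_hom] pure_closed)
  have RY: "right a b Y \<in> carrier (T (a + b))" using Y by (rule alg_homD(1)[OF right_hom])
  have sub: "Poly_Mapping.keys i \<subseteq> tuples A m" if "i \<in> tensor_ideal A m" for i m
    using ideal.axioms(1)[OF tensor_ideal, of m] that additive_subgroup.a_subset by (fastforce simp: monoid_algebra_simps)
  have inner: "lin_lift (T (a + b)) (\<lambda>ys. pure_tensor A (xs @ ys)) Y = left a b (pure_tensor A xs) \<otimes>\<^bsub>T (a + b)\<^esub> right a b Y"
    if xs: "xs \<in> tuples A a" for xs
  proof -
    have ext: "lin_ext (T (a + b)) (\<lambda>ys. pure_tensor A (xs @ ys)) s =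
        left a b (pure_tensor A xs) \<otimes>\<^bsub>T (a + b)\<^esub> lin_ext (T (a + b)) (\<lambda>ys. pure_tensor A (replicate a \<one> @ ys)) s"
      if s: "Poly_Mapping.keys s \<subseteq> tuples A b" for s
    proof -
      have "lin_ext (T (a + b)) (\<lambda>ys. pure_tensor A (xs @ ys)) s =
          lin_ext (T (a + b)) (\<lambda>ys. left a b (pure_tensor A xs) \<otimes>\<^bsub>T (a + b)\<^esub> right a b (pure_tensor A ys)) s"
        by (rule TT.lin_ext_cong) (use s in \<open>auto simp: left_right_pure[OF xs] intro!: TT.m_closed L[OF xs] R\<close>)
      also have "\<dots> = left a b (pure_tensor A xs) \<otimes>\<^bsub>T (a + b)\<^esub> lin_ext (T (a + b)) (\<lambda>ys. right a b (pure_tensor A ys)) s"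
        by (rule TT.lin_ext_mult_left[OF R L[OF xs] s])
      also have "lin_ext (T (a + b)) (\<lambda>ys. right a b (pure_tensor A ys)) s =
          lin_ext (T (a + b)) (\<lambda>ys. pure_tensor A (replicate a \<one> @ ys)) s"
        by (rule TT.lin_ext_cong) (use s R in \<open>auto simp: right_pure\<close>)
      finally show ?thesis .
    qed
    have "lin_lift (T (a + b)) (\<lambda>ys. pure_tensor A (xs @ ys)) Y = lin_ext (T (a + b)) (\<lambda>ys. pure_tensor A (xs @ ys)) r"
      unfolding r(2) tclass_def
    proof (rule lin_lift_coset[OF tuple_monoid tensor_power tensor_ideal _ _ r(1)])
      show "pure_tensor A (xs @ ys) \<in> carrier (T (a + b))" if "ys \<in> tuples A b" for ys
        using that xs by (intro pure_closed tuple_append_closed)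
      show "lin_ext (T (a + b)) (\<lambda>ys. pure_tensor A (xs @ ys)) i = \<zero>\<^bsub>T (a + b)\<^esub>" if "i \<in> tensor_ideal A b" for i
        using ext[OF sub[OF that]] right_kills[OF that] L[OF xs] by simp
    qed
    then show ?thesis using ext[OF keys(2)] right_tclass[OF r(1)] r(2) by simp
  qed
  let ?h = "\<lambda>xs. lin_lift (T (a + b)) (\<lambda>ys. pure_tensor A (xs @ ys)) Y"
  have ext: "lin_ext (T (a + b)) ?h s =
      lin_ext (T (a + b)) (\<lambda>xs. pure_tensor A (xs @ replicate b \<one>)) s \<otimes>\<^bsub>T (a + b)\<^esub> right a b Y"
    if s: "Poly_Mapping.keys s \<subseteq> tuples A a" for s
  proof -
    have "lin_ext (T (a + b)) ?h s = lin_ext (T (a + b)) (\<lambda>xs. left a b (pure_tensor A xs) \<otimes>\<^bsub>T (a + b)\<^esub> right a b Y) s"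
      by (rule TT.lin_ext_cong) (use s in \<open>auto simp: inner L RY\<close>)
    also have "\<dots> = lin_ext (T (a + b)) (\<lambda>xs. left a b (pure_tensor A xs)) s \<otimes>\<^bsub>T (a + b)\<^esub> right a b Y"
      by (rule TT.lin_ext_mult_right[OF L RY s])
    also have "lin_ext (T (a + b)) (\<lambda>xs. left a b (pure_tensor A xs)) s =
        lin_ext (T (a + b)) (\<lambda>xs. pure_tensor A (xs @ replicate b \<one>)) s"
      by (rule TT.lin_ext_cong) (use s L in \<open>auto simp: left_pure\<close>)
    finally show ?thesis .
  qed
  have "tensor_concat A a b X Y = lin_ext (T (a + b)) ?h p"
    unfolding tensor_concat_def p(2) tclass_def
  proof (rule lin_lift_coset[OF tuple_monoid tensor_power tensor_ideal _ _ p(1)])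
    show "?h xs \<in> carrier (T (a + b))" if "xs \<in> tuples A a" for xs
      using L[OF that] RY by (simp add: inner[OF that])
    show "lin_ext (T (a + b)) ?h i = \<zero>\<^bsub>T (a + b)\<^esub>" if "i \<in> tensor_ideal A a" for i
      using ext[OF sub[OF that]] left_kills[OF that] RY by simp
  qed
  then show ?thesis using ext[OF keys(1)] left_tclass[OF p(1)] p(2) by simp
qed

section \<open>Applying a coproduct to the first tensor factor\<close>

context
  fixes \<Delta> :: "'a \<Rightarrow> ('a list \<Rightarrow>\<^sub>0 'k) set"
  assumes \<Delta>: "alg_hom A (T 2) \<Delta>"
begin

definition first_factor where
  "first_factor m = lin_lift (T (2 + m)) (\<lambda>xs. tensor_concat A 2 m (\<Delta> (hd xs)) (pure_tensor A (tl xs)))"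

lemma first_factor:
  shows first_factor_hom: "alg_hom (T (Suc m)) (T (2 + m)) (first_factor m)"
    and first_factor_pure: "xs \<in> tuples A (Suc m) \<Longrightarrow> first_factor m (pure_tensor A xs) =
      left 2 m (\<Delta> (hd xs)) \<otimes>\<^bsub>T (2 + m)\<^esub> right 2 m (pure_tensor A (tl xs))"
proof -
  interpret TT: assoc_algebra "T (2 + m)" by (rule tensor_power)
  \<comment> \<open>Otherwise \<open>2 + m\<close> is rewritten to \<open>Suc (Suc m)\<close> and
    the facts about \<open>T (2 + m)\<close> no longer match.\<close>
  note add_2_eq_Suc [simp del]
  let ?h = "\<lambda>xs. tensor_concat A 2 m (\<Delta> (hd xs)) (pure_tensor A (tl xs))"
  note \<Delta>' = alg_homD[OF \<Delta>] and l = alg_homD[OF left_hom[of 2 m]] and r = alg_homD[OF right_hom[of m 2]]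
  have dest: "\<exists>x zs. xs = x # zs \<and> x \<in> carrier A \<and> zs \<in> tuples A m" if "xs \<in> tuples A (Suc m)" for xs
    using that by (cases xs) (auto simp: tuple_monoid_def)
  have h: "?h (x # zs) = left 2 m (\<Delta> x) \<otimes>\<^bsub>T (2 + m)\<^esub> right 2 m (pure_tensor A zs)" (is "_ = ?k x zs")
    if "x \<in> carrier A" "zs \<in> tuples A m" for x zs
    using that by (simp add: tensor_concat \<Delta>' pure_closed)
  have L: "left 2 m (\<Delta> x) \<in> carrier (T (2 + m))" if "x \<in> carrier A" for x using that by (simp add: l \<Delta>')
  have R: "right 2 m (pure_tensor A zs) \<in> carrier (T (2 + m))" if "zs \<in> tuples A m" for zs
    using that by (simp add: r pure_closed)
  have 1: "?h xs \<in> carrier (T (2 + m))" if "xs \<in> tuples A (Suc m)" for xs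
    using dest[OF that] L R by (auto simp: h simp del: list.sel)
  have 2: "?h (replicate (Suc m) \<one>) = \<one>\<^bsub>T (2 + m)\<^esub>"
    using h[OF one_closed tuple_one_closed] by (simp add: pure_one l \<Delta>' r)
  have 3: "?h (map2 (mult A) xs ys) = ?h xs \<otimes>\<^bsub>T (2 + m)\<^esub> ?h ys" if "xs \<in> tuples A (Suc m)" "ys \<in> tuples A (Suc m)" for xs ys
  proof -
    obtain x zs where x: "xs = x # zs" "x \<in> carrier A" "zs \<in> tuples A m" using dest[OF \<open>xs \<in> _\<close>] by blast
    obtain y ws where y: "ys = y # ws" "y \<in> carrier A" "ws \<in> tuples A m" using dest[OF \<open>ys \<in> _\<close>] by blast
    \<comment> \<open>The product law comes down to moving the coproduct of \<open>y\<close> past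
      the tail \<open>zs\<close>, which occupies other positions.\<close>
    have c: "right 2 m (pure_tensor A zs) \<otimes>\<^bsub>T (2 + m)\<^esub> left 2 m (\<Delta> y)
        = left 2 m (\<Delta> y) \<otimes>\<^bsub>T (2 + m)\<^esub> right 2 m (pure_tensor A zs)"
      using left_right_commute[OF \<Delta>'(1)[OF y(2)] pure_closed[OF x(3)]] by simp
    have "?k (x \<otimes> y) (map2 (mult A) zs ws) =
        left 2 m (\<Delta> x) \<otimes>\<^bsub>T (2 + m)\<^esub> left 2 m (\<Delta> y) \<otimes>\<^bsub>T (2 + m)\<^esub>
          (right 2 m (pure_tensor A zs) \<otimes>\<^bsub>T (2 + m)\<^esub> right 2 m (pure_tensor A ws))"
      using x y by (simp add: l r \<Delta>' pure_closed flip: pure_mult)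
    also have "\<dots> = left 2 m (\<Delta> x) \<otimes>\<^bsub>T (2 + m)\<^esub>
        (right 2 m (pure_tensor A zs) \<otimes>\<^bsub>T (2 + m)\<^esub> left 2 m (\<Delta> y)) \<otimes>\<^bsub>T (2 + m)\<^esub> right 2 m (pure_tensor A ws)"
      unfolding c using x y L R by (simp add: TT.m_assoc)
    also have "\<dots> = ?k x zs \<otimes>\<^bsub>T (2 + m)\<^esub> ?k y ws"
      using x y L R by (simp add: TT.m_assoc)
    finally have "?k (x \<otimes> y) (map2 (mult A) zs ws) = ?k x zs \<otimes>\<^bsub>T (2 + m)\<^esub> ?k y ws" .
    moreover have "map2 (mult A) xs ys = (x \<otimes> y) # map2 (mult A) zs ws" using x y by simp
    ultimately show ?thesis
      using h[OF x(2,3)] h[OF y(2,3)] h[of "x \<otimes> y" "map2 (mult A) zs ws"] x y tuple_mult_closed by simp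
  qed
  have 4: "?h (xs[i := a \<oplus> b]) = ?h (xs[i := a]) \<oplus>\<^bsub>T (2 + m)\<^esub> ?h (xs[i := b])"
    if xs: "xs \<in> tuples A (Suc m)" and i: "i < Suc m" and ab: "a \<in> carrier A" "b \<in> carrier A" for xs i a b
  proof -
    obtain x zs where x: "xs = x # zs" "x \<in> carrier A" "zs \<in> tuples A m" using dest[OF xs] by blast
    show ?thesis
    proof (cases i)
      case 0
      then show ?thesis
        using x ab L R h[OF ab(1) x(3)] h[OF ab(2) x(3)] h[OF a_closed[OF ab] x(3)]
        by (simp add: l \<Delta>' TT.l_distr)
    next
      case (Suc j)
      then have j: "j < m" using i by simp
      note u = tuple_update_closed[OF x(3)]
      show ?thesis
        using Suc x ab L R h[OF x(2) u[OF ab(1)], of j] h[OF x(2) u[OF ab(2)], of j] h[OF x(2) u[OF a_closed[OF ab]], of j]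
        by (simp add: pure_add[OF x(3) j] r pure_closed u TT.r_distr)
    qed
  qed
  have 5: "?h (xs[i := c \<odot> a]) = c \<odot>\<^bsub>T (2 + m)\<^esub> ?h (xs[i := a])"
    if xs: "xs \<in> tuples A (Suc m)" and i: "i < Suc m" and a: "a \<in> carrier A" for xs i a c
  proof -
    obtain x zs where x: "xs = x # zs" "x \<in> carrier A" "zs \<in> tuples A m" using dest[OF xs] by blast
    show ?thesis
    proof (cases i)
      case 0
      then show ?thesis
        using x a L R h[OF a x(3)] h[OF smult_closed[OF a, of c] x(3)]
        by (simp add: l \<Delta>' TT.smult_mult_left)
    next
      case (Suc j)
      then have j: "j < m" using i by simp
      note u = tuple_update_closed[OF x(3)]
      show ?thesis
        using Suc x a L R h[OF x(2) u[OF a], of j] h[OF x(2) u[OF smult_closed[OF a, of c]], of j]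
        by (simp add: pure_smult[OF x(3) j] r pure_closed u TT.smult_mult_right)
    qed
  qed
  note lift = tensor_lift[OF tensor_power, of "Suc m" ?h "2 + m", OF 1 2 3 4 5, folded first_factor_def]
  show "alg_hom (T (Suc m)) (T (2 + m)) (first_factor m)" by (rule lift(1))
  have f: "xs \<in> tuples A (Suc m) \<Longrightarrow> first_factor m (pure_tensor A xs) = ?h xs" by (rule lift(2))
  assume xs: "xs \<in> tuples A (Suc m)"
  then show "first_factor m (pure_tensor A xs) = left 2 m (\<Delta> (hd xs)) \<otimes>\<^bsub>T (2 + m)\<^esub> right 2 m (pure_tensor A (tl xs))"
    using f[OF xs] dest[OF xs] h by auto
qed

lemma first_factor_pos:
  assumes x: "x \<in> carrier A"
  shows "first_factor m (pos (Suc m) 0 x) = left 2 m (\<Delta> x)"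
    "j < m \<Longrightarrow> first_factor m (pos (Suc m) (Suc j) x) = pos (2 + m) (2 + j) x"
proof -
  interpret TT: assoc_algebra "T (2 + m)" by (rule tensor_power)
  note add_2_eq_Suc [simp del]
  note c = tuple_update_closed[OF tuple_one_closed[of "Suc m"] x]
  note \<Delta>' = alg_homD[OF \<Delta>] and l = alg_homD[OF left_hom[of 2 m]] and r = alg_homD[OF right_hom[of m 2]]
  show "first_factor m (pos (Suc m) 0 x) = left 2 m (\<Delta> x)"
    using first_factor_pure[OF c, of 0] by (simp add: pos_def pure_one r l \<Delta>' x)
  show "first_factor m (pos (Suc m) (Suc j) x) = pos (2 + m) (2 + j) x" if "j < m"
    using first_factor_pure[OF c, of "Suc j"] right_pos[OF that x, of 2] alg_homD(1)[OF pos_hom[of "2+j" "2+m"] x] that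
    by (simp add: pos_def \<Delta>' l)
qed

end
end

section \<open>Casimir elements of commuting representations\<close>

text \<open>The counterpart of \<open>assoc_algebra\<close> for type classes, where the simplifier
  can normalise noncommutative polynomials. The sort is weaker than \<open>ring_1\<close>, which
  includes \<open>0 \<noteq> 1\<close> and would exclude zero algebras.\<close>

locale scaled_ring =
  fixes sc :: "'k::field \<Rightarrow> 'b::{ring,monoid_mult} \<Rightarrow> 'b" (infixr "*s" 75)
  assumes sc_add_left: "(a + b) *s x = a *s x + b *s x"
    and sc_add_right: "a *s (x + y) = a *s x + a *s y"
    and sc_sc [simp]: "a *s b *s x = (a * b) *s x"
    and sc_one [simp]: "1 *s x = x"
    and sc_mult_left [simp]: "(a *s x) * y = a *s (x * y)"
    and sc_mult_right [simp]: "x * (a *s y) = a *s (x * y)"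
begin

lemma sc_zero_left [simp]: "0 *s x = 0"
  using sc_add_left[of 0 0 x] by simp

lemma sc_zero_right [simp]: "a *s 0 = 0"
  using sc_add_right[of a 0 0] by simp

lemma sc_uminus_left [simp]: "(- a) *s x = - (a *s x)"
  using sc_add_left[of a "-a" x] by (simp add: eq_neg_iff_add_eq_0 add.commute)

lemma sc_uminus_right [simp]: "a *s (- x) = - (a *s x)"
  using sc_add_right[of a x "-x"] by (simp add: eq_neg_iff_add_eq_0 add.commute)

lemma sc_diff_left: "(a - b) *s x = a *s x - b *s x"
  using sc_add_left[of a "-b" x] by simp

lemma sc_diff_right: "a *s (x - y) = a *s x - a *s y"
  using sc_add_right[of a x "-y"] by simp

lemmas sc_distribs = sc_add_left sc_add_right sc_diff_left sc_diff_right

end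

text \<open>\<open>p\<close> stands for the inverse of \<open>q\<close>. As a separate variable with
  \<open>q * p = 1\<close> it keeps the coefficients polynomial.\<close>

locale q_ring = scaled_ring sc for sc :: "'k::field \<Rightarrow> 'b::{ring,monoid_mult} \<Rightarrow> 'b" (infixr "*s" 75) +
  fixes q p :: 'k
  assumes qp: "q * p = 1" and d_nz: "q - p \<noteq> 0" and s_nz: "q + p \<noteq> 0"
begin

lemmas coeffs = mult.assoc[where 'a='k] mult.commute[where 'a='k] mult.left_commute[where 'a='k]

lemma qp_simps: "q * p = 1" "p * q = 1" "q * (p * z) = z" "p * (q * z) = z"
  using qp by (simp_all add: mult.commute mult.assoc[symmetric] qp)

text \<open>In a representation of the quantum group by \<open>E\<close>, \<open>F\<close>, \<open>K\<close>, \<open>L\<close> with \<open>d = q - p\<close>, put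
  \<open>k = K^2\<close>, \<open>l = L^2\<close>, \<open>u = d L E\<close>, \<open>v = d F L\<close> and let \<open>m\<close> be \<open>q + p\<close> times the Casimir element.
  These five elements satisfy relations free of denominators, and \<open>l\<close>, \<open>u\<close>, \<open>v\<close> span a right coideal.\<close>

definition reduced :: "'b \<Rightarrow> 'b \<Rightarrow> 'b \<Rightarrow> 'b \<Rightarrow> 'b \<Rightarrow> bool" where
  "reduced k l u v m \<longleftrightarrow> k * l = 1 \<and> l * k = 1 \<and>
     u * k = (p * p) *s (k * u) \<and> v * k = (q * q) *s (k * v) \<and>
     u * l = (q * q) *s (l * u) \<and> v * l = (p * p) *s (l * v) \<and>
     u * v = m * l - p *s 1 - q *s (l * l) \<and>
     v * u = (p * p) *s (m * l) - p *s 1 - (p * p * p) *s (l * l) \<and>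
     k * m = m * k \<and> l * m = m * l \<and> u * m = m * u \<and> v * m = m * v"

text \<open>Products are kept nested to the right, so \<open>a * b\<close> is not a subterm when
  another factor follows; every rewrite rule is therefore needed in this second form too.\<close>

lemma assoc_rule: "a * b = c \<Longrightarrow> a * (b * z) = c * (z :: 'b)"
  by (simp flip: mult.assoc)

lemma reduced_rules:
  assumes "reduced k l u v m"
  shows "k * l = 1" "l * k = 1" "u * k = (p * p) *s (k * u)" "v * k = (q * q) *s (k * v)"
     "u * l = (q * q) *s (l * u)" "v * l = (p * p) *s (l * v)"
     "u * v = m * l - p *s 1 - q *s (l * l)"
     "v * u = (p * p) *s (m * l) - p *s 1 - (p * p * p) *s (l * l)"
     "k * m = m * k" "l * m = m * l" "u * m = m * u" "v * m = m * v"
  using assms by (auto simp: reduced_def)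

text \<open>Rewriting with these rules leads to monomials with powers of \<open>m\<close> first,
  then of \<open>k\<close> or of \<open>l\<close>, then of \<open>u\<close> or of \<open>v\<close>;
  identities are then checked by comparing coefficients.\<close>

lemmas reduced_normalise = reduced_rules reduced_rules[THEN assoc_rule]

definition commute_sets :: "'b set \<Rightarrow> 'b set \<Rightarrow> bool" where
  "commute_sets A B \<longleftrightarrow> (\<forall>x\<in>A. \<forall>y\<in>B. x * y = y * x)"

text \<open>Oriented so that the elements of the first representation move to the left of those of
  the second.\<close>

lemma cross_rules:
  assumes "commute_sets {a1,a2,a3,a4,a5} {b1,b2,b3,b4,b5}"
  shows "b1 * a1 = a1 * b1" "b1 * a2 = a2 * b1" "b1 * a3 = a3 * b1" "b1 * a4 = a4 * b1" "b1 * a5 = a5 * b1"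
    "b2 * a1 = a1 * b2" "b2 * a2 = a2 * b2" "b2 * a3 = a3 * b2" "b2 * a4 = a4 * b2" "b2 * a5 = a5 * b2"
    "b3 * a1 = a1 * b3" "b3 * a2 = a2 * b3" "b3 * a3 = a3 * b3" "b3 * a4 = a4 * b3" "b3 * a5 = a5 * b3"
    "b4 * a1 = a1 * b4" "b4 * a2 = a2 * b4" "b4 * a3 = a3 * b4" "b4 * a4 = a4 * b4" "b4 * a5 = a5 * b4"
    "b5 * a1 = a1 * b5" "b5 * a2 = a2 * b5" "b5 * a3 = a3 * b5" "b5 * a4 = a4 * b5" "b5 * a5 = a5 * b5"
  using assms by (simp_all add: commute_sets_def)

lemmas cross_normalise = cross_rules cross_rules[THEN assoc_rule]


section \<open>Identities for two commuting representations\<close>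

definition bracket :: "'b \<Rightarrow> 'b \<Rightarrow> 'b" where
  "bracket x y = q *s (x * y) - p *s (y * x)"

text \<open>The Casimir element of a product of two representations is linear in \<open>(m, k, k u, k v)\<close> of the
  left factor and in \<open>(l', u', v', m')\<close> of the right factor.\<close>

definition pairing :: "'b \<Rightarrow> 'b \<Rightarrow> 'b \<Rightarrow> 'b \<Rightarrow> 'b \<Rightarrow> 'b \<Rightarrow> 'b \<Rightarrow> 'b \<Rightarrow> 'b" where
  "pairing k u v m l' u' v' m' =
     m * l' + k * m' - (q + p) *s (k * l') + (q * q) *s (k * (v * u')) + k * (u * v')"

lemmas expand = distrib_left[where 'a='b] distrib_right[where 'a='b]
  right_diff_distrib[where 'a='b] left_diff_distrib[where 'a='b]
  mult.assoc[where 'a='b] sc_distribs qp_simps coeffs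

context
  fixes k l u v m k' l' u' v' m' M lt ut vt
  assumes B: "reduced k l u v m" and C: "reduced k' l' u' v' m'"
   and X: "commute_sets {k,l,u,v,m} {k',l',u',v',m'}"
  defines "M \<equiv> pairing k u v m l' u' v' m'"
   and "lt \<equiv> l' - q *s (v * u')"
   and "ut \<equiv> l * u'"
   and "vt \<equiv> k * v' - q *s (k * (v * m')) + (q * (q + p)) *s (k * (v * l')) - (q * q * q) *s (k * (v * (v * u')))"
begin

lemmas nrm = reduced_normalise[OF B] reduced_normalise[OF C] cross_normalise[OF X]

text \<open>In this group of formulas, \<open>l * l'\<close>, \<open>u * l' + u'\<close> and
  \<open>v * l' + v'\<close> are the elements \<open>l\<close>, \<open>u\<close>, \<open>v\<close>
  of the product representation, by \<open>derived_cprod\<close>. An isolated Casimir element occurs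
  only in the formulas for \<open>l\<close>, because \<open>u\<close> and \<open>v\<close> vanish in
  the trivial representation.\<close>

lemma bracket_l: "bracket l M = (q - p) *s (m * (l * l') + m' - (q + p) *s lt)"
  by (simp add: bracket_def lt_def M_def pairing_def nrm expand algebra_simps)
lemma bracket_u: "bracket u M = (q - p) *s (m * (u * l' + u') - (q + p) *s ut)"
  by (simp add: bracket_def ut_def M_def pairing_def nrm expand algebra_simps)
lemma bracket_v: "bracket v M = (q - p) *s (m * (v * l' + v') - (q + p) *s vt)"
  by (simp add: bracket_def vt_def M_def pairing_def nrm expand algebra_simps)
lemma bracket_shift_l: "bracket M lt = (q - p) *s (m' * (l * l') + m - (q + p) *s l)"
  by (simp add: bracket_def lt_def M_def pairing_def nrm expand algebra_simps)
lemma bracket_shift_u: "bracket M ut = (q - p) *s (m' * (u * l' + u') - (q + p) *s u)"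
  by (simp add: bracket_def ut_def M_def pairing_def nrm expand algebra_simps)
lemma bracket_shift_v: "bracket M vt = (q - p) *s (m' * (v * l' + v') - (q + p) *s v)"
  by (simp add: bracket_def vt_def M_def pairing_def nrm expand algebra_simps)
lemma m_commutes_M: "m * M = M * m" "m' * M = M * m'"
  by (simp_all add: M_def pairing_def nrm expand algebra_simps)

end

section \<open>Representations, their products and Casimir elements\<close>

definition rep :: "(uq_gen \<Rightarrow> 'b) \<Rightarrow> bool" where
  "rep X \<longleftrightarrow> X gK * X gKinv = 1 \<and> X gKinv * X gK = 1 \<and>
     X gK * X gE = q *s (X gE * X gK) \<and> X gK * X gF = p *s (X gF * X gK) \<and>
     X gE * X gF - X gF * X gE = inverse (q - p) *s (X gK * X gK - X gKinv * X gKinv)"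

definition commuting :: "(uq_gen \<Rightarrow> 'b) \<Rightarrow> (uq_gen \<Rightarrow> 'b) \<Rightarrow> bool" where
  "commuting X Y \<longleftrightarrow> (\<forall>g h. X g * Y h = Y h * X g)"

text \<open>The coproduct followed by multiplication in the ring; for commuting \<open>X\<close> and
  \<open>Y\<close> the result is again a representation.\<close>

fun cprod :: "(uq_gen \<Rightarrow> 'b) \<Rightarrow> (uq_gen \<Rightarrow> 'b) \<Rightarrow> uq_gen \<Rightarrow> 'b" where
  "cprod X Y gE = X gE * Y gKinv + X gK * Y gE"
| "cprod X Y gF = X gF * Y gKinv + X gK * Y gF"
| "cprod X Y gK = X gK * Y gK"
| "cprod X Y gKinv = X gKinv * Y gKinv"

definition k_of where "k_of X = X gK * X gK"
definition l_of where "l_of X = X gKinv * X gKinv"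
definition u_of where "u_of X = (q - p) *s (X gKinv * X gE)"
definition v_of where "v_of X = (q - p) *s (X gF * X gKinv)"
definition ucas where "ucas X = ((q - p) * (q - p)) *s (X gF * X gE) + q *s k_of X + p *s l_of X"

text \<open>Oriented to bring \<open>X gK\<close> and \<open>X gKinv\<close> to the left, then
  \<open>X gF\<close>, then \<open>X gE\<close>. The rules for \<open>X gKinv\<close> arise from
  those for \<open>X gK\<close> by multiplying with \<open>X gKinv\<close> on both sides.\<close>

lemma rep_rules:
  assumes "rep X"
  shows "X gK * X gKinv = 1" "X gKinv * X gK = 1"
    "X gE * X gK = p *s (X gK * X gE)" "X gF * X gK = q *s (X gK * X gF)"
    "X gE * X gKinv = q *s (X gKinv * X gE)" "X gF * X gKinv = p *s (X gKinv * X gF)"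
    "X gE * X gF = X gF * X gE + inverse (q - p) *s (X gK * X gK - X gKinv * X gKinv)"
proof -
  note r = assms[unfolded rep_def]
  show K: "X gK * X gKinv = 1" "X gKinv * X gK = 1" using r by auto
  show E: "X gE * X gK = p *s (X gK * X gE)" and F: "X gF * X gK = q *s (X gK * X gF)"
    using r by (auto simp: qp_simps)
  have "X gE * X gKinv = X gKinv * (X gK * X gE) * X gKinv"
    by (simp add: K flip: mult.assoc)
  also have "\<dots> = q *s (X gKinv * X gE * (X gK * X gKinv))"
    using r by (simp add: mult.assoc)
  finally show "X gE * X gKinv = q *s (X gKinv * X gE)" by (simp add: K)
  have "X gF * X gKinv = X gKinv * (X gK * X gF) * X gKinv"
    by (simp add: K flip: mult.assoc)
  also have "\<dots> = p *s (X gKinv * X gF * (X gK * X gKinv))"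
    using r by (simp add: mult.assoc)
  finally show "X gF * X gKinv = p *s (X gKinv * X gF)" by (simp add: K)
  show "X gE * X gF = X gF * X gE + inverse (q - p) *s (X gK * X gK - X gKinv * X gKinv)"
    using r by (simp add: algebra_simps)
qed

lemmas rep_normalise = rep_rules rep_rules[THEN assoc_rule]

lemma d_scaled [simp]: "inverse (q - p) *s ((q - p) *s x) = x"
  using d_nz by simp

text \<open>Rescaling by \<open>q - p\<close> removes the denominator from the commutator of the two
  generators.\<close>

definition f_of where "f_of X = (q - p) *s X gF"
definition e_of where "e_of X = (q - p) *s X gE"

lemma scaled_rules:
  assumes "rep X"
  shows "X gK * X gKinv = 1" "X gKinv * X gK = 1"
    "e_of X * X gK = p *s (X gK * e_of X)" "f_of X * X gK = q *s (X gK * f_of X)"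
    "e_of X * X gKinv = q *s (X gKinv * e_of X)" "f_of X * X gKinv = p *s (X gKinv * f_of X)"
    "e_of X * f_of X = f_of X * e_of X + (q - p) *s (X gK * X gK - X gKinv * X gKinv)"
  using d_nz by (simp_all add: f_of_def e_of_def rep_rules[OF assms] sc_add_right coeffs)

lemmas scaled_normalise = scaled_rules scaled_rules[THEN assoc_rule]

lemma ucas_alt: "ucas X = f_of X * e_of X + q *s k_of X + p *s l_of X"
  by (simp add: ucas_def f_of_def e_of_def)

lemma u_of_alt: "u_of X = X gKinv * e_of X"
  by (simp add: u_of_def e_of_def)

lemma v_of_alt: "v_of X = f_of X * X gKinv"
  by (simp add: v_of_def f_of_def)

lemma ucas_commutes:
  assumes "rep X" shows "X g * ucas X = ucas X * X g"
proof -
  note n = scaled_normalise[OF assms]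
  have E: "e_of X * ucas X = ucas X * e_of X" and F: "f_of X * ucas X = ucas X * f_of X"
    by (simp_all add: ucas_alt k_of_def l_of_def n expand algebra_simps)
  have EF: "X gE = inverse (q - p) *s e_of X" "X gF = inverse (q - p) *s f_of X"
    by (simp_all add: e_of_def f_of_def del: sc_sc)
  show ?thesis
  proof (cases g)
    case gE
    then show ?thesis by (simp add: EF(1) E)
  next
    case gF
    then show ?thesis by (simp add: EF(2) F)
  qed (simp_all add: ucas_alt k_of_def l_of_def n expand algebra_simps)
qed

lemma reduced_rep:
  assumes "rep X" shows "reduced (k_of X) (l_of X) (u_of X) (v_of X) (ucas X)"
proof -
  note n = scaled_normalise[OF assms]
  have c: "X g * (ucas X * z) = ucas X * (X g * z)" "X g * ucas X = ucas X * X g" for g z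
    using ucas_commutes[OF assms] by (metis mult.assoc)+
  have c': "e_of X * (ucas X * z) = ucas X * (e_of X * z)" "e_of X * ucas X = ucas X * e_of X" 
    "f_of X * (ucas X * z) = ucas X * (f_of X * z)" "f_of X * ucas X = ucas X * f_of X" for z
    by (simp_all add: e_of_def f_of_def c)
  \<comment> \<open>Only the relations for \<open>u * v\<close> and \<open>v * u\<close> need the
    Casimir element multiplied out; in the commutation relations it is moved as a central
    symbol.\<close>
  have m: "ucas X * z = f_of X * (e_of X * z) + q *s (X gK * (X gK * z)) + p *s (X gKinv * (X gKinv * z))" for z
    by (simp add: ucas_alt k_of_def l_of_def expand)
  show ?thesis unfolding reduced_def u_of_alt v_of_alt k_of_def l_of_def
    apply (intro conjI)
    subgoal by (simp add: n expand)
    subgoal by (simp add: n expand)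
    subgoal by (simp add: n expand)
    subgoal by (simp add: n expand)
    subgoal by (simp add: n expand)
    subgoal by (simp add: n expand)
    subgoal by (simp add: m n expand algebra_simps)
    subgoal by (simp add: m n expand algebra_simps)
    subgoal by (simp add: c mult.assoc)
    subgoal by (simp add: c mult.assoc)
    subgoal by (simp add: c c' mult.assoc)
    subgoal by (simp add: c c' mult.assoc)
    done
qed

lemma commuting_sym: "commuting X Y \<Longrightarrow> commuting Y X"
  by (simp add: commuting_def)

lemma commuting_cprod:
  assumes "commuting X Z" "commuting Y Z" shows "commuting (cprod X Y) Z"
proof -
  have XY: "X g * Z h = Z h * X g" "Y g * Z h = Z h * Y g" for g h
    using assms by (auto simp: commuting_def)
  have XY': "X g * (Z h * z) = Z h * (X g * z)" "Y g * (Z h * z) = Z h * (Y g * z)" for g h z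
    using XY by (metis mult.assoc)+
  show ?thesis unfolding commuting_def
    by (intro allI; case_tac g) (simp_all add: distrib_left distrib_right mult.assoc XY XY')
qed

lemma commute_ucas:
  assumes "\<And>g. x * Y g = Y g * x" shows "x * ucas Y = ucas Y * x"
proof -
  have a': "x * (Y g * z) = Y g * (x * z)" for g z
    using assms by (metis mult.assoc)
  show ?thesis by (simp add: ucas_def k_of_def l_of_def distrib_left distrib_right assms a' mult.assoc)
qed

lemma commute_set_derived:
  assumes "commuting X Y"
  shows "commute_sets {k_of X, l_of X, u_of X, v_of X, ucas X} {k_of Y, l_of Y, u_of Y, v_of Y, ucas Y}"
proof -
  have XY: "X g * Y h = Y h * X g" for g h using assms by (auto simp: commuting_def)
  have XY': "X g * (Y h * z) = Y h * (X g * z)" for g h z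
    using XY by (metis mult.assoc)
  have m: "X g * ucas Y = ucas Y * X g" "ucas X * Y g = Y g * ucas X" for g
    by (rule commute_ucas, rule XY) (rule commute_ucas[symmetric], simp add: XY)
  have m': "X g * (ucas Y * z) = ucas Y * (X g * z)" "ucas X * (Y g * z) = Y g * (ucas X * z)" for g z
    using m by (metis mult.assoc)+
  have ucas': "ucas X * ucas Y = ucas Y * ucas X"
    by (rule commute_ucas) (rule m)
  show ?thesis unfolding commute_sets_def k_of_def l_of_def u_of_def v_of_def
    by (simp add: XY XY' m m' ucas' mult.assoc coeffs)
qed

lemma rep_cprod:
  assumes "rep X" "rep Y" "commuting X Y" shows "rep (cprod X Y)"
proof -
  have YX: "Y h * X g = X g * Y h" for g h using assms(3) by (auto simp: commuting_def)
  have YX': "Y h * (X g * z) = X g * (Y h * z)" for g h z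
    using YX by (metis mult.assoc)
  show ?thesis unfolding rep_def
    by (intro conjI; simp add: YX YX' expand rep_normalise[OF assms(1)] rep_normalise[OF assms(2)])
qed

text \<open>The right factor enters \<open>l\<close>, \<open>u\<close>, \<open>v\<close> of the
  product only linearly through its own \<open>l\<close>, \<open>u\<close>, \<open>v\<close>. This
  coideal property keeps computations with longer products inside the same few elements. The last
  formula is the coproduct of the Casimir element.\<close>

lemma derived_cprod:
  assumes "rep X" "rep Y" "commuting X Y"
  shows "l_of (cprod X Y) = l_of X * l_of Y" "k_of (cprod X Y) = k_of X * k_of Y"
    "u_of (cprod X Y) = u_of X * l_of Y + u_of Y" "v_of (cprod X Y) = v_of X * l_of Y + v_of Y"
    "ucas (cprod X Y) = pairing (k_of X) (u_of X) (v_of X) (ucas X) (l_of Y) (u_of Y) (v_of Y) (ucas Y)"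
proof -
  have YX: "Y h * X g = X g * Y h" for g h using assms(3) by (auto simp: commuting_def)
  then have YE: "e_of Y * X g = X g * e_of Y" "f_of Y * X g = X g * f_of Y"
      "Y h * e_of X = e_of X * Y h" "Y h * f_of X = f_of X * Y h" "e_of Y * e_of X = e_of X * e_of Y"
      "e_of Y * f_of X = f_of X * e_of Y" "f_of Y * f_of X = f_of X * f_of Y" "f_of Y * e_of X = e_of X * f_of Y" for g h
    by (simp_all add: e_of_def f_of_def coeffs)
  have EE: "e_of (cprod X Y) = e_of X * Y gKinv + X gK * e_of Y" "f_of (cprod X Y) = f_of X * Y gKinv + X gK * f_of Y"
    by (simp_all add: e_of_def f_of_def sc_add_right)
  note n = YX YE YX[THEN assoc_rule] YE[THEN assoc_rule] scaled_normalise[OF assms(1)] scaled_normalise[OF assms(2)] expand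
  show "l_of (cprod X Y) = l_of X * l_of Y" "k_of (cprod X Y) = k_of X * k_of Y"
    by (simp_all add: l_of_def k_of_def n)
  show "u_of (cprod X Y) = u_of X * l_of Y + u_of Y" "v_of (cprod X Y) = v_of X * l_of Y + v_of Y"
    by (simp_all add: l_of_def k_of_def u_of_alt v_of_alt n EE)
  show "ucas (cprod X Y) = pairing (k_of X) (u_of X) (v_of X) (ucas X) (l_of Y) (u_of Y) (v_of Y) (ucas Y)"
    by (simp add: ucas_alt pairing_def k_of_def l_of_def u_of_alt v_of_alt n EE algebra_simps)
qed

lemma cprod_assoc: "cprod (cprod X Y) Z = cprod X (cprod Y Z)"
proof
  show "cprod (cprod X Y) Z g = cprod X (cprod Y Z) g" for g
    by (cases g) (simp_all add: distrib_left distrib_right mult.assoc add.assoc)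
qed


subsection \<open>Brackets\<close>

text \<open>\<open>shift_l\<close>, \<open>shift_u\<close>, \<open>shift_v\<close> are \<open>l\<close>, \<open>u\<close>, \<open>v\<close> of \<open>Y\<close> conjugated by the universal R-matrix past \<open>X\<close>;
  pairing with them gives the Casimir element \<open>around X Y Z\<close> of \<open>X\<close> and \<open>Z\<close> that bypasses \<open>Y\<close>. The formulas
  are read off from the brackets of \<open>l\<close>, \<open>u\<close>, \<open>v\<close> with the Casimir element of the product.\<close>

definition shift_l where "shift_l X Y = l_of Y - q *s (v_of X * u_of Y)"
definition shift_u where "shift_u X Y = l_of X * u_of Y"
definition shift_v where "shift_v X Y = k_of X * v_of Y - q *s (k_of X * (v_of X * ucas Y))
  + (q * (q + p)) *s (k_of X * (v_of X * l_of Y)) - (q * q * q) *s (k_of X * (v_of X * (v_of X * u_of Y)))"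

abbreviation pairing_with where "pairing_with X \<equiv> pairing (k_of X) (u_of X) (v_of X) (ucas X)"

definition around where "around X Y Z = pairing_with X (shift_l Y Z) (shift_u Y Z) (shift_v Y Z) (ucas Z)"

lemma commuting_derived:
  assumes "commuting X Y"
  shows "k_of X * ucas Y = ucas Y * k_of X" "u_of X * ucas Y = ucas Y * u_of X" "v_of X * ucas Y = ucas Y * v_of X"
    "ucas X * ucas Y = ucas Y * ucas X"
  using commute_set_derived[OF assms] by (auto simp: commute_sets_def)

text \<open>This is how the leftmost factor drops out: an \<open>M\<close> that commutes with its
  elements lets the bracket pass to the four entries of the right factor, in which the pairing is
  linear.\<close>

lemma bracket_pairing:
  assumes "k * M = M * k" "u * M = M * u" "v * M = M * v" "m * M = M * m"
  shows "bracket (pairing k u v m l' u' v' m') M = pairing k u v m (bracket l' M) (bracket u' M) (bracket v' M) (bracket m' M)"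
    "bracket M (pairing k u v m l' u' v' m') = pairing k u v m (bracket M l') (bracket M u') (bracket M v') (bracket M m')"
  by (simp_all add: bracket_def pairing_def expand assms[symmetric] assms[symmetric, THEN assoc_rule] algebra_simps)

lemma bracket_commuting: "x * y = y * x \<Longrightarrow> bracket x y = (q - p) *s (x * y)"
  by (simp add: bracket_def sc_distribs)

text \<open>Serves the Casimir entry of a pairing, where by \<open>bracket_commuting\<close> the
  bracket degenerates to \<open>q - p\<close> times a product.\<close>

lemma ucas_cprod_commutes:
  assumes "rep X" "rep Y" "commuting X Y"
  shows "ucas X * ucas (cprod X Y) = ucas (cprod X Y) * ucas X" "ucas Y * ucas (cprod X Y) = ucas (cprod X Y) * ucas Y"
  unfolding derived_cprod(5)[OF assms]
  using m_commutes_M[OF reduced_rep reduced_rep commute_set_derived, OF assms] by auto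

lemma pairing_sc: "pairing k u v m (a *s l') (a *s u') (a *s v') (a *s m') = a *s pairing k u v m l' u' v' m'"
  by (simp add: pairing_def expand algebra_simps)

lemmas bracket_cprod = bracket_l bracket_u bracket_v bracket_shift_l bracket_shift_u bracket_shift_v

context
  fixes X Y assumes X: "rep X" and Y: "rep Y" and XY: "commuting X Y"
begin

lemmas bracket_rules = bracket_cprod[OF reduced_rep[OF X] reduced_rep[OF Y] commute_set_derived[OF XY],
   folded derived_cprod(5)[OF X Y XY] derived_cprod(3,4)[OF X Y XY] shift_l_def shift_u_def derived_cprod(1)[OF X Y XY], folded shift_v_def]

end

context
  fixes X Y Z
  assumes X: "rep X" and Y: "rep Y" and Z: "rep Z"
    and XY: "commuting X Y" and XZ: "commuting X Z" and YZ: "commuting Y Z"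
begin

lemma X_YZ: "commuting X (cprod Y Z)"
  using XY XZ commuting_cprod commuting_sym by blast

lemma rep_YZ: "rep (cprod Y Z)" by (rule rep_cprod[OF Y Z YZ])

text \<open>The entry for \<open>l\<close> contributes an isolated \<open>ucas Z\<close>. Paired
  with \<open>X\<close> it gives \<open>ucas X * ucas Z\<close>, and through the term
  \<open>(q + p) *s (k * l')\<close> of \<open>pairing\<close> also the Casimir entry of
  \<open>around\<close>, which the bracket of the Casimir entries, a multiple of
  \<open>ucas Y * ucas (cprod Y Z)\<close>, does not supply.\<close>

lemma bracket_around1:
  "bracket (ucas (cprod X Y)) (ucas (cprod Y Z)) =
    (q - p) *s (ucas X * ucas Z + ucas Y * ucas (cprod X (cprod Y Z)) - (q + p) *s around X Y Z)"
proof -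
  note c = commuting_derived[OF X_YZ]
  have mY: "ucas Y * k_of X = k_of X * ucas Y" "ucas Y * u_of X = u_of X * ucas Y" "ucas Y * v_of X = v_of X * ucas Y" "ucas Y * ucas X = ucas X * ucas Y"
    using commuting_derived[OF XY] by auto
  show ?thesis
  unfolding derived_cprod(5)[OF X Y XY] bracket_pairing[OF c] bracket_rules[OF Y Z YZ] bracket_commuting[OF ucas_cprod_commutes(1)[OF Y Z YZ]]
     pairing_sc derived_cprod(5)[OF X rep_YZ X_YZ] around_def
   by (simp add: pairing_def expand mY mY[THEN assoc_rule] algebra_simps)
qed

text \<open>Here the bracket undoes the shift: the entries of \<open>around\<close> return to
  \<open>l\<close>, \<open>u\<close>, \<open>v\<close> of \<open>Y\<close>, so the Casimir element
  of \<open>cprod X Y\<close> reappears.\<close>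

lemma bracket_around2:
  "bracket (ucas (cprod Y Z)) (around X Y Z) =
    (q - p) *s (ucas X * ucas Y + ucas Z * ucas (cprod X (cprod Y Z)) - (q + p) *s ucas (cprod X Y))"
proof -
  note c = commuting_derived[OF X_YZ]
  have mZ: "ucas Z * k_of X = k_of X * ucas Z" "ucas Z * u_of X = u_of X * ucas Z" "ucas Z * v_of X = v_of X * ucas Z" "ucas Z * ucas X = ucas X * ucas Z"
     "ucas Z * ucas (cprod Y Z) = ucas (cprod Y Z) * ucas Z"
    using commuting_derived[OF XZ]  ucas_cprod_commutes(2)[OF Y Z YZ] by auto
  show ?thesis
  unfolding derived_cprod(5)[OF X Y XY] around_def bracket_pairing[OF c] bracket_rules[OF Y Z YZ] 
     bracket_commuting[OF ucas_cprod_commutes(2)[OF Y Z YZ, symmetric]]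
     pairing_sc derived_cprod(5)[OF X rep_YZ X_YZ]
   by (simp add: pairing_def expand mZ mZ[THEN assoc_rule] algebra_simps)
qed

context
  fixes W
  assumes W: "rep W" and XW: "commuting X W" and YW: "commuting Y W" and ZW: "commuting Z W"
begin

lemma bracket_around3:
  "bracket (around X Y Z) (ucas (cprod Z W)) =
    (q - p) *s (ucas X * ucas W + ucas Z * around X Y (cprod Z W) - (q + p) *s around X (cprod Y Z) W)"
proof -
  have XZW: "commuting X (cprod Z W)" and YZW: "commuting Y (cprod Z W)"
    using XZ XW YZ YW commuting_cprod commuting_sym by blast+
  note c = commuting_derived[OF XZW]
  have cX: "ucas Z * k_of X = k_of X * ucas Z" "ucas Z * u_of X = u_of X * ucas Z" "ucas Z * v_of X = v_of X * ucas Z" "ucas Z * ucas X = ucas X * ucas Z"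
    using commuting_derived[OF XZ] by auto
  have cY: "k_of Y * ucas (cprod Z W) = ucas (cprod Z W) * k_of Y" "l_of Y * ucas (cprod Z W) = ucas (cprod Z W) * l_of Y"
     "v_of Y * ucas (cprod Z W) = ucas (cprod Z W) * v_of Y"
    using commute_set_derived[OF YZW] by (auto simp: commute_sets_def)
  note cZ = cross_normalise[OF commute_set_derived[OF YZ]]
  \<comment> \<open>The shifted elements are linear in \<open>l\<close>, \<open>u\<close>,
    \<open>v\<close> and \<open>ucas\<close> of \<open>Z\<close>, with coefficients from
    \<open>Y\<close> on the left. These commute with \<open>ucas (cprod Z W)\<close>, so the bracket
    acts on the elements of \<open>Z\<close> alone.\<close>
  have c1: "bracket (y * z) (ucas (cprod Z W)) = y * bracket z (ucas (cprod Z W))" 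
     if "y * ucas (cprod Z W) = ucas (cprod Z W) * y" for y z
    unfolding bracket_def using that by (simp add: expand that[symmetric, THEN assoc_rule] that[symmetric])
  have c2: "bracket (x + y) M = bracket x M + bracket y M" "bracket (x - y) M = bracket x M - bracket y M" "bracket (a *s x) M = a *s bracket x M" for x y M a
    by (simp_all add: bracket_def expand algebra_simps)
  note B = bracket_rules[OF Z W ZW] bracket_commuting[OF ucas_cprod_commutes(1)[OF Z W ZW]]
  note D = derived_cprod[OF Y Z YZ] derived_cprod(1-4)[OF Z W ZW]
  have t: "bracket (shift_l Y Z) (ucas (cprod Z W)) = (q - p) *s (ucas W + ucas Z * shift_l Y (cprod Z W) - (q + p) *s shift_l (cprod Y Z) W)"
    unfolding shift_l_def[of Y Z] c2 c1[OF cY(3)] B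
    by (simp add: shift_l_def shift_u_def D cZ expand algebra_simps)
  have u: "bracket (shift_u Y Z) (ucas (cprod Z W)) = (q - p) *s (ucas Z * shift_u Y (cprod Z W) - (q + p) *s shift_u (cprod Y Z) W)"
    unfolding shift_u_def[of Y Z] c2 c1[OF cY(2)] B
    by (simp add: shift_u_def D cZ expand algebra_simps)
  \<comment> \<open>The shift past \<open>cprod Y Z\<close> contains products and squares of
    \<open>v_of Y * l_of Z + v_of Z\<close>; multiplying them out uses the relations inside
    \<open>Y\<close> and inside \<open>Z\<close>, unlike in the two previous cases.\<close>
  have v: "bracket (shift_v Y Z) (ucas (cprod Z W)) = (q - p) *s (ucas Z * shift_v Y (cprod Z W) - (q + p) *s shift_v (cprod Y Z) W)"
    unfolding shift_v_def[of Y Z] c2 c1[OF cY(1)] c1[OF cY(3)] B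
    by (simp add: shift_v_def shift_l_def shift_u_def D cZ reduced_normalise[OF reduced_rep[OF Y]] reduced_normalise[OF reduced_rep[OF Z]] expand algebra_simps)
  show ?thesis 
    unfolding around_def bracket_pairing[OF c] t u v B(7)
     pairing_sc
   by (simp add: pairing_def expand cX cX[THEN assoc_rule] algebra_simps)
qed

end
end
end

section \<open>Intervals, adjacency and holes\<close>

definition next_interval :: "nat \<Rightarrow> nat set \<Rightarrow> nat set \<Rightarrow> bool" where
  "next_interval n I J \<longleftrightarrow> (\<exists>a b c. 1 \<le> a \<and> a \<le> b \<and> b < c \<and> c \<le> n \<and> I = {a..b} \<and> J = {Suc b..c})"

lemma interval_connected: "1 \<le> a \<Longrightarrow> a \<le> b \<Longrightarrow> b \<le> n \<Longrightarrow> {a..b} \<in> connected_subsets n"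
  unfolding connected_subsets_def by (rule CollectI, rule exI[of _ a], rule exI[of _ b]) simp

lemma connected_subsetsE:
  assumes "I \<in> connected_subsets n" obtains a b where "1 \<le> a" "a \<le> b" "b \<le> n" "I = {a..b}"
  using assms unfolding connected_subsets_def by auto

lemma next_intervalI: "1 \<le> a \<Longrightarrow> a \<le> b \<Longrightarrow> b < c \<Longrightarrow> c \<le> n \<Longrightarrow> next_interval n {a..b} {Suc b..c}"
  unfolding next_interval_def by (rule exI[of _ a], rule exI[of _ b], rule exI[of _ c]) simp

lemma next_intervalE:
  assumes "next_interval n I J"
  obtains a b c where "1 \<le> a" "a \<le> b" "b < c" "c \<le> n" "I = {a..b}" "J = {Suc b..c}"
  using assms unfolding next_interval_def by (elim exE conjE) (rule that; simp)

lemma next_interval_adjacent: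
  assumes "next_interval n I J" shows "adjacent n I J" "adjacent n J I"
proof -
  obtain a b c where h: "1 \<le> a" "a \<le> b" "b < c" "c \<le> n" "I = {a..b}" "J = {Suc b..c}"
    using assms by (elim next_intervalE) (rule that; simp)
  have "I \<union> J = {a..c}" "I \<inter> J = {}" using h by auto
  moreover have "{a..c} \<in> connected_subsets n" "I \<in> connected_subsets n" "J \<in> connected_subsets n"
    using h by (simp_all add: interval_connected)
  ultimately show "adjacent n I J" "adjacent n J I"
    unfolding adjacent_def by (simp_all add: Un_commute Int_commute)
qed

text \<open>The number following the end of \<open>I\<close> lies in the connected union but not in
  \<open>I\<close>, hence in \<open>J\<close>.\<close>

lemma adjacent_next_interval:
  assumes "adjacent n I J" "set_less I J" shows "next_interval n I J"
proof -
  have c: "I \<in> connected_subsets n" "J \<in> connected_subsets n" "I \<union> J \<in> connected_subsets n"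
    using assms(1) by (simp_all add: adjacent_def)
  obtain a b where I: "1 \<le> a" "a \<le> b" "b \<le> n" "I = {a..b}"
    using c(1) by (rule connected_subsetsE)
  obtain c d where J: "1 \<le> c" "c \<le> d" "d \<le> n" "J = {c..d}"
    using c(2) by (rule connected_subsetsE)
  obtain e f where IJ: "I \<union> J = {e..f}"
    using c(3) by (rule connected_subsetsE)
  have "b \<in> I" "c \<in> J" using I J by auto
  then have bc: "b < c" using assms(2) unfolding set_less_def by blast
  have "a \<in> I \<union> J" "d \<in> I \<union> J" using I(2,4) J(2,4) by auto
  then have "e \<le> a" "d \<le> f" unfolding IJ by auto
  then have "Suc b \<in> I \<union> J" using I(2) J(2) bc unfolding IJ by simp
  then have cb: "c = Suc b" using bc unfolding I(4) J(4) by simp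
  show ?thesis
    unfolding I(4) J(4) cb by (rule next_intervalI) (use I(1-3) J(2,3) bc in simp_all)
qed

lemma next_interval_chain:
  assumes "next_interval n I J" "next_interval n J K"
  shows "next_interval n I (J \<union> K)" "next_interval n (I \<union> J) K"
    "\<not> adjacent n I K" "\<not> adjacent n K I" "hole I K = J" "hole K I = J" "I \<inter> K = {}"
proof -
  obtain a b c where I: "1 \<le> a" "a \<le> b" "b < c" "I = {a..b}" "J = {Suc b..c}"
    using assms(1) by (elim next_intervalE) (rule that; simp)
  obtain a' b' d where J: "a' \<le> b'" "b' < d" "d \<le> n" "J = {a'..b'}" "K = {Suc b'..d}"
    using assms(2) by (elim next_intervalE) (rule that; simp)
  have "c \<in> J" unfolding I(5) using I(3) by simp
  then have 1: "c \<le> b'" unfolding J(4) by simp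
  have "b' \<in> J" unfolding J(4) using J(1) by simp
  then have "b' \<le> c" unfolding I(5) by simp
  with 1 have "b' = c" by simp
  then have K: "c < d" "d \<le> n" "K = {Suc c..d}" using J(2,3,5) by simp_all
  have u: "I \<union> J = {a..c}" "J \<union> K = {Suc b..d}" using I K by auto
  show "next_interval n I (J \<union> K)"
    unfolding u I(4) using I(1-3) K(1,2) by (intro next_intervalI) simp_all
  show "next_interval n (I \<union> J) K"
    unfolding u K(3) using I(1-3) K(1,2) by (intro next_intervalI) simp_all
  \<comment> \<open>An interval containing both ends would also contain \<open>Suc b\<close>, which
    lies in the gap \<open>J\<close>.\<close>
  have ne: "I \<union> K \<noteq> {e..f}" for e f
  proof
    assume e: "I \<union> K = {e..f}"
    have "a \<in> I \<union> K" "d \<in> I \<union> K" using I K by auto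
    then have "e \<le> a" "d \<le> f" unfolding e by auto
    then have "Suc b \<in> I \<union> K" unfolding e using I K by simp
    then show False using I K by simp
  qed
  then have "I \<union> K \<notin> connected_subsets n" unfolding connected_subsets_def by blast
  then show "\<not> adjacent n I K" "\<not> adjacent n K I"
    unfolding adjacent_def by (simp_all add: Un_commute)
  have b: "b \<in> I" and c: "Suc c \<in> K" using I K by auto
  have "hole I K \<subseteq> J"
  proof
    fix x assume "x \<in> hole I K"
    then have "b < x \<and> x < Suc c \<or> Suc c < x \<and> x < b"
      using b c unfolding hole_def by blast
    then show "x \<in> J" using I K by auto
  qed
  moreover have "J \<subseteq> hole I K"
    using I K unfolding hole_def by auto
  ultimately show "hole I K = J" by blast
  moreover have "hole K I = hole I K"
    unfolding hole_def by (rule Collect_cong, rule iffI; elim disjE; simp)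
  ultimately show "hole K I = J" by simp
  show "I \<inter> K = {}" using I K by auto
qed

lemma monotonic_adjacent_cases:
  assumes "monotonic_adjacent n Is"
  shows "successively (next_interval n) Is \<or> successively (\<lambda>I J. next_interval n J I) Is"
proof -
  have 1: "successively (next_interval n) Is" if "successively (adjacent n) Is" "sorted_wrt set_less Is"
    using that by (induction Is rule: induct_list012) (auto simp: adjacent_next_interval)
  have 2: "successively (\<lambda>I J. next_interval n J I) Is"
    if "successively (adjacent n) Is" "sorted_wrt (\<lambda>I J. set_less J I) Is"
    using that by (induction Is rule: induct_list012)
      (auto intro!: adjacent_next_interval simp: adjacent_def Un_commute Int_commute)
  show ?thesis using assms 1 2 by (auto simp: monotonic_adjacent_def)
qed

section \<open>Normalised Casimir elements and the exchange automorphism\<close>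

context q_ring begin

definition cas where "cas X = inverse (q + p) *s ucas X"
definition qbracket where "qbracket x y = inverse (q - p) *s (q *s (x * y) - p *s (y * x))"

lemma qbracket_sc: "qbracket (a *s x) (b *s y) = (a * b) *s qbracket x y"
  by (simp add: qbracket_def expand)

lemma qbracket_bracket: "qbracket x y = inverse (q - p) *s bracket x y"
  by (simp add: qbracket_def bracket_def)

text \<open>The bracket and the two products carry two factors \<open>t\<close>, and
  \<open>q + p\<close> in front of \<open>z\<close> cancels one of them there. Dividing every
  Casimir element by \<open>q + p\<close> thus gives the identities the shape of the relations of
  \<open>aw\<close>.\<close>

lemma normalised:
  assumes "bracket x y = (q - p) *s (a * b + c * d - (q + p) *s z)"
  defines "t \<equiv> inverse (q + p)"
  shows "t *s z = - qbracket (t *s x) (t *s y) + (t *s a) * (t *s b) + (t *s c) * (t *s d)"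
proof -
  have "qbracket (t *s x) (t *s y) = (t * t) *s (inverse (q - p) *s bracket x y)"
    by (subst qbracket_sc) (simp only: qbracket_bracket)
  also have "\<dots> = (t * t) *s (a * b + c * d - (q + p) *s z)"
    by (simp only: assms(1) d_scaled)
  finally have "qbracket (t *s x) (t *s y) = (t * t) *s (a * b + c * d - (q + p) *s z)" .
  moreover have "(t * t) *s ((q + p) *s z) = t *s z"
    using s_nz by (simp add: t_def mult.assoc)
  ultimately show ?thesis by (simp add: sc_diff_right sc_add_right)
qed

definition arc where "arc X Y Z = inverse (q + p) *s around X Y Z"

lemma cas_relations:
  assumes "rep X" "rep Y" "rep Z" "commuting X Y" "commuting X Z" "commuting Y Z"
  shows "arc X Y Z = - qbracket (cas (cprod X Y)) (cas (cprod Y Z)) + cas X * cas Z + cas Y * cas (cprod X (cprod Y Z))"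
    "cas (cprod X Y) = - qbracket (cas (cprod Y Z)) (arc X Y Z) + cas X * cas Y + cas Z * cas (cprod X (cprod Y Z))"
  unfolding cas_def arc_def
  by (rule normalised[OF bracket_around1[OF assms]], rule normalised[OF bracket_around2[OF assms]])

lemma arc_relation:
  assumes "rep X" "rep Y" "rep Z" "commuting X Y" "commuting X Z" "commuting Y Z"
    "rep W" "commuting X W" "commuting Y W" "commuting Z W"
  shows "arc X (cprod Y Z) W = - qbracket (arc X Y Z) (cas (cprod Z W)) + cas X * cas W + cas Z * arc X Y (cprod Z W)"
  unfolding cas_def arc_def
  by (rule normalised[OF bracket_around3[OF assms]])

text \<open>The automorphism \<open>theta\<close> fixes the Casimir element and reverses the coproduct, so that it turns
  relations for decreasing sequences into relations for increasing ones.\<close>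

fun theta :: "uq_gen \<Rightarrow> uq_gen" where
  "theta gE = gF" | "theta gF = gE" | "theta gK = gKinv" | "theta gKinv = gK"

definition flip :: "(uq_gen \<Rightarrow> 'b) \<Rightarrow> uq_gen \<Rightarrow> 'b" where "flip X g = X (theta g)"

lemma rep_flip: assumes "rep X" shows "rep (flip X)"
  unfolding rep_def flip_def
  by (simp add: rep_rules[OF assms] sc_diff_right qp_simps)

lemma commuting_flip: "commuting X Y \<Longrightarrow> commuting (flip X) (flip Y)"
  by (simp add: commuting_def flip_def)

lemma cprod_flip: assumes "commuting X Y" shows "flip (cprod X Y) = cprod (flip Y) (flip X)"
proof
  fix g
  have "X g * Y h = Y h * X g" for g h using assms by (auto simp: commuting_def)
  then show "flip (cprod X Y) g = cprod (flip Y) (flip X) g"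
    by (cases g) (simp_all add: flip_def add.commute)
qed

text \<open>The exchange puts \<open>E F\<close> in place of \<open>F E\<close>. Their difference,
  scaled by the square of \<open>q - p\<close>, is \<open>q - p\<close> times
  \<open>K^2 - L^2\<close>, where \<open>L\<close> is the inverse of \<open>K\<close>; it restores
  the coefficients \<open>q\<close> of \<open>K^2\<close> and \<open>p\<close> of \<open>L^2\<close>
  that the exchange has swapped.\<close>

lemma cas_flip: assumes "rep X" shows "cas (flip X) = cas X"
proof -
  have "(q - p) *s y = q *s y - p *s y" for y by (simp add: sc_diff_left)
  moreover have "((q - p) * (q - p)) *s (inverse (q - p) *s y) = q *s y - p *s y" for y
  proof -
    have "(q - p) * (q - p) * inverse (q - p) = q - p" using d_nz by (simp add: mult.assoc)
    then show ?thesis by (simp only: sc_sc sc_diff_left)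
  qed
  ultimately have "ucas (flip X) = ucas X"
    by (simp add: ucas_def flip_def k_of_def l_of_def rep_rules[OF assms] sc_add_right sc_diff_right del: sc_sc)
  then show ?thesis by (simp add: cas_def)
qed

text \<open>The counit, which is neutral for \<open>cprod\<close>: it ends the recursion of
  \<open>block\<close> and fills the indices outside a tensor power.\<close>

fun triv :: "uq_gen \<Rightarrow> 'b" where
  "triv gE = 0" | "triv gF = 0" | "triv gK = 1" | "triv gKinv = 1"

lemma cprod_triv [simp]: "cprod triv X = X" "cprod X triv = X"
proof -
  have "cprod triv X g = X g" "cprod X triv g = X g" for g by (cases g; simp)+
  then show "cprod triv X = X" "cprod X triv = X" by auto
qed

lemma rep_triv: "rep triv" by (simp add: rep_def)

lemma commuting_triv: "commuting triv X"
  unfolding commuting_def by (intro allI; case_tac g; simp)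

end

section \<open>Families of commuting representations and their intervals\<close>

locale commuting_reps = q_ring sc q p for sc :: "'k::field \<Rightarrow> 'b::{ring,monoid_mult} \<Rightarrow> 'b" and q p +
  fixes X :: "nat \<Rightarrow> uq_gen \<Rightarrow> 'b"
  assumes rep_X: "rep (X i)" and commuting_X: "i \<noteq> j \<Longrightarrow> commuting (X i) (X j)"
begin

primrec block :: "nat \<Rightarrow> nat \<Rightarrow> uq_gen \<Rightarrow> 'b" where
  "block i 0 = triv"
| "block i (Suc c) = cprod (X i) (block (Suc i) c)"

lemma block_add: "block i (a + b) = cprod (block i a) (block (i + a) b)"
  by (induction a arbitrary: i) (simp_all add: cprod_assoc)

lemma commuting_block:
  assumes "\<And>m. i \<le> m \<Longrightarrow> m < i + c \<Longrightarrow> commuting (X m) Y" shows "commuting (block i c) Y"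
  using assms by (induction c arbitrary: i) (simp_all add: commuting_triv commuting_cprod)

lemma commuting_blocks: "i + c \<le> j \<Longrightarrow> commuting (block i c) (block j d)"
  by (intro commuting_block commuting_sym[OF commuting_block] commuting_X) auto

lemma rep_block: "rep (block i c)"
proof (induction c arbitrary: i)
  case (Suc c)
  have "commuting (block i 1) (block (Suc i) c)" by (rule commuting_blocks) simp
  then show ?case using Suc rep_X by (auto intro!: rep_cprod)
qed (simp add: rep_triv)

definition D where "D I = block (Min I) (card I)"

lemma D_interval: "a \<le> b \<Longrightarrow> D {a..b} = block a (Suc b - a)"
proof -
  assume "a \<le> b"
  then have "Min {a..b} = a" by (intro Min_eqI) auto
  then show ?thesis by (simp add: D_def)
qed

definition C where "C I = cas (D I)"

text \<open>Repeats the case distinction of \<open>aw_C2\<close>, so that the two correspond term by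
  term under evaluation.\<close>

definition C2 where "C2 n I J = (let H = hole I J in if adjacent n I J then C (I \<union> J)
   else - qbracket (C (I \<union> H)) (C (H \<union> J)) + C I * C J + C H * C (I \<union> H \<union> J))"

lemma rep_D: "rep (D I)" by (simp add: D_def rep_block)

lemma D_next:
  assumes "next_interval n I J" shows "D (I \<union> J) = cprod (D I) (D J)"
proof -
  obtain a b c where h: "1 \<le> a" "a \<le> b" "b < c" "c \<le> n" "I = {a..b}" "J = {Suc b..c}"
    using assms by (elim next_intervalE) (rule that; simp)
  then have u: "I \<union> J = {a..c}" by auto
  have "block a (Suc c - a) = cprod (block a (Suc b - a)) (block (Suc b) (Suc c - Suc b))"
    using block_add[of a "Suc b - a" "Suc c - Suc b"] h by simp
  then show ?thesis unfolding u using h by (simp add: D_interval)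
qed

lemma commuting_D:
  assumes "I \<in> connected_subsets n" "J \<in> connected_subsets n" "I \<inter> J = {}"
  shows "commuting (D I) (D J)"
proof -
  obtain a b where I: "a \<le> b" "I = {a..b}"
    using assms(1) by (rule connected_subsetsE)
  obtain c d where J: "c \<le> d" "J = {c..d}"
    using assms(2) by (rule connected_subsetsE)
  note h = I J
  have "b < c \<or> d < a"
  proof (rule ccontr)
    assume "\<not> ?thesis"
    \<comment> \<open>If neither interval ends before the other begins, the larger of the two
      starting points belongs to both.\<close>
    then have "max a c \<in> I \<inter> J" using h by auto
    then show False using assms(3) by auto
  qed
  then show ?thesis using h
    by (auto simp: D_interval intro: commuting_blocks commuting_sym[OF commuting_blocks])
qed

lemma C_commute_disjoint:
  assumes "I \<in> connected_subsets n" "J \<in> connected_subsets n" "I \<inter> J = {}"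
  shows "C I * C J = C J * C I"
  using commuting_derived(4)[OF commuting_D[OF assms]] by (simp add: C_def cas_def coeffs)

text \<open>\<open>J\<close> consists of a part before \<open>I\<close>, of \<open>I\<close>, and of
  a part after \<open>I\<close>. The Casimir element of \<open>D I\<close> commutes with the outer
  parts, which sit at other positions, and with \<open>D I\<close>, where it is central; so it
  commutes with every \<open>D J g\<close>, and hence with the Casimir element of
  \<open>D J\<close>.\<close>

lemma C_commute_subset:
  assumes "I \<in> connected_subsets n" "J \<in> connected_subsets n" "I \<subseteq> J"
  shows "C I * C J = C J * C I"
proof -
  obtain a b where I: "1 \<le> a" "a \<le> b" "I = {a..b}"
    using assms(1) by (rule connected_subsetsE)
  obtain c d where J: "1 \<le> c" "c \<le> d" "J = {c..d}"
    using assms(2) by (rule connected_subsetsE)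
  have h: "c \<le> a" "b \<le> d" using assms(3) I J by auto
  have e: "Suc d - c = (a - c) + ((Suc b - a) + (d - b))" using h I(2) by simp
  have DJ: "D J = cprod (block c (a - c)) (cprod (D I) (block (Suc b) (d - b)))"
    using h I J unfolding J(3) D_interval[OF J(2)] e block_add by (simp add: D_interval)
  define P R where "P = block c (a - c)" and "R = block (Suc b) (d - b)"
  have PI: "commuting P (D I)" and RI: "commuting (D I) R"
    using h I by (auto simp: P_def R_def D_interval intro!: commuting_blocks)
  have 1: "P g * ucas (D I) = ucas (D I) * P g" "R g * ucas (D I) = ucas (D I) * R g" for g
    using PI RI by (auto intro!: commute_ucas simp: commuting_def)
  note 2 = ucas_commutes[OF rep_D, of I]
  note 3 = assoc_rule[OF 1(1)] assoc_rule[OF 1(2)] assoc_rule[OF 2]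
  have "D J g * ucas (D I) = ucas (D I) * D J g" for g
    unfolding DJ P_def[symmetric] R_def[symmetric]
    by (cases g) (simp_all add: distrib_left distrib_right mult.assoc 1 2 3)
  then have "ucas (D I) * ucas (D J) = ucas (D J) * ucas (D I)"
    by (intro commute_ucas) simp
  then show ?thesis by (simp add: C_def cas_def coeffs)
qed


end

text \<open>\<open>nx I J\<close> says that \<open>J\<close> is adjacent to \<open>I\<close> in the direction of the sequence. For decreasing sequences
  \<open>G\<close> is the flipped representation.\<close>

locale monotone_chain = commuting_reps sc q p X
  for sc :: "'k::field \<Rightarrow> 'b::{ring,monoid_mult} \<Rightarrow> 'b" and q p X +
  fixes G :: "nat set \<Rightarrow> uq_gen \<Rightarrow> 'b" and nx :: "nat set \<Rightarrow> nat set \<Rightarrow> bool" and n :: nat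
  assumes rep_G: "rep (G I)" and C_G: "C I = cas (G I)"
    and commuting_G: "I \<in> connected_subsets n \<Longrightarrow> J \<in> connected_subsets n \<Longrightarrow> I \<inter> J = {}
      \<Longrightarrow> commuting (G I) (G J)"
    and G_union: "nx I J \<Longrightarrow> G (I \<union> J) = cprod (G I) (G J)"
    and nx_adjacent: "nx I J \<Longrightarrow> adjacent n I J"
    and nx_union: "nx I J \<Longrightarrow> nx J K \<Longrightarrow> nx I (J \<union> K)" "nx I J \<Longrightarrow> nx J K \<Longrightarrow> nx (I \<union> J) K"
    and nx_hole: "nx I J \<Longrightarrow> nx J K \<Longrightarrow> \<not> adjacent n I K \<and> hole I K = J \<and> I \<inter> K = {}"
begin

lemma nx_comm: "nx I J \<Longrightarrow> commuting (G I) (G J)"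
  using nx_adjacent[of I J] by (auto simp: adjacent_def intro: commuting_G)

lemma nx_comm2: "nx I J \<Longrightarrow> nx J K \<Longrightarrow> commuting (G I) (G K)"
  using nx_adjacent[of I J] nx_adjacent[of J K] nx_hole[of I J K]
  by (intro commuting_G) (auto simp: adjacent_def)

lemma C2_nx: "nx I J \<Longrightarrow> C2 n I J = C (I \<union> J)"
  by (simp add: C2_def nx_adjacent)

text \<open>When a single \<open>J\<close> fills the gap, the defining formula of \<open>C2\<close>
  is the first identity of \<open>cas_relations\<close>. That identity therefore computes the
  element with index \<open>I K\<close>, and the relation of type (ii) is the second one.\<close>

lemma C2_arc:
  assumes "nx I J" "nx J K" shows "C2 n I K = arc (G I) (G J) (G K)"
proof -
  have "commuting (G I) (G J)" "commuting (G I) (G K)" "commuting (G J) (G K)"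
    using assms nx_comm nx_comm2 by blast+
  from cas_relations(1)[OF rep_G rep_G rep_G this] show ?thesis
    using assms nx_hole[OF assms] nx_union[OF assms]
    by (simp add: C2_def C_G G_union Un_assoc)
qed

lemma relation3:
  assumes "nx I J" "nx J K"
  shows "C2 n I J = - qbracket (C2 n J K) (C2 n I K) + C I * C J + C K * C (I \<union> J \<union> K)"
proof -
  have "commuting (G I) (G J)" "commuting (G I) (G K)" "commuting (G J) (G K)"
    using assms nx_comm nx_comm2 by blast+
  from cas_relations(2)[OF rep_G rep_G rep_G this] show ?thesis
    using assms nx_hole[OF assms] nx_union[OF assms]
    by (simp add: C2_arc C2_nx C_G G_union Un_assoc)
qed

text \<open>\<open>I\<close> and \<open>K\<close>, as well as \<open>I\<close> and
  \<open>K \<union> L\<close>, are separated by \<open>J\<close>, while \<open>I\<close> and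
  \<open>L\<close> are separated by \<open>J \<union> K\<close>; so every non-adjacent pair is an
  \<open>arc\<close> and \<open>arc_relation\<close> applies.\<close>

lemma relation4:
  assumes "nx I J" "nx J K" "nx K L"
  shows "C2 n I L = - qbracket (C2 n I K) (C2 n K L) + C I * C L + C K * C2 n I (K \<union> L)"
proof -
  have JK: "nx I (J \<union> K)" "nx (J \<union> K) L" "nx J (K \<union> L)" "nx (I \<union> J) K"
    using assms nx_union by blast+
  have "commuting (G I) (G J)" "commuting (G I) (G K)" "commuting (G J) (G K)"
    "commuting (G I) (G L)" "commuting (G J) (G L)" "commuting (G K) (G L)"
    using assms JK nx_comm nx_comm2 by blast+
  from arc_relation[OF rep_G rep_G rep_G this(1-3) rep_G this(4-6)]
  show ?thesis
    unfolding C2_arc[OF JK(1,2)] C2_arc[OF assms(1,2)] C2_arc[OF assms(1) JK(3)] C2_nx[OF assms(3)]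
    by (simp add: assms C_G G_union)
qed

end

context commuting_reps begin

lemma increasing_chain: "monotone_chain sc q p X D (next_interval n) n"
proof unfold_locales
  fix I J K
  assume "next_interval n I J" "next_interval n J K"
  from next_interval_chain[OF this]
  show "next_interval n I (J \<union> K)" "next_interval n (I \<union> J) K"
    "\<not> adjacent n I K \<and> hole I K = J \<and> I \<inter> K = {}" by auto
qed (auto simp: rep_D C_def commuting_D D_next next_interval_adjacent)

text \<open>The family \<open>X\<close>, and with it \<open>C\<close>, stays the same, since by
  \<open>cas_flip\<close> the Casimir elements do not notice the flip. Only the order of the factors
  in \<open>cprod\<close> is reversed.\<close>

lemma decreasing_chain: "monotone_chain sc q p X (\<lambda>I. flip (D I)) (\<lambda>I J. next_interval n J I) n"
proof unfold_locales
  fix I J K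
  assume "next_interval n J I" "next_interval n K J"
  from next_interval_chain[OF this(2,1)]
  show "next_interval n (J \<union> K) I" "next_interval n K (I \<union> J)"
    "\<not> adjacent n I K \<and> hole I K = J \<and> I \<inter> K = {}" by (auto simp: Un_commute Int_commute)
next
  fix I J
  assume a: "next_interval n J I"
  then show "adjacent n I J" by (simp add: next_interval_adjacent)
  then have "commuting (D J) (D I)"
    by (intro commuting_D) (auto simp: adjacent_def)
  then show "flip (D (I \<union> J)) = cprod (flip (D I)) (flip (D J))"
    using D_next[OF a] by (simp add: cprod_flip Un_commute)
qed (auto simp: rep_D C_def commuting_D rep_flip cas_flip commuting_flip)

lemma C2_relation3:
  assumes "monotonic_adjacent n [I, J, K]"
  shows "C2 n I J = - qbracket (C2 n J K) (C2 n I K) + C I * C J + C K * C (I \<union> J \<union> K)"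
  using monotonic_adjacent_cases[OF assms]
    monotone_chain.relation3[OF increasing_chain] monotone_chain.relation3[OF decreasing_chain]
  by (auto simp del: Un_assoc)

lemma C2_relation4:
  assumes "monotonic_adjacent n [I, J, K, L]"
  shows "C2 n I L = - qbracket (C2 n I K) (C2 n K L) + C I * C L + C K * C2 n I (K \<union> L)"
  using monotonic_adjacent_cases[OF assms]
    monotone_chain.relation4[OF increasing_chain] monotone_chain.relation4[OF decreasing_chain]
  by auto

end

section \<open>The quantum group and its tensor powers\<close>

text \<open>Families of elements, one in each algebra on a given type, form a ring in the sense of type
  classes. Identities proved there by rewriting hold in every algebra record, by evaluation.\<close>

lemma assoc_algebra_closed:
  assumes "assoc_algebra A"
  shows "\<zero>\<^bsub>A\<^esub> \<in> carrier A" "\<one>\<^bsub>A\<^esub> \<in> carrier A" "x \<in> carrier A \<Longrightarrow> \<ominus>\<^bsub>A\<^esub> x \<in> carrier A"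
    "x \<in> carrier A \<Longrightarrow> c \<odot>\<^bsub>A\<^esub> x \<in> carrier A"
    "x \<in> carrier A \<Longrightarrow> y \<in> carrier A \<Longrightarrow> x \<oplus>\<^bsub>A\<^esub> y \<in> carrier A"
    "x \<in> carrier A \<Longrightarrow> y \<in> carrier A \<Longrightarrow> x \<otimes>\<^bsub>A\<^esub> y \<in> carrier A"
    "x \<in> carrier A \<Longrightarrow> y \<in> carrier A \<Longrightarrow> x \<ominus>\<^bsub>A\<^esub> y \<in> carrier A"
proof -
  interpret assoc_algebra A by fact
  show "\<zero>\<^bsub>A\<^esub> \<in> carrier A" "\<one>\<^bsub>A\<^esub> \<in> carrier A" "x \<in> carrier A \<Longrightarrow> \<ominus>\<^bsub>A\<^esub> x \<in> carrier A"
    "x \<in> carrier A \<Longrightarrow> c \<odot>\<^bsub>A\<^esub> x \<in> carrier A"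
    "x \<in> carrier A \<Longrightarrow> y \<in> carrier A \<Longrightarrow> x \<oplus>\<^bsub>A\<^esub> y \<in> carrier A"
    "x \<in> carrier A \<Longrightarrow> y \<in> carrier A \<Longrightarrow> x \<otimes>\<^bsub>A\<^esub> y \<in> carrier A"
    "x \<in> carrier A \<Longrightarrow> y \<in> carrier A \<Longrightarrow> x \<ominus>\<^bsub>A\<^esub> y \<in> carrier A"
    by simp_all
qed

lemma section_closed:
  assumes "\<And>A. f A \<in> (if assoc_algebra A then carrier A else {undefined})" "assoc_algebra A"
  shows "f A \<in> carrier A"
  using assms(1)[of A] assms(2) by simp

text \<open>The carrier of one given algebra is a term and cannot become a type; ranging over all
  algebra records on a type removes this dependency. The value \<open>undefined\<close> elsewhere
  makes a section determined by its values on algebras.\<close>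

typedef (overloaded) ('k::field, 'a) alg_section =
  "{f :: ('k, 'a) module \<Rightarrow> 'a. \<forall>A. f A \<in> (if assoc_algebra A then carrier A else {undefined})}"
  morphisms at_algebra Abs_alg_section
proof
  have "\<zero>\<^bsub>A\<^esub> \<in> carrier A" if "assoc_algebra A" for A :: "('k, 'a) module"
    using that by (simp add: assoc_algebra_def ring.ring_simprules(2))
  then show "(\<lambda>A. if assoc_algebra A then \<zero>\<^bsub>A\<^esub> else undefined) \<in>
    {f :: ('k, 'a) module \<Rightarrow> 'a. \<forall>A. f A \<in> (if assoc_algebra A then carrier A else {undefined})}"
    by simp
qed

setup_lifting type_definition_alg_section

lemma at_closed [simp]: "assoc_algebra A \<Longrightarrow> at_algebra x A \<in> carrier A"
  using at_algebra[of x] by (auto dest: spec[of _ A])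

lemma alg_section_eqI:
  assumes "\<And>A. assoc_algebra A \<Longrightarrow> at_algebra x A = at_algebra y A" shows "x = y"
proof -
  have "at_algebra x A = at_algebra y A" for A
    using assms at_algebra[of x] at_algebra[of y] by (cases "assoc_algebra A") (auto dest!: spec[of _ A])
  then show ?thesis by (simp add: at_algebra_inject[symmetric] fun_eq_iff)
qed

instantiation alg_section :: (field, type) "{zero, one, plus, minus, uminus, times}"
begin

lift_definition zero_alg_section :: "('a, 'b) alg_section" is "\<lambda>A. if assoc_algebra A then \<zero>\<^bsub>A\<^esub> else undefined"
  by (simp add: assoc_algebra_closed)
lift_definition one_alg_section :: "('a, 'b) alg_section" is "\<lambda>A. if assoc_algebra A then \<one>\<^bsub>A\<^esub> else undefined"
  by (simp add: assoc_algebra_closed)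
lift_definition plus_alg_section :: "('a, 'b) alg_section \<Rightarrow> ('a, 'b) alg_section \<Rightarrow> ('a, 'b) alg_section"
  is "\<lambda>f g A. if assoc_algebra A then f A \<oplus>\<^bsub>A\<^esub> g A else undefined"
  by (simp add: assoc_algebra_closed section_closed)
lift_definition minus_alg_section :: "('a, 'b) alg_section \<Rightarrow> ('a, 'b) alg_section \<Rightarrow> ('a, 'b) alg_section"
  is "\<lambda>f g A. if assoc_algebra A then f A \<ominus>\<^bsub>A\<^esub> g A else undefined"
  by (simp add: assoc_algebra_closed section_closed)
lift_definition uminus_alg_section :: "('a, 'b) alg_section \<Rightarrow> ('a, 'b) alg_section"
  is "\<lambda>f A. if assoc_algebra A then \<ominus>\<^bsub>A\<^esub> f A else undefined"
  by (simp add: assoc_algebra_closed section_closed)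
lift_definition times_alg_section :: "('a, 'b) alg_section \<Rightarrow> ('a, 'b) alg_section \<Rightarrow> ('a, 'b) alg_section"
  is "\<lambda>f g A. if assoc_algebra A then f A \<otimes>\<^bsub>A\<^esub> g A else undefined"
  by (simp add: assoc_algebra_closed section_closed)

instance ..

end

lift_definition scale_alg_section :: "'k::field \<Rightarrow> ('k, 'a) alg_section \<Rightarrow> ('k, 'a) alg_section"
  is "\<lambda>c f A. if assoc_algebra A then c \<odot>\<^bsub>A\<^esub> f A else undefined"
  by (simp add: assoc_algebra_closed section_closed)

lemma at_simps:
  assumes "assoc_algebra A"
  shows "at_algebra 0 A = \<zero>\<^bsub>A\<^esub>" "at_algebra 1 A = \<one>\<^bsub>A\<^esub>"
    "at_algebra (x + y) A = at_algebra x A \<oplus>\<^bsub>A\<^esub> at_algebra y A"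
    "at_algebra (x - y) A = at_algebra x A \<ominus>\<^bsub>A\<^esub> at_algebra y A"
    "at_algebra (- x) A = \<ominus>\<^bsub>A\<^esub> at_algebra x A"
    "at_algebra (x * y) A = at_algebra x A \<otimes>\<^bsub>A\<^esub> at_algebra y A"
    "at_algebra (scale_alg_section c x) A = c \<odot>\<^bsub>A\<^esub> at_algebra x A"
  by (simp_all add: assms zero_alg_section.rep_eq one_alg_section.rep_eq plus_alg_section.rep_eq minus_alg_section.rep_eq
      uminus_alg_section.rep_eq times_alg_section.rep_eq scale_alg_section.rep_eq)

instance alg_section :: (field, type) ring
proof
  fix x y z :: "('a, 'b) alg_section"
  note r = assoc_algebra.axioms(1)
  show "x + y + z = x + (y + z)" by (rule alg_section_eqI) (simp add: at_simps ring.ring_simprules[OF r])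
  show "x + y = y + x" by (rule alg_section_eqI) (simp add: at_simps ring.ring_simprules(10)[OF r])
  show "0 + x = x" by (rule alg_section_eqI) (simp add: at_simps ring.ring_simprules[OF r])
  show "- x + x = 0" by (rule alg_section_eqI) (simp add: at_simps ring.ring_simprules[OF r])
  show "x - y = x + - y" by (rule alg_section_eqI) (simp add: at_simps a_minus_def)
  show "x * y * z = x * (y * z)" by (rule alg_section_eqI) (simp add: at_simps ring.ring_simprules[OF r])
  show "(x + y) * z = x * z + y * z" by (rule alg_section_eqI) (simp add: at_simps ring.ring_simprules[OF r])
  show "x * (y + z) = x * y + x * z" by (rule alg_section_eqI) (simp add: at_simps ring.ring_simprules[OF r])
qed

instance alg_section :: (field, type) monoid_mult
proof
  fix x :: "('a, 'b) alg_section"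
  note r = ring.is_monoid[OF assoc_algebra.axioms(1)]
  show "1 * x = x" by (rule alg_section_eqI) (simp add: at_simps monoid.l_one[OF r])
  show "x * 1 = x" by (rule alg_section_eqI) (simp add: at_simps monoid.r_one[OF r])
qed

interpretation alg_section: scaled_ring "scale_alg_section :: 'k::field \<Rightarrow> ('k, 'a) alg_section \<Rightarrow> ('k, 'a) alg_section"
proof
  fix a b :: 'k and x y :: "('k, 'a) alg_section"
  show "scale_alg_section (a + b) x = scale_alg_section a x + scale_alg_section b x"
    by (rule alg_section_eqI) (simp add: at_simps assoc_algebra.smult_add_left)
  show "scale_alg_section a (x + y) = scale_alg_section a x + scale_alg_section a y"
    by (rule alg_section_eqI) (simp add: at_simps assoc_algebra.smult_add_right)
  show "scale_alg_section a (scale_alg_section b x) = scale_alg_section (a * b) x"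
    by (rule alg_section_eqI) (simp add: at_simps assoc_algebra.smult_smult)
  show "scale_alg_section 1 x = x"
    by (rule alg_section_eqI) (simp add: at_simps assoc_algebra.smult_one)
  show "scale_alg_section a x * y = scale_alg_section a (x * y)"
    by (rule alg_section_eqI) (simp add: at_simps assoc_algebra.smult_mult_left)
  show "x * scale_alg_section a y = scale_alg_section a (x * y)"
    by (rule alg_section_eqI) (simp add: at_simps assoc_algebra.smult_mult_right)
qed

lemma qv_facts: "qv \<noteq> 0" "qv - inverse qv \<noteq> 0" "qv + inverse qv \<noteq> 0"
proof -
  have inv: "inverse qv = Fract 1 [:0, 1:]" by (simp add: qv_def)
  show "qv \<noteq> 0" by (simp add: qv_def Zero_fract_def eq_fract)
  show "qv - inverse qv \<noteq> 0" unfolding inv by (simp add: qv_def Zero_fract_def eq_fract one_pCons)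
  show "qv + inverse qv \<noteq> 0" unfolding inv by (simp add: qv_def Zero_fract_def eq_fract one_pCons)
qed

interpretation alg_section: q_ring "scale_alg_section :: Cq \<Rightarrow> (Cq, 'a) alg_section \<Rightarrow> (Cq, 'a) alg_section" qv "inverse qv"
  by unfold_locales (use qv_facts in simp_all)

subsection \<open>Transfer\<close>

definition rep_in :: "(Cq, 'a) module \<Rightarrow> (uq_gen \<Rightarrow> 'a) \<Rightarrow> bool" where
  "rep_in A X \<longleftrightarrow> (\<forall>g. X g \<in> carrier A) \<and>
     X gK \<otimes>\<^bsub>A\<^esub> X gKinv = \<one>\<^bsub>A\<^esub> \<and> X gKinv \<otimes>\<^bsub>A\<^esub> X gK = \<one>\<^bsub>A\<^esub> \<and>
     X gK \<otimes>\<^bsub>A\<^esub> X gE = qv \<odot>\<^bsub>A\<^esub> (X gE \<otimes>\<^bsub>A\<^esub> X gK) \<and>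
     X gK \<otimes>\<^bsub>A\<^esub> X gF = inverse qv \<odot>\<^bsub>A\<^esub> (X gF \<otimes>\<^bsub>A\<^esub> X gK) \<and>
     X gE \<otimes>\<^bsub>A\<^esub> X gF \<ominus>\<^bsub>A\<^esub> X gF \<otimes>\<^bsub>A\<^esub> X gE =
       inverse (qv - inverse qv) \<odot>\<^bsub>A\<^esub> (X gK \<otimes>\<^bsub>A\<^esub> X gK \<ominus>\<^bsub>A\<^esub> X gKinv \<otimes>\<^bsub>A\<^esub> X gKinv)"

definition commuting_in :: "(Cq, 'a) module \<Rightarrow> (uq_gen \<Rightarrow> 'a) \<Rightarrow> (uq_gen \<Rightarrow> 'a) \<Rightarrow> bool" where
  "commuting_in A X Y \<longleftrightarrow> (\<forall>g h. X g \<otimes>\<^bsub>A\<^esub> Y h = Y h \<otimes>\<^bsub>A\<^esub> X g)"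

fun cprod_in :: "(Cq, 'a) module \<Rightarrow> (uq_gen \<Rightarrow> 'a) \<Rightarrow> (uq_gen \<Rightarrow> 'a) \<Rightarrow> uq_gen \<Rightarrow> 'a" where
  "cprod_in A X Y gE = X gE \<otimes>\<^bsub>A\<^esub> Y gKinv \<oplus>\<^bsub>A\<^esub> X gK \<otimes>\<^bsub>A\<^esub> Y gE"
| "cprod_in A X Y gF = X gF \<otimes>\<^bsub>A\<^esub> Y gKinv \<oplus>\<^bsub>A\<^esub> X gK \<otimes>\<^bsub>A\<^esub> Y gF"
| "cprod_in A X Y gK = X gK \<otimes>\<^bsub>A\<^esub> Y gK"
| "cprod_in A X Y gKinv = X gKinv \<otimes>\<^bsub>A\<^esub> Y gKinv"

fun triv_in :: "(Cq, 'a) module \<Rightarrow> uq_gen \<Rightarrow> 'a" where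
  "triv_in A gE = \<zero>\<^bsub>A\<^esub>" | "triv_in A gF = \<zero>\<^bsub>A\<^esub>" | "triv_in A gK = \<one>\<^bsub>A\<^esub>" | "triv_in A gKinv = \<one>\<^bsub>A\<^esub>"

primrec block_in :: "(Cq, 'a) module \<Rightarrow> (nat \<Rightarrow> uq_gen \<Rightarrow> 'a) \<Rightarrow> nat \<Rightarrow> nat \<Rightarrow> uq_gen \<Rightarrow> 'a" where
  "block_in A X i 0 = triv_in A"
| "block_in A X i (Suc c) = cprod_in A (X i) (block_in A X (Suc i) c)"

definition casimir_in :: "(Cq, 'a) module \<Rightarrow> (uq_gen \<Rightarrow> 'a) \<Rightarrow> 'a" where
  "casimir_in A X = inverse (qv + inverse qv) \<odot>\<^bsub>A\<^esub>
     ((qv - inverse qv)\<^sup>2 \<odot>\<^bsub>A\<^esub> (X gF \<otimes>\<^bsub>A\<^esub> X gE)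
      \<oplus>\<^bsub>A\<^esub> qv \<odot>\<^bsub>A\<^esub> (X gK \<otimes>\<^bsub>A\<^esub> X gK)
      \<oplus>\<^bsub>A\<^esub> inverse qv \<odot>\<^bsub>A\<^esub> (X gKinv \<otimes>\<^bsub>A\<^esub> X gKinv))"

lemma triv_in_rep:
  assumes "assoc_algebra A" shows "rep_in A (triv_in A)" "commuting_in A (triv_in A) (triv_in A)"
proof -
  interpret assoc_algebra A by fact
  have c: "triv_in A g \<in> carrier A" for g by (cases g) simp_all
  then show "rep_in A (triv_in A)" by (simp add: rep_in_def a_minus_def r_neg)
  have "triv_in A g \<otimes>\<^bsub>A\<^esub> triv_in A h = triv_in A h \<otimes>\<^bsub>A\<^esub> triv_in A g" for g h
    by (cases g; cases h) simp_all
  then show "commuting_in A (triv_in A) (triv_in A)" by (simp add: commuting_in_def)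
qed

text \<open>Outside \<open>A\<close> the section takes the values of the trivial representation, so that relations
  with constant terms, such as \<open>K L = 1\<close>, hold in every component.\<close>

definition extend :: "(Cq, 'a) module \<Rightarrow> (uq_gen \<Rightarrow> 'a) \<Rightarrow> uq_gen \<Rightarrow> (Cq, 'a) alg_section" where
  "extend A X g = Abs_alg_section (\<lambda>B. if \<not> assoc_algebra B then undefined else if B = A then X g else triv_in B g)"

lemma at_extend:
  assumes "\<And>g. X g \<in> carrier A" "assoc_algebra B"
  shows "at_algebra (extend A X g) B = (if B = A then X g else triv_in B g)"
proof -
  have "triv_in B g \<in> carrier B" if "assoc_algebra B" for B :: "(Cq, 'a) module"
    using triv_in_rep(1)[OF that] by (simp add: rep_in_def)
  then have "at_algebra (extend A X g) = (\<lambda>B. if \<not> assoc_algebra B then undefined else if B = A then X g else triv_in B g)"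
    unfolding extend_def by (intro Abs_alg_section_inverse) (use assms(1) in auto)
  then show ?thesis using assms(2) by simp
qed

lemma rep_extend:
  assumes "rep_in A X" shows "alg_section.rep (extend A X)"
proof -
  have c: "X g \<in> carrier A" for g using assms by (simp add: rep_in_def)
  have "rep_in B (\<lambda>g. at_algebra (extend A X g) B)" if B: "assoc_algebra B" for B
  proof (cases "B = A")
    case True
    then show ?thesis using assms B by (simp add: at_extend[OF c] eta_contract_eq)
  next
    case False
    then show ?thesis using triv_in_rep(1)[OF B] B by (simp add: at_extend[OF c] eta_contract_eq)
  qed
  then show ?thesis
    unfolding alg_section.rep_def rep_in_def by (intro conjI alg_section_eqI; simp add: at_simps)
qed

lemma commuting_extend:
  assumes "rep_in A X" "rep_in A Y" "commuting_in A X Y" shows "alg_section.commuting (extend A X) (extend A Y)"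
proof -
  have c: "X g \<in> carrier A" "Y g \<in> carrier A" for g using assms by (simp_all add: rep_in_def)
  show ?thesis
    unfolding alg_section.commuting_def
  proof (intro allI alg_section_eqI)
    fix g h B assume B: "assoc_algebra (B :: (Cq, 'a) module)"
    show "at_algebra (extend A X g * extend A Y h) B = at_algebra (extend A Y h * extend A X g) B"
      using assms(3) triv_in_rep(2)[OF B] B
      by (cases "B = A") (auto simp: at_simps at_extend[OF c(1)] at_extend[OF c(2)] commuting_in_def)
  qed
qed

lemma at_cprod: "assoc_algebra A \<Longrightarrow>
    at_algebra (alg_section.cprod X Y g) A = cprod_in A (\<lambda>g. at_algebra (X g) A) (\<lambda>g. at_algebra (Y g) A) g"
  by (cases g) (simp_all add: at_simps)

lemma at_triv: "assoc_algebra A \<Longrightarrow> at_algebra (alg_section.triv g) A = triv_in A g"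
  by (cases g) (simp_all add: at_simps)

lemma at_cas: "assoc_algebra A \<Longrightarrow> at_algebra (alg_section.cas X) A = casimir_in A (\<lambda>g. at_algebra (X g) A)"
  by (simp add: alg_section.cas_def alg_section.ucas_def alg_section.k_of_def alg_section.l_of_def casimir_in_def at_simps power2_eq_square)

text \<open>The pattern of the transfer: extend the representations to sections, apply the result
  for type classes, and evaluate the resulting equations at \<open>A\<close>.\<close>

lemma rep_in_cprod:
  assumes A: "assoc_algebra A" and X: "rep_in A X" "rep_in A Y" "commuting_in A X Y"
  shows "rep_in A (cprod_in A X Y)"
proof -
  have c: "X g \<in> carrier A" "Y g \<in> carrier A" for g using X by (simp_all add: rep_in_def)
  have "alg_section.rep (alg_section.cprod (extend A X) (extend A Y))"
    by (intro alg_section.rep_cprod rep_extend commuting_extend X)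
  then have "rep_in A (\<lambda>g. at_algebra (alg_section.cprod (extend A X) (extend A Y) g) A)"
    unfolding alg_section.rep_def rep_in_def using A
    by (auto simp: at_simps dest!: arg_cong[where f = "\<lambda>x. at_algebra x A"])
  then show ?thesis using A by (simp add: at_cprod at_extend[OF c(1)] at_extend[OF c(2)] eta_contract_eq)
qed

lemma cprod_in_hom:
  assumes "assoc_algebra A" "alg_hom A B f" "\<And>g. X g \<in> carrier A" "\<And>g. Y g \<in> carrier A"
  shows "f (cprod_in A X Y g) = cprod_in B (\<lambda>g. f (X g)) (\<lambda>g. f (Y g)) g" "cprod_in A X Y g \<in> carrier A"
  using assms(3,4) by (cases g; simp add: alg_homD[OF assms(2)] assoc_algebra_closed[OF assms(1)])+

lemma triv_in_hom:
  assumes "assoc_algebra A" "assoc_algebra B" "alg_hom A B f"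
  shows "f (triv_in A g) = triv_in B g" "triv_in A g \<in> carrier A"
  by (cases g; simp add: alg_homD[OF assms(3)] alg_hom_zero[OF assms] assoc_algebra_closed[OF assms(1)])+

lemma block_in_closed:
  assumes "assoc_algebra A" "\<And>k g. i \<le> k \<Longrightarrow> k < i + c \<Longrightarrow> X k g \<in> carrier A"
  shows "block_in A X i c g \<in> carrier A"
  using assms(2)
proof (induction c arbitrary: i g)
  case 0 then show ?case using triv_in_rep(1)[OF assms(1)] by (simp add: rep_in_def)
next
  case (Suc c)
  have "X i g \<in> carrier A" "block_in A X (Suc i) c g \<in> carrier A" for g using Suc by simp_all
  then show ?case by (cases g) (simp_all add: assoc_algebra_closed[OF assms(1)])
qed

lemma block_in_hom:
  assumes "assoc_algebra A" "assoc_algebra B" "alg_hom A B f"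
    "\<And>k g. i \<le> k \<Longrightarrow> k < i + c \<Longrightarrow> X k g \<in> carrier A"
  shows "f (block_in A X i c g) = block_in B (\<lambda>k g. f (X k g)) i c g"
  using assms(4)
proof (induction c arbitrary: i g)
  case 0 then show ?case using assms by (simp add: triv_in_hom)
next
  case (Suc c)
  have "X i g \<in> carrier A" "block_in A X (Suc i) c g \<in> carrier A" for g
    using Suc.prems by (auto intro!: block_in_closed[OF assms(1)])
  moreover have "f (block_in A X (Suc i) c g) = block_in B (\<lambda>k g. f (X k g)) (Suc i) c g" for g
    by (rule Suc.IH) (use Suc.prems in simp)
  ultimately show ?case by (simp add: cprod_in_hom[OF assms(1,3)])
qed

lemma block_in_cong:
  assumes "\<And>k. k < c \<Longrightarrow> X (i + k) = Y (j + k)" shows "block_in A X i c = block_in A Y j c"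
  using assms
proof (induction c arbitrary: i j)
  case (Suc c)
  have "block_in A X (Suc i) c = block_in A Y (Suc j) c"
    by (rule Suc.IH) (use Suc.prems[of "Suc _"] in simp)
  then show ?case using Suc.prems[of 0] by simp
qed simp

lemma cprod_in_assoc:
  assumes "assoc_algebra A" "\<And>g. X g \<in> carrier A" "\<And>g. Y g \<in> carrier A" "\<And>g. Z g \<in> carrier A"
  shows "cprod_in A (cprod_in A X Y) Z = cprod_in A X (cprod_in A Y Z)"
proof
  interpret assoc_algebra A by fact
  show "cprod_in A (cprod_in A X Y) Z g = cprod_in A X (cprod_in A Y Z) g" for g
    using assms(2-) by (cases g) (simp_all add: l_distr r_distr m_assoc a_assoc)
qed

lemma cprod_in_triv:
  assumes "assoc_algebra A" "\<And>g. X g \<in> carrier A" shows "cprod_in A X (triv_in A) = X"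
proof
  interpret assoc_algebra A by fact
  show "cprod_in A X (triv_in A) g = X g" for g
    using assms(2) by (cases g) simp_all
qed

lemma casimir_in_hom:
  assumes "assoc_algebra A" "alg_hom A B f" "\<And>g. X g \<in> carrier A"
  shows "f (casimir_in A X) = casimir_in B (\<lambda>g. f (X g))" "casimir_in A X \<in> carrier A"
  using assms(3) by (simp_all add: casimir_in_def alg_homD[OF assms(2)] assoc_algebra_closed[OF assms(1)])

lemma rep_in_hom:
  assumes "assoc_algebra A" "assoc_algebra B" "alg_hom A B f" "rep_in A X"
  shows "rep_in B (\<lambda>g. f (X g))"
proof -
  note c = assoc_algebra_closed[OF assms(1)] and h = alg_homD[OF assms(3)]
  have X: "X g \<in> carrier A" for g using assms(4) by (simp add: rep_in_def)
  note m = alg_hom_minus[OF assms(1-3)]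
  have "f (X gK \<otimes>\<^bsub>A\<^esub> X gKinv) = f \<one>\<^bsub>A\<^esub>" "f (X gKinv \<otimes>\<^bsub>A\<^esub> X gK) = f \<one>\<^bsub>A\<^esub>"
    "f (X gK \<otimes>\<^bsub>A\<^esub> X gE) = f (qv \<odot>\<^bsub>A\<^esub> (X gE \<otimes>\<^bsub>A\<^esub> X gK))"
    "f (X gK \<otimes>\<^bsub>A\<^esub> X gF) = f (inverse qv \<odot>\<^bsub>A\<^esub> (X gF \<otimes>\<^bsub>A\<^esub> X gK))"
    "f (X gE \<otimes>\<^bsub>A\<^esub> X gF \<ominus>\<^bsub>A\<^esub> X gF \<otimes>\<^bsub>A\<^esub> X gE) =
       f (inverse (qv - inverse qv) \<odot>\<^bsub>A\<^esub> (X gK \<otimes>\<^bsub>A\<^esub> X gK \<ominus>\<^bsub>A\<^esub> X gKinv \<otimes>\<^bsub>A\<^esub> X gKinv))"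
    using assms(4) by (simp_all add: rep_in_def)
  then show ?thesis unfolding rep_in_def using X by (simp add: h c m)
qed

subsection \<open>The quantum group\<close>

lemma Uq_free_carrier: "carrier (free_algebra UNIV) = UNIV"
  by (simp add: free_algebra_def monoid_algebra_simps free_monoid_def)

text \<open>Both directions are used: for the quotient map it gives the relations between the
  generators of \<open>Uq\<close>, and for the evaluation map it shows that a representation
  annihilates the relations and so factors through \<open>Uq\<close>.\<close>

lemma Uq_relations_iff:
  assumes "assoc_algebra B" "alg_hom Uq_free B f"
  shows "(\<forall>r\<in>Uq_relations. f r = \<zero>\<^bsub>B\<^esub>) \<longleftrightarrow> rep_in B (\<lambda>g. f (gen g))"
proof -
  interpret B: assoc_algebra B by fact
  have F: "assoc_algebra Uq_free" unfolding Uq_free_def by (rule free_algebra)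
  have car: "x \<in> carrier Uq_free" for x by (simp add: Uq_free_def Uq_free_carrier)
  note [simp] = car alg_homD[OF assms(2)] alg_hom_minus[OF F assms] B.r_right_minus_eq
  show ?thesis
    unfolding Uq_relations_def rep_in_def Let_def by simp
qed

lemma Uq_relations_carrier: "Uq_relations \<subseteq> carrier (free_algebra UNIV)"
  by (simp add: Uq_free_carrier)

interpretation Uq: assoc_algebra Uq
  unfolding Uq_def by (rule presented_algebra[OF Uq_relations_carrier])

lemma rep_in_Uq: "rep_in Uq uq"
proof -
  have "alg_hom Uq_free Uq (presented_class UNIV Uq_relations)"
    unfolding Uq_free_def Uq_def by (rule presented_class_hom[OF Uq_relations_carrier])
  from Uq_relations_iff[OF Uq.assoc_algebra_axioms this]
  show ?thesis
    by (simp add: presented_class_relation[OF Uq_relations_carrier] Uq_def uq_def eta_contract_eq flip: uq_def)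
qed

lemma uq_closed [simp]: "uq g \<in> carrier Uq"
  using rep_in_Uq by (simp add: rep_in_def)

lemma Uq_lift:
  assumes B: "assoc_algebra B" and X: "rep_in B X"
  shows "alg_hom Uq B (presented_lift B X)" "presented_lift B X (uq g) = X g"
proof -
  have c: "X g \<in> carrier B" for g using X by (simp add: rep_in_def)
  have gen: "eval_free B X (gen g) = X g" for g by (rule eval_free_gen[OF B c UNIV_I])
  have "alg_hom Uq_free B (eval_free B X)" unfolding Uq_free_def by (rule eval_free_hom[OF B c])
  from Uq_relations_iff[OF B this] X
  have kill: "eval_free B X r = \<zero>\<^bsub>B\<^esub>" if "r \<in> Uq_relations" for r using that by (simp add: gen)
  show "alg_hom Uq B (presented_lift B X)"
    unfolding Uq_def by (rule presented_lift(1)[OF B c Uq_relations_carrier kill])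
  show "presented_lift B X (uq g) = X g"
    unfolding uq_def using presented_lift(2)[OF B c Uq_relations_carrier kill, of "gen g"]
    by (simp add: Uq_free_carrier gen)
qed

lemma Uq_pow: "Uq_pow n = tensor_power Uq n"
  by (simp add: Uq_pow_def)

lemma Uq_pow_algebra: "assoc_algebra (Uq_pow n)"
  unfolding Uq_pow by (rule Uq.tensor_power)

section \<open>Positions in tensor powers and the iterated coproduct\<close>

definition Uq_pos :: "nat \<Rightarrow> nat \<Rightarrow> uq_gen \<Rightarrow> Uq_tensor" where
  "Uq_pos n i g = Uq.pos n i (uq g)"

lemma rep_in_pos: "i < n \<Longrightarrow> rep_in (Uq_pow n) (Uq_pos n i)"
  unfolding Uq_pos_def[abs_def] Uq_pow
  by (rule rep_in_hom[OF Uq.assoc_algebra_axioms Uq.tensor_power Uq.pos_hom rep_in_Uq])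

lemma Uq_pos_closed: "i < n \<Longrightarrow> Uq_pos n i g \<in> carrier (Uq_pow n)"
  using rep_in_pos[of i n] by (simp add: rep_in_def)

lemma commuting_in_pos: "i \<noteq> j \<Longrightarrow> commuting_in (Uq_pow n) (Uq_pos n i) (Uq_pos n j)"
  by (simp add: commuting_in_def Uq_pos_def Uq_pow Uq.pos_commute)

text \<open>A pure tensor of length two is the product of its entries placed at the two positions.
  On generators the coproduct is thus a product of two commuting representations, and its
  compatibility with the relations of \<open>Uq\<close> comes from
  \<open>rep_in_cprod\<close>.\<close>

lemma coproduct_gen_eq: "coproduct_gen = cprod_in (Uq_pow 2) (Uq_pos 2 0) (Uq_pos 2 1)"
proof
  fix g
  have pure: "pure_tensor Uq [x, y] = Uq.pos 2 0 x \<otimes>\<^bsub>Uq_pow 2\<^esub> Uq.pos 2 1 y"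
    if "x \<in> carrier Uq" "y \<in> carrier Uq" for x y
  proof -
    have "[x, \<one>\<^bsub>Uq\<^esub>] \<in> tuples Uq 2" "[\<one>\<^bsub>Uq\<^esub>, y] \<in> tuples Uq 2"
      using that by (simp_all add: tuple_monoid_def)
    from Uq.pure_mult[OF this] show ?thesis
      using that by (simp add: Uq.pos_def Uq_pow numeral_2_eq_2)
  qed
  show "coproduct_gen g = cprod_in (Uq_pow 2) (Uq_pos 2 0) (Uq_pos 2 1) g"
    by (cases g) (simp_all add: pure Uq_pos_def)
qed

lemma coproduct:
  "alg_hom Uq (Uq_pow 2) coproduct" "coproduct (uq g) = cprod_in (Uq_pow 2) (Uq_pos 2 0) (Uq_pos 2 1) g"
proof -
  have "rep_in (Uq_pow 2) coproduct_gen"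
    unfolding coproduct_gen_eq
    by (intro rep_in_cprod Uq_pow_algebra rep_in_pos commuting_in_pos) simp_all
  from Uq_lift[OF Uq_pow_algebra this]
  show "alg_hom Uq (Uq_pow 2) coproduct" "coproduct (uq g) = cprod_in (Uq_pow 2) (Uq_pos 2 0) (Uq_pos 2 1) g"
    unfolding coproduct_def by (simp_all add: coproduct_gen_eq)
qed

lemma coproduct_first_eq: "coproduct_first m = Uq.first_factor coproduct m"
  by (simp add: coproduct_first_def Uq.first_factor_def[OF coproduct(1)[unfolded Uq_pow]] Uq_pow)

lemma coproduct_first:
  shows coproduct_first_hom: "alg_hom (Uq_pow (Suc m)) (Uq_pow (2 + m)) (coproduct_first m)"
    and coproduct_first_pos_0: "coproduct_first m (Uq_pos (Suc m) 0 g) =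
      cprod_in (Uq_pow (2 + m)) (Uq_pos (2 + m) 0) (Uq_pos (2 + m) 1) g"
    and coproduct_first_pos_Suc: "j < m \<Longrightarrow> coproduct_first m (Uq_pos (Suc m) (Suc j) g) = Uq_pos (2 + m) (2 + j) g"
proof -
  note \<Delta> = coproduct(1)[unfolded Uq_pow]
  show "alg_hom (Uq_pow (Suc m)) (Uq_pow (2 + m)) (coproduct_first m)"
    unfolding coproduct_first_eq Uq_pow by (rule Uq.first_factor_hom[OF \<Delta>])
  show "j < m \<Longrightarrow> coproduct_first m (Uq_pos (Suc m) (Suc j) g) = Uq_pos (2 + m) (2 + j) g"
    unfolding coproduct_first_eq Uq_pos_def by (rule Uq.first_factor_pos(2)[OF \<Delta> uq_closed])
  have "coproduct_first m (Uq_pos (Suc m) 0 g) = Uq.left 2 m (coproduct (uq g))"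
    unfolding coproduct_first_eq Uq_pos_def by (rule Uq.first_factor_pos(1)[OF \<Delta> uq_closed])
  also have "\<dots> = cprod_in (Uq_pow (2 + m)) (\<lambda>g. Uq.left 2 m (Uq_pos 2 0 g)) (\<lambda>g. Uq.left 2 m (Uq_pos 2 1 g)) g"
    unfolding coproduct(2)
    by (rule cprod_in_hom(1)[OF Uq_pow_algebra]) (simp_all add: Uq_pow Uq.left_hom Uq_pos_closed[unfolded Uq_pow] del: add_2_eq_Suc)
  also have "(\<lambda>g. Uq.left 2 m (Uq_pos 2 0 g)) = Uq_pos (2 + m) 0"
    unfolding Uq_pos_def by (rule ext, rule Uq.left_pos) simp_all
  also have "(\<lambda>g. Uq.left 2 m (Uq_pos 2 1 g)) = Uq_pos (2 + m) 1"
    unfolding Uq_pos_def by (rule ext, rule Uq.left_pos) simp_all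
  finally show "coproduct_first m (Uq_pos (Suc m) 0 g) =
      cprod_in (Uq_pow (2 + m)) (Uq_pos (2 + m) 0) (Uq_pos (2 + m) 1) g" .
qed

text \<open>The coproduct in the first factor replaces position 0 by the product of positions 0 and
  1 and moves the other positions up by one; reassociating gives a block with one more factor. For
  \<open>m = 0\<close> the trivial representation that ends the block is absorbed by
  \<open>cprod_in_triv\<close>.\<close>

lemma iterated_coproduct:
  "alg_hom Uq (Uq_pow (Suc m)) (iterated_coproduct m) \<and>
    (\<forall>g. iterated_coproduct m (uq g) = block_in (Uq_pow (Suc m)) (Uq_pos (Suc m)) 0 (Suc m) g)"
proof (induction m)
  case 0
  have "iterated_coproduct 0 = Uq.pos 1 0" by (rule ext) (simp add: Uq.pos_def)
  moreover have "cprod_in (Uq_pow 1) (Uq_pos 1 0) (triv_in (Uq_pow 1)) = Uq_pos 1 0"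
    by (rule cprod_in_triv[OF Uq_pow_algebra]) (simp add: Uq_pos_closed)
  ultimately show ?case
    using Uq.pos_hom[of 0 1] by (simp add: Uq_pow) (simp add: Uq_pos_def)
next
  case (Suc m)
  let ?N = "2 + m" let ?B = "Uq_pow ?N" let ?X = "Uq_pos ?N"
  let ?Y = "\<lambda>k g. coproduct_first m (Uq_pos (Suc m) k g)"
  have eq: "iterated_coproduct (Suc m) = (\<lambda>x. coproduct_first m (iterated_coproduct m x))" by (rule ext) simp
  have hom: "alg_hom Uq ?B (iterated_coproduct (Suc m))"
    unfolding eq using Suc coproduct_first_hom by (blast intro: alg_hom_comp)
  have "iterated_coproduct (Suc m) (uq g) = block_in ?B ?X 0 ?N g" for g
  proof -
    have c: "?X i g \<in> carrier ?B" if "i < ?N" for i g using that by (rule Uq_pos_closed)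
    have b: "block_in ?B ?X 2 m g \<in> carrier ?B" for g
      by (rule block_in_closed[OF Uq_pow_algebra c])
    have "iterated_coproduct (Suc m) (uq g) = coproduct_first m (block_in (Uq_pow (Suc m)) (Uq_pos (Suc m)) 0 (Suc m) g)"
      using Suc by simp
    also have "\<dots> = block_in ?B ?Y 0 (Suc m) g"
      by (rule block_in_hom[OF Uq_pow_algebra Uq_pow_algebra coproduct_first_hom]) (simp add: Uq_pos_closed)
    also have "\<dots> = cprod_in ?B (?Y 0) (block_in ?B ?Y 1 m) g" by simp
    also have "?Y 0 = cprod_in ?B (?X 0) (?X 1)" by (rule ext) (rule coproduct_first_pos_0)
    also have "block_in ?B ?Y 1 m = block_in ?B ?X 2 m"
      by (rule block_in_cong, rule ext) (simp add: coproduct_first_pos_Suc del: add_2_eq_Suc)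
    also have "cprod_in ?B (cprod_in ?B (?X 0) (?X 1)) (block_in ?B ?X 2 m) = cprod_in ?B (?X 0) (cprod_in ?B (?X 1) (block_in ?B ?X 2 m))"
      by (rule cprod_in_assoc[OF Uq_pow_algebra]) (simp_all add: c b del: add_2_eq_Suc)
    also have "\<dots> = block_in ?B ?X 0 ?N" by (simp add: numeral_2_eq_2)
    finally show ?thesis .
  qed
  then show ?case using hom by (simp del: iterated_coproduct.simps block_in.simps)
qed

lemma casimir_eq: "casimir = casimir_in Uq uq"
  by (simp add: casimir_def casimir_in_def)

lemma block_pos_closed: "i + c \<le> n \<Longrightarrow> block_in (Uq_pow n) (Uq_pos n) i c g \<in> carrier (Uq_pow n)"
  by (rule block_in_closed[OF Uq_pow_algebra]) (simp add: Uq_pos_closed)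

lemma intermediate_casimir_interval:
  assumes "1 \<le> i" "i \<le> j" "j \<le> n"
  shows "intermediate_casimir n {i..j} = casimir_in (Uq_pow n) (block_in (Uq_pow n) (Uq_pos n) (i - 1) (Suc j - i))"
proof -
  \<comment> \<open>\<open>a\<close> tensor factors precede the interval, \<open>c\<close> belong to
    it and \<open>d\<close> follow it. The interval counts from 1 and tensor positions from 0,
    whence the start \<open>i - 1\<close>.\<close>
  define a c d where "a = i - 1" and "c = Suc (j - i)" and "d = n - j"
  have n: "a + (c + d) = n" using assms by (simp add: a_def c_def d_def)
  have m: "Min {i..j} = i" "Max {i..j} = j" using assms by (auto intro!: Min_eqI Max_eqI)
  have casc: "casimir \<in> carrier Uq" unfolding casimir_eq by (simp add: casimir_in_def)
  let ?Q = "iterated_coproduct (j - i) casimir"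
  note it = iterated_coproduct[of "j - i", folded c_def]
  note l = Uq.left_hom[of c d] and r = Uq.right_hom[of "c + d" a]
  have Q: "?Q \<in> carrier (Uq_pow c)" by (rule alg_homD(1)[OF conjunct1[OF it] casc])
  have lQ: "tensor_concat Uq c d ?Q \<one>\<^bsub>Uq_pow d\<^esub> = Uq.left c d ?Q"
  proof -
    interpret T: assoc_algebra "tensor_power Uq (c + d)" by (rule Uq.tensor_power)
    show ?thesis
      using Q assoc_algebra_closed(2)[OF Uq.tensor_power[of d]] alg_homD(1)[OF l]
      by (simp add: Uq_pow Uq.tensor_concat alg_homD(4)[OF Uq.right_hom])
  qed
  have LQ: "Uq.left c d ?Q \<in> carrier (Uq_pow (c + d))" using Q alg_homD(1)[OF l] by (simp add: Uq_pow)
  have "intermediate_casimir n {i..j} = tensor_concat Uq a (c + d) \<one>\<^bsub>Uq_pow a\<^esub> (Uq.left c d ?Q)"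
    unfolding intermediate_casimir_def Let_def m using lQ by (simp add: a_def c_def d_def)
  also have "\<dots> = Uq.right a (c + d) (Uq.left c d ?Q)"
  proof -
    interpret T: assoc_algebra "tensor_power Uq (a + (c + d))" by (rule Uq.tensor_power)
    show ?thesis
      using LQ assoc_algebra_closed(2)[OF Uq.tensor_power[of a]] alg_homD(1)[OF r]
      by (simp add: Uq_pow Uq.tensor_concat alg_homD(4)[OF Uq.left_hom])
  qed
  finally have 1: "intermediate_casimir n {i..j} = Uq.right a (c + d) (Uq.left c d ?Q)" .
  \<comment> \<open>Tensoring with units on both sides is an algebra morphism that moves position
    \<open>k\<close> to \<open>a + k\<close>, so it commutes with forming blocks and Casimir
    elements.\<close>
  define f where "f x = Uq.right a (c + d) (Uq.left c d x)" for x
  have f: "alg_hom (Uq_pow c) (Uq_pow n) f"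
    unfolding f_def using alg_hom_comp[OF l r] by (simp add: Uq_pow n)
  have f_pos: "f (Uq_pos c k g) = Uq_pos n (a + k) g" if "k < c" for k g
    using that unfolding f_def Uq_pos_def by (simp add: Uq.left_pos Uq.right_pos n)
  have "intermediate_casimir n {i..j} = f (casimir_in (Uq_pow c) (\<lambda>g. iterated_coproduct (j - i) (uq g)))"
    unfolding 1 f_def[symmetric] casimir_eq
    by (subst casimir_in_hom(1)[OF Uq.assoc_algebra_axioms]) (use it in auto)
  also have "\<dots> = casimir_in (Uq_pow n) (\<lambda>g. f (block_in (Uq_pow c) (Uq_pos c) 0 c g))"
    using it block_pos_closed[of 0 c c] by (simp add: casimir_in_hom(1)[OF Uq_pow_algebra f])
  also have "(\<lambda>g. f (block_in (Uq_pow c) (Uq_pos c) 0 c g)) = block_in (Uq_pow n) (\<lambda>k g. f (Uq_pos c k g)) 0 c"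
    by (rule ext, rule block_in_hom[OF Uq_pow_algebra Uq_pow_algebra f]) (simp add: Uq_pos_closed)
  also have "\<dots> = block_in (Uq_pow n) (Uq_pos n) a c"
    by (rule block_in_cong, rule ext) (simp add: f_pos)
  finally show ?thesis using assms by (simp add: a_def c_def Suc_diff_le)
qed

section \<open>The morphism\<close>

text \<open>Ensures that every generator occurring in \<open>aw_C2 n I J\<close> has a connected
  index, so that \<open>aw_C2 n I J\<close> lies in \<open>aw_free n\<close> and can be
  evaluated.\<close>

definition casimir_index :: "nat \<Rightarrow> nat set \<Rightarrow> nat set \<Rightarrow> bool" where
  "casimir_index n I J \<longleftrightarrow> I \<in> connected_subsets n \<and> J \<in> connected_subsets n \<and>
     (adjacent n I J \<or> hole I J \<in> connected_subsets n \<and> I \<union> hole I J \<in> connected_subsets n \<and>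
       hole I J \<union> J \<in> connected_subsets n \<and> I \<union> hole I J \<union> J \<in> connected_subsets n)"

lemma casimir_index_adjacent: "adjacent n I J \<Longrightarrow> casimir_index n I J"
  by (simp add: casimir_index_def adjacent_def)

lemma casimir_index_chain:
  assumes "next_interval n I J \<and> next_interval n J K \<or> next_interval n K J \<and> next_interval n J I"
  shows "casimir_index n I K" "I \<union> J \<union> K \<in> connected_subsets n"
proof -
  have "hole I K = J \<and> adjacent n I J \<and> adjacent n J K \<and> adjacent n (I \<union> J) K"
    using assms
  proof
    assume a: "next_interval n I J \<and> next_interval n J K"
    then show ?thesis
      using next_interval_chain[of n I J K] next_interval_adjacent[of n I J] next_interval_adjacent[of n J K]
        next_interval_adjacent[of n "I \<union> J" K] by simp
  next
    assume a: "next_interval n K J \<and> next_interval n J I"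
    then show ?thesis
      using next_interval_chain[of n K J I] next_interval_adjacent[of n K J] next_interval_adjacent[of n J I]
        next_interval_adjacent[of n K "J \<union> I"] by (simp add: Un_commute)
  qed
  then show "casimir_index n I K" "I \<union> J \<union> K \<in> connected_subsets n"
    by (simp_all add: casimir_index_def adjacent_def)
qed

lemma monotonic3_index:
  assumes "monotonic_adjacent n [I, J, K]"
  shows "casimir_index n I J" "casimir_index n J K" "casimir_index n I K" "I \<union> J \<union> K \<in> connected_subsets n"
proof -
  have c: "next_interval n I J \<and> next_interval n J K \<or> next_interval n K J \<and> next_interval n J I"
    using monotonic_adjacent_cases[OF assms] by auto
  then show "casimir_index n I J" "casimir_index n J K"
    by (auto intro!: casimir_index_adjacent dest: next_interval_adjacent)
  show "casimir_index n I K" "I \<union> J \<union> K \<in> connected_subsets n"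
    using casimir_index_chain[OF c] .
qed

lemma monotonic4_index:
  assumes "monotonic_adjacent n [I, J, K, L]"
  shows "casimir_index n I L" "casimir_index n I K" "casimir_index n K L" "casimir_index n I (K \<union> L)"
proof -
  consider (inc) "next_interval n I J" "next_interval n J K" "next_interval n K L"
    | (dec) "next_interval n J I" "next_interval n K J" "next_interval n L K"
    using monotonic_adjacent_cases[OF assms] by auto
  then have "(next_interval n I J \<and> next_interval n J K \<or> next_interval n K J \<and> next_interval n J I) \<and>
    (next_interval n I (J \<union> K) \<and> next_interval n (J \<union> K) L \<or> next_interval n L (J \<union> K) \<and> next_interval n (J \<union> K) I) \<and>
    (next_interval n I J \<and> next_interval n J (K \<union> L) \<or> next_interval n (K \<union> L) J \<and> next_interval n J I) \<and>
    adjacent n K L"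
  proof cases
    case inc
    then show ?thesis
      using next_interval_chain(1)[OF inc(1,2)] next_interval_chain(2)[OF inc(2,3)]
        next_interval_chain(1)[OF inc(2,3)] next_interval_adjacent(1)[OF inc(3)] by blast
  next
    case dec
    then show ?thesis
      using next_interval_chain(2)[OF dec(2,1)] next_interval_chain(1)[OF dec(3,2)]
        next_interval_chain(2)[OF dec(3,2)] next_interval_adjacent(2)[OF dec(3)]
      by (simp add: Un_commute)
  qed
  then have c: "next_interval n I J \<and> next_interval n J K \<or> next_interval n K J \<and> next_interval n J I"
    "next_interval n I (J \<union> K) \<and> next_interval n (J \<union> K) L \<or> next_interval n L (J \<union> K) \<and> next_interval n (J \<union> K) I"
    "next_interval n I J \<and> next_interval n J (K \<union> L) \<or> next_interval n (K \<union> L) J \<and> next_interval n J I"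
    "adjacent n K L"
    by blast+
  show "casimir_index n I L" "casimir_index n I K" "casimir_index n K L" "casimir_index n I (K \<union> L)"
    using casimir_index_chain(1)[OF c(1)] casimir_index_chain(1)[OF c(2)] casimir_index_chain(1)[OF c(3)]
      casimir_index_adjacent[OF c(4)] by simp_all
qed

text \<open>Indices count from 1, as in connected subsets. The trivial representation elsewhere
  makes the family total, as \<open>commuting_reps\<close> demands.\<close>

definition Uq_quad :: "nat \<Rightarrow> nat \<Rightarrow> uq_gen \<Rightarrow> (Cq, Uq_tensor) alg_section" where
  "Uq_quad n k = (if 1 \<le> k \<and> k \<le> n then extend (Uq_pow n) (Uq_pos n (k - 1)) else alg_section.triv)"

interpretation Uq_reps: commuting_reps "scale_alg_section :: Cq \<Rightarrow> (Cq, Uq_tensor) alg_section \<Rightarrow> (Cq, Uq_tensor) alg_section"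
  qv "inverse qv" "Uq_quad n" for n
proof
  fix i j :: nat
  show "alg_section.rep (Uq_quad n i)"
    unfolding Uq_quad_def by (auto intro!: rep_extend rep_in_pos alg_section.rep_triv)
  assume ij: "i \<noteq> j"
  show "alg_section.commuting (Uq_quad n i) (Uq_quad n j)"
  proof (cases "(1 \<le> i \<and> i \<le> n) \<and> (1 \<le> j \<and> j \<le> n)")
    case True
    then have "alg_section.commuting (extend (Uq_pow n) (Uq_pos n (i - 1))) (extend (Uq_pow n) (Uq_pos n (j - 1)))"
      using ij by (intro commuting_extend rep_in_pos commuting_in_pos) auto
    then show ?thesis using True by (simp add: Uq_quad_def)
  next
    case False
    then show ?thesis unfolding Uq_quad_def
      by (auto intro: alg_section.commuting_triv alg_section.commuting_sym[OF alg_section.commuting_triv])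
  qed
qed

lemma at_block:
  assumes A: "assoc_algebra A"
  shows "at_algebra (Uq_reps.block n i c g) A = block_in A (\<lambda>k g. at_algebra (Uq_quad n k g) A) i c g"
proof (induction c arbitrary: i g)
  case 0 then show ?case by (simp add: at_triv A)
next
  case (Suc c) then show ?case by (simp add: at_cprod A)
qed

lemma at_C:
  assumes "I \<in> connected_subsets n"
  shows "at_algebra (Uq_reps.C n I) (Uq_pow n) = intermediate_casimir n I"
proof -
  obtain a b where I: "1 \<le> a" "a \<le> b" "b \<le> n" "I = {a..b}" using assms by (rule connected_subsetsE)
  have "block_in (Uq_pow n) (\<lambda>k g. at_algebra (Uq_quad n k g) (Uq_pow n)) a (Suc b - a) =
      block_in (Uq_pow n) (Uq_pos n) (a - 1) (Suc b - a)"
  proof (rule block_in_cong, rule ext)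
    fix k g assume k: "k < Suc b - a"
    \<comment> \<open>Subtraction is truncated here, so the last equation depends on
      \<open>1 \<le> a\<close>.\<close>
    then have "1 \<le> a + k \<and> a + k \<le> n" "a + k - 1 < n" "a + k - 1 = a - 1 + k" using I by auto
    then show "at_algebra (Uq_quad n (a + k) g) (Uq_pow n) = Uq_pos n (a - 1 + k) g"
      by (simp add: Uq_quad_def at_extend[OF Uq_pos_closed Uq_pow_algebra])
  qed
  then show ?thesis
    using I intermediate_casimir_interval[OF I(1-3)]
    by (simp add: Uq_reps.C_def at_cas[OF Uq_pow_algebra] Uq_reps.D_interval at_block[OF Uq_pow_algebra] eta_contract_eq)
qed

lemma at_qbracket: "at_algebra (alg_section.qbracket x y) A = qcomm A (at_algebra x A) (at_algebra y A)" if "assoc_algebra A"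
  by (simp add: alg_section.qbracket_def qcomm_def at_simps[OF that])

lemma alg_hom_qcomm:
  assumes "assoc_algebra A" "assoc_algebra B" "alg_hom A B f" "x \<in> carrier A" "y \<in> carrier A"
  shows "f (qcomm A x y) = qcomm B (f x) (f y)" "qcomm A x y \<in> carrier A"
  using assms(4,5) by (simp_all add: qcomm_def alg_homD[OF assms(3)] alg_hom_minus[OF assms(1-3)]
      assoc_algebra_closed[OF assms(1)])

section \<open>Evaluation of the defining relations at Casimir elements\<close>

context
  fixes n :: nat
begin

abbreviation "eval_casimir \<equiv> eval_free (Uq_pow n) (intermediate_casimir n)"

lemma casimir_closed: "I \<in> connected_subsets n \<Longrightarrow> intermediate_casimir n I \<in> carrier (Uq_pow n)"
  by (simp add: at_closed[OF Uq_pow_algebra] flip: at_C)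

lemma aw_free_algebra: "assoc_algebra (aw_free n)"
  unfolding aw_free_def by (rule free_algebra)

lemma eval_casimir_hom: "alg_hom (aw_free n) (Uq_pow n) eval_casimir"
  unfolding aw_free_def by (rule eval_free_hom[OF Uq_pow_algebra casimir_closed])

lemma aw_gen_closed: "I \<in> connected_subsets n \<Longrightarrow> gen I \<in> carrier (aw_free n)"
  unfolding aw_free_def by (rule gen_carrier)

lemma eval_casimir_gen: "I \<in> connected_subsets n \<Longrightarrow> eval_casimir (gen I) = at_algebra (Uq_reps.C n I) (Uq_pow n)"
  by (simp add: at_C eval_free_gen[OF Uq_pow_algebra casimir_closed])

lemmas eval_casimir_simps = alg_homD[OF eval_casimir_hom] alg_hom_minus[OF aw_free_algebra Uq_pow_algebra eval_casimir_hom]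
  alg_hom_uminus[OF aw_free_algebra Uq_pow_algebra eval_casimir_hom]
  alg_hom_qcomm[OF aw_free_algebra Uq_pow_algebra eval_casimir_hom]
  assoc_algebra_closed[OF aw_free_algebra] at_simps[OF Uq_pow_algebra] at_qbracket[OF Uq_pow_algebra]

text \<open>In \<open>Uq_reps.C2 n n I J\<close> the first \<open>n\<close> is the parameter of the
  interpretation, and the second bounds the sets in \<open>adjacent\<close>.\<close>

lemma eval_casimir_C2:
  assumes "casimir_index n I J"
  shows "aw_C2 n I J \<in> carrier (aw_free n)" "eval_casimir (aw_C2 n I J) = at_algebra (Uq_reps.C2 n n I J) (Uq_pow n)"
proof -
  have "aw_C2 n I J \<in> carrier (aw_free n) \<and> eval_casimir (aw_C2 n I J) = at_algebra (Uq_reps.C2 n n I J) (Uq_pow n)"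
  proof (cases "adjacent n I J")
    case True
    then have "I \<union> J \<in> connected_subsets n" by (simp add: adjacent_def)
    then show ?thesis using True by (simp add: aw_C2_def Uq_reps.C2_def aw_gen_closed eval_casimir_gen)
  next
    case False
    \<comment> \<open>Without \<open>uminus_add_conv_diff\<close> a sum that begins with a negated
      bracket keeps this shape in the ring of sections, and so matches the record term; the rule
      would turn it into a difference.\<close>
    then show ?thesis using assms
      by (simp add: aw_C2_def Uq_reps.C2_def casimir_index_def Let_def aw_gen_closed eval_casimir_gen eval_casimir_simps
        del: uminus_add_conv_diff)
  qed
  then show "aw_C2 n I J \<in> carrier (aw_free n)" "eval_casimir (aw_C2 n I J) = at_algebra (Uq_reps.C2 n n I J) (Uq_pow n)"
    by auto
qed

lemma aw_relation_holds:
  assumes "r \<in> aw_relations n" shows "r \<in> carrier (aw_free n)" "eval_casimir r = \<zero>\<^bsub>Uq_pow n\<^esub>"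
proof -
  interpret F: assoc_algebra "aw_free n" by (rule aw_free_algebra)
  interpret B: assoc_algebra "Uq_pow n" by (rule Uq_pow_algebra)
  have zero: "at_algebra x (Uq_pow n) \<ominus>\<^bsub>Uq_pow n\<^esub> at_algebra y (Uq_pow n) = \<zero>\<^bsub>Uq_pow n\<^esub>"
    if "x = y" for x y :: "(Cq, Uq_tensor) alg_section"
    using that by (simp add: at_closed[OF Uq_pow_algebra])
  have "r \<in> carrier (aw_free n) \<and> eval_casimir r = \<zero>\<^bsub>Uq_pow n\<^esub>"
    using assms unfolding aw_relations_def Let_def
  proof (elim UnE CollectE exE conjE)
    fix I J
    assume r: "r = gen I \<otimes>\<^bsub>aw_free n\<^esub> gen J \<ominus>\<^bsub>aw_free n\<^esub> gen J \<otimes>\<^bsub>aw_free n\<^esub> gen I"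
      and IJ: "I \<in> connected_subsets n" "J \<in> connected_subsets n" "I \<inter> J = {} \<or> I \<subseteq> J"
    have "Uq_reps.C n I * Uq_reps.C n J = Uq_reps.C n J * Uq_reps.C n I"
      using IJ Uq_reps.C_commute_disjoint Uq_reps.C_commute_subset by blast
    from zero[OF this] show ?thesis
      unfolding r using IJ by (simp add: aw_gen_closed eval_casimir_gen eval_casimir_simps)
  next
    fix I J K
    assume r: "r = aw_C2 n I J \<ominus>\<^bsub>aw_free n\<^esub> (\<ominus>\<^bsub>aw_free n\<^esub> qcomm (aw_free n) (aw_C2 n J K) (aw_C2 n I K)
        \<oplus>\<^bsub>aw_free n\<^esub> gen I \<otimes>\<^bsub>aw_free n\<^esub> gen J \<oplus>\<^bsub>aw_free n\<^esub> gen K \<otimes>\<^bsub>aw_free n\<^esub> gen (I \<union> J \<union> K))"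
      and m: "monotonic_adjacent n [I, J, K]"
    have c: "I \<in> connected_subsets n" "J \<in> connected_subsets n" "K \<in> connected_subsets n"
      using m by (simp_all add: monotonic_adjacent_def)
    note index = monotonic3_index[OF m]
    from zero[OF Uq_reps.C2_relation3[OF m, of n]] show ?thesis
      unfolding r using c index(4)
      by (simp add: aw_gen_closed eval_casimir_gen eval_casimir_C2[OF index(1)] eval_casimir_C2[OF index(2)] eval_casimir_C2[OF index(3)] eval_casimir_simps
        del: uminus_add_conv_diff)
  next
    fix I J K L
    assume r: "r = aw_C2 n I L \<ominus>\<^bsub>aw_free n\<^esub> (\<ominus>\<^bsub>aw_free n\<^esub> qcomm (aw_free n) (aw_C2 n I K) (aw_C2 n K L)
        \<oplus>\<^bsub>aw_free n\<^esub> gen I \<otimes>\<^bsub>aw_free n\<^esub> gen L \<oplus>\<^bsub>aw_free n\<^esub> gen K \<otimes>\<^bsub>aw_free n\<^esub> aw_C2 n I (K \<union> L))"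
      and m: "monotonic_adjacent n [I, J, K, L]"
    have c: "I \<in> connected_subsets n" "L \<in> connected_subsets n" "K \<in> connected_subsets n"
      using m by (simp_all add: monotonic_adjacent_def)
    note index = monotonic4_index[OF m]
    from zero[OF Uq_reps.C2_relation4[OF m, of n]] show ?thesis
      unfolding r using c
      by (simp add: aw_gen_closed eval_casimir_gen eval_casimir_C2[OF index(1)] eval_casimir_C2[OF index(2)] eval_casimir_C2[OF index(3)]
          eval_casimir_C2[OF index(4)] eval_casimir_simps del: uminus_add_conv_diff)
  qed
  then show "r \<in> carrier (aw_free n)" "eval_casimir r = \<zero>\<^bsub>Uq_pow n\<^esub>" by auto
qed

end

theorem mainTheorem8:
  fixes n :: nat
  assumes "n \<ge> 1"
  shows "\<exists>\<phi>. alg_hom (aw n) (Uq_pow n) \<phi> \<and>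
      (\<forall>I \<in> connected_subsets n. \<phi> (aw_C n I) = intermediate_casimir n I) \<and>
      (\<forall>\<psi>. alg_hom (aw n) (Uq_pow n) \<psi> \<and>
          (\<forall>I \<in> connected_subsets n. \<psi> (aw_C n I) = intermediate_casimir n I) \<longrightarrow>
          (\<forall>x \<in> carrier (aw n). \<psi> x = \<phi> x)) \<and>
      \<phi> ` carrier (aw n) =
        subalgebra_generated (Uq_pow n) (intermediate_casimir n ` connected_subsets n)"
proof -
  let ?B = "Uq_pow n" and ?g = "intermediate_casimir n"
  define \<phi> where "\<phi> = presented_lift ?B ?g"
  have R: "aw_relations n \<subseteq> carrier (free_algebra (connected_subsets n))"
    using aw_relation_holds(1)[of _ n] by (auto simp: aw_free_def)
  have lift: "\<phi> (presented_class (connected_subsets n) (aw_relations n) p) = eval_casimir n p"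
    if "p \<in> carrier (free_algebra (connected_subsets n))" for p
    unfolding \<phi>_def
    by (rule presented_lift(2)[OF Uq_pow_algebra casimir_closed R aw_relation_holds(2) that])
  have aw: "assoc_algebra (aw n)" unfolding aw_def by (rule presented_algebra[OF R])
  have hom: "alg_hom (aw n) ?B \<phi>" unfolding \<phi>_def aw_def
    by (rule presented_lift(1)[OF Uq_pow_algebra casimir_closed R aw_relation_holds(2)])
  have gens: "\<phi> (aw_C n I) = ?g I" if I: "I \<in> connected_subsets n" for I
    using lift[OF gen_carrier[OF I]] eval_casimir_gen[OF I] at_C[OF I] by (simp add: aw_C_def)
  have generated: "carrier (aw n) \<subseteq> S"
    if "is_subalgebra (aw n) S" "\<And>I. I \<in> connected_subsets n \<Longrightarrow> aw_C n I \<in> S" for S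
    using that presented_generated[OF R, of S] by (simp add: aw_def aw_C_def)
  have gen_closed: "aw_C n I \<in> carrier (aw n)" if I: "I \<in> connected_subsets n" for I
    unfolding aw_C_def aw_def using presented_carrier[OF R] gen_carrier[OF I] by blast
  have unique: "\<psi> x = \<phi> x" if \<psi>: "alg_hom (aw n) ?B \<psi>" "\<And>I. I \<in> connected_subsets n \<Longrightarrow> \<psi> (aw_C n I) = ?g I"
    and x: "x \<in> carrier (aw n)" for \<psi> x
  proof -
    \<comment> \<open>The equaliser of the two morphisms is a subalgebra that contains the
      generators.\<close>
    have "carrier (aw n) \<subseteq> {x \<in> carrier (aw n). \<psi> x = \<phi> x}"
      by (rule generated[OF alg_hom_equaliser_subalgebra[OF aw Uq_pow_algebra \<psi>(1) hom]])
        (simp add: gen_closed gens \<psi>(2))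
    then show ?thesis using x by blast
  qed
  have "\<phi> ` carrier (aw n) = subalgebra_generated ?B (?g ` connected_subsets n)"
  proof
    show "\<phi> ` carrier (aw n) \<subseteq> subalgebra_generated ?B (?g ` connected_subsets n)"
      unfolding subalgebra_generated_def
    proof (rule Inter_greatest, elim CollectE conjE)
      fix S assume S: "is_subalgebra ?B S" "?g ` connected_subsets n \<subseteq> S"
      \<comment> \<open>The preimage of \<open>S\<close> is a subalgebra that contains the
        generators, and so is everything.\<close>
      have "carrier (aw n) \<subseteq> {x \<in> carrier (aw n). \<phi> x \<in> S}"
        by (rule generated[OF alg_hom_preimage_subalgebra[OF aw Uq_pow_algebra hom S(1)]])
          (use S(2) in \<open>auto simp: gen_closed gens\<close>)
      then show "\<phi> ` carrier (aw n) \<subseteq> S" by blast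
    qed
    have "?g ` connected_subsets n \<subseteq> \<phi> ` carrier (aw n)"
    proof (rule image_subsetI)
      fix I assume "I \<in> connected_subsets n"
      then show "?g I \<in> \<phi> ` carrier (aw n)" by (intro image_eqI[of _ _ "aw_C n I"] gen_closed) (simp_all add: gens)
    qed
    then show "subalgebra_generated ?B (?g ` connected_subsets n) \<subseteq> \<phi> ` carrier (aw n)"
      unfolding subalgebra_generated_def
      by (intro Inter_lower CollectI conjI alg_hom_image_subalgebra[OF aw Uq_pow_algebra hom])
  qed
  moreover have "\<forall>\<psi>. alg_hom (aw n) ?B \<psi> \<and> (\<forall>I \<in> connected_subsets n. \<psi> (aw_C n I) = ?g I) \<longrightarrow>
      (\<forall>x \<in> carrier (aw n). \<psi> x = \<phi> x)"
    by (intro allI impI ballI, elim conjE, rule unique) simp_all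
  ultimately show ?thesis
    by (intro exI[of _ \<phi>] conjI ballI hom gens)
qed

end
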